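(* Let $0<\beta<\alpha<1$. Then the Bessel fractional derivative of order $\beta$, $\mathcal{D}^\beta: Lip_\alpha(\gamma)\to Lip_{\alpha-\beta}(\gamma)$, is bounded; that is, $\mathcal{D}^\beta f\in Lip_{\alpha-\beta}(\gamma)$ for every $f\in Lip_\alpha(\gamma)$ and there is a constant $C$, independent of $f$, such that $\|\mathcal{D}^\beta f\|_{Lip_{\alpha-\beta}(\gamma)}\le C\|f\|_{Lip_\alpha(\gamma)}$ for all $f\in Lip_\alpha(\gamma)$.
   Context: Fix $d\ge 1$ and let $d\gamma(x)=\pi^{-d/2}e^{-|x|^2}dx$ be the Gaussian measure on $\mathbb{R}^d$; $\|\cdot\|_\infty$ is the norm of $L^\infty=L^\infty(\gamma)$. The Ornstein-Uhlenbeck semigroup is $T_0f=f$ and, for $t>0$, $$T_tf(x)=\frac{1}{\pi^{d/2}(1-e^{-2t})^{d/2}}\int_{\mathbb{R}^d}\exp\left(-\frac{|y-e^{-t}x|^2}{1-e^{-2t}}\right)f(y)\,dy ,$$ with generator $L=\frac12\Delta-\langle x,\nabla\rangle$. The Poisson-Hermite semigroup (generator $-(-L)^{1/2}$) is $$P_tf(x)=\frac{1}{\sqrt{\pi}}\int_0^\infty\frac{e^{-u}}{\sqrt{u}}\,T_{t^2/4u}f(x)\,du,\quad t>0,\qquad P_0f=f.$$ Gaussian Lipschitz spaces: for $\alpha>0$ let $n$ be the smallest integer greater than $\alpha$. $Lip_\alpha(\gamma)$ is the set of $f\in L^\infty$ for which there is a constant $A$ such that $\left\|\frac{\partial^nP_tf}{\partial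 t^n}\right\|_\infty\le A\,t^{-n+\alpha}$ for all $t>0$. The smallest such $A$ is denoted $A_\alpha(f)$, and $\|f\|_{Lip_\alpha(\gamma)}=\|f\|_\infty+A_\alpha(f)$. The Bessel fractional derivative of order $\beta$, formally $\mathcal{D}^\beta=(I+\sqrt{-L})^{\beta}$, is given for $0<\beta<1$ by $$\mathcal{D}^\beta f=\frac{1}{c_\beta}\int_0^\infty s^{-\beta-1}(e^{-s}P_sf-f)\,ds,\qquad c_\beta=\int_0^\infty u^{-\beta-1}(e^{-u}-1)\,du .$$ *)

theory Defs
  imports "HOL-Probability.Probability"
begin

text \<open>
  Elements of \<open>L\<^sup>\<infinity>(\<gamma>)\<close> are represented by Borel functions rather than by equivalence classes.
  The operators below only see the class of their argument: for \<open>t > 0\<close> they are given by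
  integrals of \<open>f\<close> against a density, so changing \<open>f\<close> on a null set changes \<open>T\<^sub>t f\<close> and \<open>P\<^sub>t f\<close>
  nowhere and \<open>D\<^sup>\<beta> f\<close> only on that null set.
\<close>

definition gauss_measure :: "'a::euclidean_space measure" where
  "gauss_measure =
     density lborel (\<lambda>x. ennreal (pi powr (- real DIM('a) / 2) * exp (- (norm x)\<^sup>2)))"

definition Linf_norm :: "('a::euclidean_space \<Rightarrow> real) \<Rightarrow> ereal" where
  "Linf_norm f = esssup gauss_measure (\<lambda>x. ereal \<bar>f x\<bar>)"

definition Linf :: "('a::euclidean_space \<Rightarrow> real) set" where
  "Linf = {f \<in> borel_measurable gauss_measure. Linf_norm f < \<infinity>}"

text \<open>Only \<open>t \<ge> 0\<close> is meaningful in the two semigroups; negative times are treated like \<open>t = 0\<close>.\<close>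

definition ou_semigroup :: "real \<Rightarrow> ('a::euclidean_space \<Rightarrow> real) \<Rightarrow> 'a \<Rightarrow> real" where
  "ou_semigroup t f x =
     (if t > 0
      then 1 / (pi powr (real DIM('a) / 2) * (1 - exp (- 2 * t)) powr (real DIM('a) / 2)) *
           (LINT y|lborel.
              exp (- ((norm (y - exp (- t) *\<^sub>R x))\<^sup>2 / (1 - exp (- 2 * t)))) * f y)
      else f x)"

definition poisson_hermite :: "real \<Rightarrow> ('a::euclidean_space \<Rightarrow> real) \<Rightarrow> 'a \<Rightarrow> real" where
  "poisson_hermite t f x =
     (if t > 0
      then 1 / sqrt pi *
           (LINT u:{0<..}|lborel. exp (- u) / sqrt u * ou_semigroup (t\<^sup>2 / (4 * u)) f x)
      else f x)"

definition lip_order :: "real \<Rightarrow> nat" where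
  "lip_order \<alpha> = (LEAST n. \<alpha> < real n)"

text \<open>
  The time derivative is taken pointwise in \<open>x\<close>. For \<open>f\<close> in \<open>L\<^sup>\<infinity>(\<gamma>)\<close> the map \<open>t \<mapsto> P\<^sub>t f(x)\<close> is
  smooth on \<open>(0, \<infinity>)\<close> for every \<open>x\<close>, so \<^const>\<open>deriv\<close> is only used where derivatives exist.
\<close>

definition lip_bound :: "real \<Rightarrow> ('a::euclidean_space \<Rightarrow> real) \<Rightarrow> real \<Rightarrow> bool" where
  "lip_bound \<alpha> f A \<longleftrightarrow>
     (\<forall>t>0. Linf_norm (\<lambda>x. (deriv ^^ lip_order \<alpha>) (\<lambda>s. poisson_hermite s f x) t)
              \<le> ereal (A * t powr (- real (lip_order \<alpha>) + \<alpha>)))"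

definition gauss_lip :: "real \<Rightarrow> ('a::euclidean_space \<Rightarrow> real) set" where
  "gauss_lip \<alpha> = {f \<in> Linf. \<exists>A. lip_bound \<alpha> f A}"

definition lip_const :: "real \<Rightarrow> ('a::euclidean_space \<Rightarrow> real) \<Rightarrow> real" where
  "lip_const \<alpha> f = (LEAST A. lip_bound \<alpha> f A)"

definition gauss_lip_norm :: "real \<Rightarrow> ('a::euclidean_space \<Rightarrow> real) \<Rightarrow> ereal" where
  "gauss_lip_norm \<alpha> f = Linf_norm f + ereal (lip_const \<alpha> f)"

definition bessel_integrand :: "real \<Rightarrow> ('a::euclidean_space \<Rightarrow> real) \<Rightarrow> 'a \<Rightarrow> real \<Rightarrow> real" where
  "bessel_integrand \<beta> f x s = s powr (- \<beta> - 1) * (exp (- s) * poisson_hermite s f x - f x)"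

definition bessel_const :: "real \<Rightarrow> real" where
  "bessel_const \<beta> = (LINT u:{0<..}|lborel. u powr (- \<beta> - 1) * (exp (- u) - 1))"

text \<open>
  The Lebesgue integral is \<open>0\<close> by convention where the integrand is not integrable, so a statement
  about \<open>D\<^sup>\<beta> f\<close> should come with integrability for almost every \<open>x\<close>.
\<close>

definition bessel_deriv :: "real \<Rightarrow> ('a::euclidean_space \<Rightarrow> real) \<Rightarrow> 'a \<Rightarrow> real" where
  "bessel_deriv \<beta> f x = 1 / bessel_const \<beta> * (LINT s:{0<..}|lborel. bessel_integrand \<beta> f x s)"

end

theory Submission
  imports Defs
begin

text \<open>
  Write \<open>Q\<^sub>t f\<close> for the time derivative of \<open>P\<^sub>t f\<close>. The theorem rests on four facts.

  First, \<open>P\<^sub>t f(x)\<close> is the average of \<open>T\<^sub>r f(x)\<close> over a random time \<open>r\<close> with the one-sided stable law of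
  index \<open>1/2\<close>. The density of this law is explicit. Differentiating it in \<open>t\<close> costs a factor
  \<open>8/t\<close>, so \<open>|Q\<^sub>t f| \<le> (8/t) sup |f|\<close> (\<open>stable_density_deriv_bound\<close>, \<open>poisson_op_deriv_bound\<close>).

  Second, \<open>P\<^sub>s P\<^sub>t = P\<^sub>s\<^sub>+\<^sub>t\<close> (\<open>poisson_op_add\<close>), hence \<open>Q\<^sub>s\<^sub>+\<^sub>t f = P\<^sub>s Q\<^sub>t f = Q\<^sub>s P\<^sub>t f\<close>. The law of the
  random time is closed under convolution by the Cauchy-Schloemilch substitution
  (\<open>cauchy_schloemilch\<close>), and \<open>T\<close> is a semigroup because the law of \<open>(z, a z + b w)\<close> for independent
  Gaussian \<open>z\<close>, \<open>w\<close> and \<open>a\<^sup>2 + b\<^sup>2 = 1\<close> is symmetric in its two components (\<open>gauss_exchange\<close>).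

  Third, let \<open>f\<close> be Lipschitz of order \<open>\<alpha>\<close> with constant \<open>A\<close>. Since \<open>Q\<^sub>t f = P\<^sub>t\<^sub>/\<^sub>2 Q\<^sub>t\<^sub>/\<^sub>2 f\<close>, the almost everywhere
  bound on \<open>Q\<^sub>t f\<close> becomes an everywhere bound of order \<open>A t\<^sup>\<alpha>\<^sup>-\<^sup>1\<close>. Integrating it, \<open>P\<^sub>t f\<close> converges uniformly
  as \<open>t \<rightarrow> 0\<close>, with error of order \<open>A t\<^sup>\<alpha>\<close>; the limit equals \<open>f\<close> almost everywhere because \<open>P\<^sub>t\<close> is
  symmetric for the Gaussian measure and \<open>P\<^sub>t \<phi> \<rightarrow> \<phi>\<close> for indicators \<open>\<phi>\<close> of boxes
  (\<open>AE_eq_if_poisson_op_eq\<close>). So \<open>f\<close> may be replaced by this limit, for which all estimates hold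
  at every point. In the same way \<open>|Q\<^sub>t\<^sub>+\<^sub>s f - Q\<^sub>t f|\<close> is of order \<open>A t\<^sup>\<alpha>\<^sup>-\<^sup>1 min(1, s/t)\<close>: apply the bound
  \<open>8/u\<close> for a time derivative at times \<open>u \<ge> t/2\<close> to the function \<open>Q\<^sub>t\<^sub>/\<^sub>2 f\<close>, which is of size \<open>A t\<^sup>\<alpha>\<^sup>-\<^sup>1\<close>
  (\<open>deriv_diff_bound\<close>).

  Fourth, the integrand of \<open>D\<^sup>\<beta> f\<close> is at most a multiple of \<open>s\<^sup>-\<^sup>\<beta>\<^sup>-\<^sup>1 min(1, s\<^sup>\<alpha>)\<close>, which is integrable
  as \<open>0 < \<beta> < \<alpha>\<close>; this bounds \<open>D\<^sup>\<beta> f\<close> and permits the exchange of integrals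
  \<open>Q\<^sub>t D\<^sup>\<beta> f = (1/c\<^sub>\<beta>) \<integral> s\<^sup>-\<^sup>\<beta>\<^sup>-\<^sup>1 (e\<^sup>-\<^sup>s Q\<^sub>t\<^sub>+\<^sub>s f - Q\<^sub>t f) ds\<close>. For \<open>t \<le> 1\<close> the integrand is of order
  \<open>A t\<^sup>\<alpha>\<^sup>-\<^sup>1 s\<^sup>-\<^sup>\<beta>\<^sup>-\<^sup>1 min(1, s/t)\<close> and the integral scales to \<open>t\<^sup>\<alpha>\<^sup>-\<^sup>\<beta>\<^sup>-\<^sup>1\<close>. For \<open>t \<ge> 1\<close> this estimate is too weak,
  because \<open>e\<^sup>-\<^sup>s - 1\<close> does not scale, but then \<open>|Q\<^sub>t D\<^sup>\<beta> f| \<le> (8/t) sup |D\<^sup>\<beta> f|\<close> suffices.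
\<close>

section \<open>The Gaussian measure and its exchange symmetry\<close>

text \<open>
  The integrand is a product over the coordinates, so the integral is a power of the
  one-dimensional one, and that is known from the total mass of a normal density.
\<close>

lemma nn_integral_exp_neg_norm_sq:
  "(\<integral>\<^sup>+x. ennreal (exp (- (norm x)\<^sup>2)) \<partial>(lborel :: 'a::euclidean_space measure)) = ennreal (pi powr (real DIM('a) / 2))"
proof -
  interpret N: prob_space "density lborel (\<lambda>x. ennreal (normal_density 0 (1 / sqrt 2) x))"
    by (rule prob_space_normal_density) simp
  have "1 = (\<integral>\<^sup>+x. ennreal (normal_density 0 (1 / sqrt 2) x) \<partial>lborel)"
    using N.emeasure_space_1 by (simp add: emeasure_density)
  also have "\<dots> = (\<integral>\<^sup>+x. ennreal (1 / sqrt pi) * ennreal (exp (- x\<^sup>2)) \<partial>lborel)"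
    by (intro nn_integral_cong)
       (simp add: normal_density_def power_divide field_simps flip: ennreal_mult)
  also have "\<dots> = ennreal (1 / sqrt pi) * (\<integral>\<^sup>+x. ennreal (exp (- x\<^sup>2)) \<partial>lborel)"
    by (simp add: nn_integral_cmult)
  finally have "ennreal (sqrt pi) * 1 = ennreal (sqrt pi) * (ennreal (1 / sqrt pi) * (\<integral>\<^sup>+x. ennreal (exp (- x\<^sup>2)) \<partial>lborel))"
    by simp
  then have one_dim: "(\<integral>\<^sup>+x. ennreal (exp (- x\<^sup>2)) \<partial>lborel) = ennreal (sqrt pi)"
    by (simp add: mult.assoc[symmetric] ennreal_mult[symmetric])
  have "(\<integral>\<^sup>+x. ennreal (exp (- (norm x)\<^sup>2)) \<partial>(lborel :: 'a measure))
      = (\<integral>\<^sup>+x. (\<Prod>b\<in>Basis. ennreal (exp (- (x \<bullet> b)\<^sup>2))) \<partial>(lborel :: 'a measure))"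
  proof (intro nn_integral_cong)
    fix x :: 'a
    have "(norm x)\<^sup>2 = (\<Sum>b\<in>Basis. (x \<bullet> b)\<^sup>2)"
      unfolding power2_norm_eq_inner by (subst euclidean_inner) (simp add: power2_eq_square)
    then show "ennreal (exp (- (norm x)\<^sup>2)) = (\<Prod>b\<in>Basis. ennreal (exp (- (x \<bullet> b)\<^sup>2)))"
      by (simp add: prod_ennreal exp_sum[symmetric] sum_negf)
  qed
  also have "\<dots> = (\<Prod>b\<in>(Basis::'a set). ennreal (sqrt pi))"
    using one_dim by (subst nn_integral_lborel_prod) simp_all
  also have "\<dots> = ennreal (sqrt pi ^ DIM('a))"
    by (simp add: ennreal_power)
  also have "sqrt pi ^ DIM('a) = pi powr (real DIM('a) / 2)"
    by (simp add: powr_half_sqrt[symmetric] powr_powr powr_realpow[symmetric] del: powr_realpow)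
  finally show ?thesis .
qed

lemma sets_gauss_measure [simp, measurable_cong]: "sets gauss_measure = sets borel"
  by (simp add: gauss_measure_def)

lemma space_gauss_measure [simp]: "space gauss_measure = UNIV"
  by (simp add: gauss_measure_def)

lemma AE_gauss_measure: "(AE x in gauss_measure. P x) \<longleftrightarrow> (AE x in lborel. P x)"
  unfolding gauss_measure_def by (subst AE_density) auto

lemma prob_space_gauss_measure: "prob_space (gauss_measure :: 'a::euclidean_space measure)"
proof
  have "emeasure gauss_measure (space gauss_measure :: 'a set) = 
      (\<integral>\<^sup>+x. ennreal (pi powr (- real DIM('a) / 2)) * ennreal (exp (- (norm x)\<^sup>2)) \<partial>(lborel :: 'a measure))"
    by (simp add: gauss_measure_def emeasure_density ennreal_mult)
  also have "\<dots> = ennreal (pi powr (- real DIM('a) / 2)) * ennreal (pi powr (real DIM('a) / 2))"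
    by (subst nn_integral_cmult) (auto simp: nn_integral_exp_neg_norm_sq)
  also have "\<dots> = ennreal (pi powr (- real DIM('a) / 2) * pi powr (real DIM('a) / 2))"
    by (simp add: ennreal_mult)
  also have "pi powr (- real DIM('a) / 2) * pi powr (real DIM('a) / 2) = 1"
    by (simp add: powr_add[symmetric])
  finally show "emeasure gauss_measure (space gauss_measure :: 'a set) = 1" by simp
qed

interpretation gauss: prob_space "gauss_measure :: 'a::euclidean_space measure"
  by (rule prob_space_gauss_measure)

interpretation gauss_pair: pair_prob_space "gauss_measure :: 'a::euclidean_space measure"
  "gauss_measure :: 'a::euclidean_space measure" ..

lemma nn_integral_lborel_affine:
  fixes t :: "'a::euclidean_space"
  assumes "c \<noteq> 0" and [measurable]: "f \<in> borel_measurable borel"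
  shows "(\<integral>\<^sup>+x. f x \<partial>lborel) = ennreal (\<bar>c\<bar> ^ DIM('a)) * (\<integral>\<^sup>+x. f (t + c *\<^sub>R x) \<partial>lborel)"
  by (subst lborel_affine[OF \<open>c \<noteq> 0\<close>, of t])
     (simp add: nn_integral_density nn_integral_distr nn_integral_cmult)

lemma integral_lborel_affine:
  fixes t :: "'a::euclidean_space" and f :: "'a \<Rightarrow> real"
  assumes "c \<noteq> 0" and [measurable]: "f \<in> borel_measurable borel"
  shows "(\<integral>x. f x \<partial>lborel) = \<bar>c\<bar> ^ DIM('a) * (\<integral>x. f (t + c *\<^sub>R x) \<partial>lborel)"
  by (subst lborel_affine[OF \<open>c \<noteq> 0\<close>, of t])
     (simp add: integral_density integral_distr)

text \<open>
  Up to constants the two sides are the exponents of the joint density of \<open>(z, a z + b w)\<close> for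
  independent Gaussian \<open>z\<close>, \<open>w\<close>; this symmetry in \<open>y\<close> and \<open>z\<close> is the source of both the invariance
  and the reversibility of the Ornstein-Uhlenbeck semigroup.
\<close>

lemma gauss_rotation_kernel_symmetric:
  fixes y z :: "'a::real_inner"
  assumes "a\<^sup>2 + b\<^sup>2 = 1" "b \<noteq> (0::real)"
  shows "(norm z)\<^sup>2 + (norm (y - a *\<^sub>R z))\<^sup>2 / b\<^sup>2 = (norm y)\<^sup>2 + (norm (z - a *\<^sub>R y))\<^sup>2 / b\<^sup>2"
proof -
  have a: "a\<^sup>2 = 1 - b\<^sup>2" using assms by simp
  have e: "(norm (y - a *\<^sub>R z))\<^sup>2 = (norm y)\<^sup>2 - 2 * a * (y \<bullet> z) + (1 - b\<^sup>2) * (norm z)\<^sup>2" for y z :: 'a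
    unfolding a[symmetric] power2_norm_eq_inner
    by (simp add: inner_diff_left inner_diff_right inner_commute power2_eq_square algebra_simps)
  show ?thesis
    unfolding e using assms(2) by (simp add: field_simps inner_commute)
qed

text \<open>
  The pair \<open>(z, a z + b w)\<close> has a density with respect to Lebesgue measure which is symmetric in its
  two arguments. Taking a function of one component only shows that \<open>a z + b w\<close> is again Gaussian,
  which gives the semigroup law; taking a product of functions of the two components gives the symmetry
  of the semigroup in \<open>L\<^sup>2(\<gamma>)\<close>.
\<close>

lemma gauss_exchange:
  fixes a b :: real
  assumes ab: "a\<^sup>2 + b\<^sup>2 = 1" "0 < b"
  shows "distr (gauss_measure \<Otimes>\<^sub>M gauss_measure) (borel \<Otimes>\<^sub>M borel) (\<lambda>(z, w). (z, a *\<^sub>R z + b *\<^sub>R w))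
       = distr (gauss_measure \<Otimes>\<^sub>M gauss_measure) (borel \<Otimes>\<^sub>M borel)
           (\<lambda>(z, w). (a *\<^sub>R z + b *\<^sub>R w, z :: 'a::euclidean_space))"
proof -
  define C where "C = pi powr (- real DIM('a) / 2)"
  have C: "0 < C" by (simp add: C_def)
  define E :: "'a \<Rightarrow> 'a \<Rightarrow> ennreal" where
    "E z y = ennreal (C\<^sup>2 * exp (- ((norm z)\<^sup>2 + (norm (y - a *\<^sub>R z))\<^sup>2 / b\<^sup>2)))" for z y
  have [measurable]: "case_prod E \<in> borel_measurable (borel \<Otimes>\<^sub>M borel)"
    unfolding E_def by measurable
  have E_sym: "E z y = E y z" for z y
    unfolding E_def using gauss_rotation_kernel_symmetric[of a b z y] ab by simp
  define D :: "'a \<Rightarrow> ennreal" where "D z = ennreal (C * exp (- (norm z)\<^sup>2))" for z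
  have [measurable]: "D \<in> borel_measurable borel"
    unfolding D_def by measurable
  have gauss: "(gauss_measure :: 'a measure) = density lborel D"
    unfolding gauss_measure_def C_def D_def ..
  have DE: "E z (a *\<^sub>R z + b *\<^sub>R w) = D z * D w" for z w
    using C ab
    by (simp add: D_def E_def power_mult_distrib exp_add[symmetric] ennreal_mult[symmetric] power2_eq_square)
  \<comment> \<open>Substituting \<open>y = a z + b w\<close> for fixed \<open>z\<close> produces the Jacobian \<open>b\<^sup>d\<close>.\<close>
  have key: "ennreal (b ^ DIM('a)) * (\<integral>\<^sup>+z. \<integral>\<^sup>+w. F (z, a *\<^sub>R z + b *\<^sub>R w) \<partial>gauss_measure \<partial>gauss_measure)
       = (\<integral>\<^sup>+z. \<integral>\<^sup>+y. F (z, y) * E z y \<partial>lborel \<partial>lborel)"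
    if [measurable]: "F \<in> borel_measurable (borel \<Otimes>\<^sub>M borel)" for F :: "'a \<times> 'a \<Rightarrow> ennreal"
  proof -
    have "(\<integral>\<^sup>+z. \<integral>\<^sup>+w. F (z, a *\<^sub>R z + b *\<^sub>R w) \<partial>gauss_measure \<partial>gauss_measure)
        = (\<integral>\<^sup>+z. (\<integral>\<^sup>+w. F (z, a *\<^sub>R z + b *\<^sub>R w) * E z (a *\<^sub>R z + b *\<^sub>R w) \<partial>lborel) \<partial>lborel)"
    proof -
      have "(\<integral>\<^sup>+z. \<integral>\<^sup>+w. F (z, a *\<^sub>R z + b *\<^sub>R w) \<partial>gauss_measure \<partial>gauss_measure)
          = (\<integral>\<^sup>+z. D z * (\<integral>\<^sup>+w. D w * F (z, a *\<^sub>R z + b *\<^sub>R w) \<partial>lborel) \<partial>lborel)"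
        unfolding gauss by (subst nn_integral_density; measurable; subst nn_integral_density; measurable)
      also have "\<dots> = (\<integral>\<^sup>+z. (\<integral>\<^sup>+w. D z * (D w * F (z, a *\<^sub>R z + b *\<^sub>R w)) \<partial>lborel) \<partial>lborel)"
        by (intro nn_integral_cong nn_integral_cmult[symmetric]) measurable
      also have "\<dots> = (\<integral>\<^sup>+z. (\<integral>\<^sup>+w. F (z, a *\<^sub>R z + b *\<^sub>R w) * E z (a *\<^sub>R z + b *\<^sub>R w) \<partial>lborel) \<partial>lborel)"
        by (intro nn_integral_cong) (simp add: DE mult_ac)
      finally show ?thesis .
    qed
    also have "ennreal (b ^ DIM('a)) * \<dots> = (\<integral>\<^sup>+z. ennreal (b ^ DIM('a)) * (\<integral>\<^sup>+w. F (z, a *\<^sub>R z + b *\<^sub>R w) * E z (a *\<^sub>R z + b *\<^sub>R w) \<partial>lborel) \<partial>lborel)"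
      by (subst nn_integral_cmult) measurable
    also have "\<dots> = (\<integral>\<^sup>+z. \<integral>\<^sup>+y. F (z, y) * E z y \<partial>lborel \<partial>lborel)"
    proof (rule nn_integral_cong)
      fix z :: 'a
      show "ennreal (b ^ DIM('a)) * (\<integral>\<^sup>+w. F (z, a *\<^sub>R z + b *\<^sub>R w) * E z (a *\<^sub>R z + b *\<^sub>R w) \<partial>lborel)
          = (\<integral>\<^sup>+y. F (z, y) * E z y \<partial>lborel)"
        using nn_integral_lborel_affine[of b "\<lambda>y. F (z, y) * E z y" "a *\<^sub>R z"] ab by simp
    qed
    finally show ?thesis .
  qed
  have eq: "(\<integral>\<^sup>+z. \<integral>\<^sup>+w. F (z, a *\<^sub>R z + b *\<^sub>R w) \<partial>gauss_measure \<partial>gauss_measure)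
          = (\<integral>\<^sup>+z. \<integral>\<^sup>+w. F (a *\<^sub>R z + b *\<^sub>R w, z) \<partial>gauss_measure \<partial>gauss_measure)"
    if [measurable]: "F \<in> borel_measurable (borel \<Otimes>\<^sub>M borel)" for F :: "'a \<times> 'a \<Rightarrow> ennreal"
  proof -
    have "ennreal (b ^ DIM('a)) * (\<integral>\<^sup>+z. \<integral>\<^sup>+w. F (a *\<^sub>R z + b *\<^sub>R w, z) \<partial>gauss_measure \<partial>gauss_measure)
        = (\<integral>\<^sup>+z. \<integral>\<^sup>+y. F (y, z) * E z y \<partial>lborel \<partial>lborel)"
      using key[of "\<lambda>p. F (snd p, fst p)"] by simp
    also have "\<dots> = (\<integral>\<^sup>+z. \<integral>\<^sup>+y. F (z, y) * E z y \<partial>lborel \<partial>lborel)"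
      by (subst lborel_pair.Fubini') (auto simp: E_sym)
    also have "\<dots> = ennreal (b ^ DIM('a)) * (\<integral>\<^sup>+z. \<integral>\<^sup>+w. F (z, a *\<^sub>R z + b *\<^sub>R w) \<partial>gauss_measure \<partial>gauss_measure)"
      by (rule key[symmetric]) measurable
    finally show ?thesis
      using ab by (simp add: ennreal_mult_cancel_left)
  qed
  show ?thesis
  proof (rule measure_eqI)
    fix A :: "('a \<times> 'a) set" 
    assume "A \<in> sets (distr (gauss_measure \<Otimes>\<^sub>M gauss_measure) (borel \<Otimes>\<^sub>M borel) (\<lambda>(z, w). (z, a *\<^sub>R z + b *\<^sub>R w)))"
    then have [measurable]: "A \<in> sets (borel \<Otimes>\<^sub>M borel)" by simp
    have em: "emeasure (distr (gauss_measure \<Otimes>\<^sub>M gauss_measure) (borel \<Otimes>\<^sub>M borel) (\<lambda>(z, w). h z w)) A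
        = (\<integral>\<^sup>+z. \<integral>\<^sup>+w. indicator A (h z w) \<partial>gauss_measure \<partial>gauss_measure)"
      if [measurable]: "(\<lambda>(z, w). h z w) \<in> borel \<Otimes>\<^sub>M borel \<rightarrow>\<^sub>M borel \<Otimes>\<^sub>M borel"
      for h :: "'a \<Rightarrow> 'a \<Rightarrow> 'a \<times> 'a"
    proof -
      have "emeasure (distr (gauss_measure \<Otimes>\<^sub>M gauss_measure) (borel \<Otimes>\<^sub>M borel) (\<lambda>(z, w). h z w)) A
        = (\<integral>\<^sup>+p. indicator A p \<partial>distr (gauss_measure \<Otimes>\<^sub>M gauss_measure) (borel \<Otimes>\<^sub>M borel) (\<lambda>(z, w). h z w))"
        by simp
      also have "\<dots> = (\<integral>\<^sup>+p. indicator A (h (fst p) (snd p)) \<partial>(gauss_measure \<Otimes>\<^sub>M gauss_measure))"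
        by (subst nn_integral_distr) (auto simp: case_prod_beta intro!: nn_integral_cong split: split_indicator)
      also have "\<dots> = (\<integral>\<^sup>+z. \<integral>\<^sup>+w. indicator A (h z w) \<partial>gauss_measure \<partial>gauss_measure)"
        by (subst gauss.nn_integral_fst[symmetric]) simp_all
      finally show ?thesis .
    qed
    show "emeasure (distr (gauss_measure \<Otimes>\<^sub>M gauss_measure) (borel \<Otimes>\<^sub>M borel) (\<lambda>(z, w). (z, a *\<^sub>R z + b *\<^sub>R w))) A
       = emeasure (distr (gauss_measure \<Otimes>\<^sub>M gauss_measure) (borel \<Otimes>\<^sub>M borel) (\<lambda>(z, w). (a *\<^sub>R z + b *\<^sub>R w, z))) A"
      using eq[of "indicator A"] by (subst (1 2) em) simp_all
  qed simp
qed

section \<open>The Ornstein-Uhlenbeck semigroup in Mehler form\<close>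

text \<open>
  For \<open>r > 0\<close> this is \<open>T\<^sub>r f\<close> after the substitution \<open>y = e\<^sup>-\<^sup>r x + \<surd>(1 - e\<^sup>-\<^sup>2\<^sup>r) z\<close>. All dependence on \<open>r\<close> sits
  in the argument of \<open>f\<close> and the averaging measure is fixed, which makes bounds, limits and
  applications of Fubini's theorem immediate.
\<close>

definition mehler :: "real \<Rightarrow> ('a::euclidean_space \<Rightarrow> real) \<Rightarrow> 'a \<Rightarrow> real" where
  "mehler r f x = (\<integral>z. f (exp (- r) *\<^sub>R x + sqrt (1 - exp (- 2 * r)) *\<^sub>R z) \<partial>gauss_measure)"

lemma ou_semigroup_eq_mehler:
  fixes f :: "'a::euclidean_space \<Rightarrow> real"
  assumes r: "r > 0" and [measurable]: "f \<in> borel_measurable borel"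
  shows "ou_semigroup r f x = mehler r f x"
proof -
  define \<sigma> where "\<sigma> = sqrt (1 - exp (- 2 * r))"
  have \<sigma>: "\<sigma> > 0" "\<sigma>\<^sup>2 = 1 - exp (- 2 * r)"
    using r by (simp_all add: \<sigma>_def)
  have pw: "(\<sigma>\<^sup>2) powr (real DIM('a) / 2) = \<sigma> ^ DIM('a)"
    using \<sigma>(1)
    by (simp add: powr_realpow[symmetric] powr_powr del: powr_realpow flip: powr_numeral)
  have "(\<integral>y. exp (- ((norm (y - exp (- r) *\<^sub>R x))\<^sup>2 / \<sigma>\<^sup>2)) * f y \<partial>lborel)
      = \<sigma> ^ DIM('a) * (\<integral>z. exp (- (norm z)\<^sup>2) * f (exp (- r) *\<^sub>R x + \<sigma> *\<^sub>R z) \<partial>lborel)"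
    using \<sigma>(1) r by (subst integral_lborel_affine[of \<sigma> _ "exp (- r) *\<^sub>R x"])
      (simp_all add: power_mult_distrib)
  then have "ou_semigroup r f x = pi powr (- real DIM('a) / 2) *
      (\<integral>z. exp (- (norm z)\<^sup>2) * f (exp (- r) *\<^sub>R x + \<sigma> *\<^sub>R z) \<partial>lborel)"
    using r \<sigma>(1) unfolding ou_semigroup_def \<sigma>(2)[symmetric] pw
    by (simp add: powr_minus divide_simps)
  also have "\<dots> = mehler r f x"
    unfolding mehler_def gauss_measure_def \<sigma>_def[symmetric]
    by (subst integral_density) (simp_all add: mult.assoc)
  finally show ?thesis .
qed

lemma measurable_mehler [measurable (raw)]:
  assumes [measurable]: "f \<in> borel_measurable borel" "g \<in> borel_measurable M" "h \<in> borel_measurable M"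
  shows "(\<lambda>x. mehler (g x) f (h x)) \<in> borel_measurable M"
proof -
  have [measurable]: "(\<lambda>(r, x). mehler r f x) \<in> borel_measurable (borel \<Otimes>\<^sub>M borel)"
    unfolding mehler_def by measurable
  have "(\<lambda>x. (\<lambda>(r, x). mehler r f x) (g x, h x)) \<in> borel_measurable M"
    by measurable
  then show ?thesis by simp
qed

lemma gauss_integrable_bounded:
  fixes f :: "'a::euclidean_space \<Rightarrow> real"
  assumes [measurable]: "f \<in> borel_measurable borel" and "\<And>x. \<bar>f x\<bar> \<le> M"
  shows "integrable gauss_measure f"
  by (rule gauss.integrable_const_bound[where B=M]) (use assms in auto)

lemma integrable_mehler:
  fixes f :: "'a::euclidean_space \<Rightarrow> real"
  assumes [measurable]: "f \<in> borel_measurable borel" and M: "\<And>x. \<bar>f x\<bar> \<le> M"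
  shows "integrable gauss_measure (\<lambda>z. f (u + c *\<^sub>R z))"
  by (rule gauss_integrable_bounded[where M=M]) (use M in auto)

lemma gauss_integral_bound:
  fixes f :: "'a::euclidean_space \<Rightarrow> real"
  assumes M: "\<And>x. \<bar>f x\<bar> \<le> M"
  shows "\<bar>\<integral>x. f x \<partial>gauss_measure\<bar> \<le> M"
proof (cases "integrable gauss_measure f")
  case True
  have "\<bar>\<integral>x. f x \<partial>gauss_measure\<bar> \<le> (\<integral>x. \<bar>f x\<bar> \<partial>gauss_measure)"
    by (rule integral_abs_bound)
  also have "\<dots> \<le> (\<integral>x. M \<partial>(gauss_measure :: 'a measure))"
    by (rule integral_mono) (use True M in auto)
  finally show ?thesis by (simp add: gauss.prob_space[unfolded space_gauss_measure])
next
  case False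
  then show ?thesis using M[of undefined] by (simp add: not_integrable_integral_eq)
qed

lemma mehler_bound:
  assumes M: "\<And>x. \<bar>f x\<bar> \<le> M"
  shows "\<bar>mehler r f x\<bar> \<le> M"
  unfolding mehler_def by (rule gauss_integral_bound) (rule M)

lemma gauss_exchange_integral:
  fixes F :: "'a::euclidean_space \<times> 'a \<Rightarrow> real"
  assumes ab: "a\<^sup>2 + b\<^sup>2 = 1" "0 < b"
    and [measurable]: "F \<in> borel_measurable (borel \<Otimes>\<^sub>M borel)" and M: "\<And>p. \<bar>F p\<bar> \<le> M"
  shows "(\<integral>z. \<integral>w. F (z, a *\<^sub>R z + b *\<^sub>R w) \<partial>gauss_measure \<partial>gauss_measure)
       = (\<integral>z. \<integral>w. F (a *\<^sub>R z + b *\<^sub>R w, z) \<partial>gauss_measure \<partial>gauss_measure)"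
proof -
  have e: "(\<integral>z. \<integral>w. F (h z w) \<partial>gauss_measure \<partial>gauss_measure)
      = (\<integral>p. F p \<partial>distr (gauss_measure \<Otimes>\<^sub>M gauss_measure) (borel \<Otimes>\<^sub>M borel) (\<lambda>(z, w). h z w))"
    if [measurable]: "(\<lambda>(z, w). h z w) \<in> borel \<Otimes>\<^sub>M borel \<rightarrow>\<^sub>M borel \<Otimes>\<^sub>M borel"
    for h :: "'a \<Rightarrow> 'a \<Rightarrow> 'a \<times> 'a"
  proof -
    have "integrable (gauss_measure \<Otimes>\<^sub>M gauss_measure) (\<lambda>p. F (h (fst p) (snd p)))"
      by (rule gauss_pair.P.integrable_const_bound[where B=M]) (use M in auto)
    from gauss_pair.integral_fst'[OF this]
    show ?thesis by (subst integral_distr) (simp_all add: case_prod_beta)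
  qed
  show ?thesis
    using gauss_exchange[OF ab, where 'a='a] by (simp add: e)
qed

text \<open>
  Both sides average \<open>f\<close> over a Gaussian centred at \<open>e\<^sup>-\<^sup>r\<^sup>-\<^sup>s x\<close>. The two independent contributions on the
  left combine to a single one by the rotation invariance contained in the exchange symmetry.
\<close>

lemma mehler_add:
  fixes f :: "'a::euclidean_space \<Rightarrow> real"
  assumes r: "r > 0" and s: "s > 0"
    and [measurable]: "f \<in> borel_measurable borel" and M: "\<And>x. \<bar>f x\<bar> \<le> M"
  shows "mehler r (mehler s f) x = mehler (r + s) f x"
proof -
  define \<sigma> where "\<sigma> = (\<lambda>r. sqrt (1 - exp (- 2 * r)))"
  have \<sigma>: "\<sigma> r > 0" "(\<sigma> r)\<^sup>2 = 1 - exp (- 2 * r)" if "r > 0" for r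
    using that by (simp_all add: \<sigma>_def)
  \<comment> \<open>The weights of the two independent Gaussian contributions, normalised so that \<open>a\<^sup>2 + b\<^sup>2 = 1\<close>.\<close>
  define a b where "a = exp (- s) * \<sigma> r / \<sigma> (r + s)" and "b = \<sigma> s / \<sigma> (r + s)"
  have b: "b > 0" using \<sigma>(1) r s by (simp add: b_def)
  have "(exp (- s) * \<sigma> r)\<^sup>2 + (\<sigma> s)\<^sup>2 = (\<sigma> (r + s))\<^sup>2"
    using r s by (simp add: \<sigma>(2) power_mult_distrib exp_double[symmetric] algebra_simps exp_add[symmetric])
  then have ab: "a\<^sup>2 + b\<^sup>2 = 1"
    using \<sigma>(1)[of "r + s"] r s
    by (simp add: a_def b_def power_divide add_divide_distrib[symmetric])
  define F where "F = (\<lambda>p::'a \<times> 'a. f (exp (- (r + s)) *\<^sub>R x + \<sigma> (r + s) *\<^sub>R snd p))"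
  have [measurable]: "F \<in> borel_measurable (borel \<Otimes>\<^sub>M borel)" unfolding F_def by measurable
  have "mehler r (mehler s f) x = (\<integral>z. \<integral>w. F (z, a *\<^sub>R z + b *\<^sub>R w) \<partial>gauss_measure \<partial>gauss_measure)"
  proof -
    have "exp (- s) *\<^sub>R (exp (- r) *\<^sub>R x + \<sigma> r *\<^sub>R z) + \<sigma> s *\<^sub>R w
        = exp (- (r + s)) *\<^sub>R x + \<sigma> (r + s) *\<^sub>R (a *\<^sub>R z + b *\<^sub>R w)" for z w
      using \<sigma>(1)[of "r + s"] r s
      by (simp add: a_def b_def scaleR_add_right exp_add[symmetric])
    note e = this
    show ?thesis unfolding mehler_def F_def snd_conv \<sigma>_def by (simp only: e[unfolded \<sigma>_def])
  qed
  also have "\<dots> = (\<integral>z. \<integral>w. F (a *\<^sub>R z + b *\<^sub>R w, z) \<partial>gauss_measure \<partial>gauss_measure)"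
    by (rule gauss_exchange_integral[OF ab b, where M=M]) (use M in \<open>auto simp: F_def\<close>)
  also have "\<dots> = mehler (r + s) f x"
    by (simp add: F_def mehler_def \<sigma>_def gauss.prob_space[unfolded space_gauss_measure])
  finally show ?thesis .
qed

lemma mehler_symmetric:
  fixes f h :: "'a::euclidean_space \<Rightarrow> real"
  assumes r: "r > 0"
    and [measurable]: "f \<in> borel_measurable borel" "h \<in> borel_measurable borel"
    and M: "\<And>x. \<bar>f x\<bar> \<le> M" and N: "\<And>x. \<bar>h x\<bar> \<le> N"
  shows "(\<integral>x. h x * mehler r f x \<partial>gauss_measure) = (\<integral>x. f x * mehler r h x \<partial>gauss_measure)"
proof -
  define a b where "a = exp (- r)" and "b = sqrt (1 - exp (- 2 * r))"
  have ab: "a\<^sup>2 + b\<^sup>2 = 1" "b > 0"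
    using r by (simp_all add: a_def b_def exp_double[symmetric])
  have "\<bar>h x * f y\<bar> \<le> N * M" for x y
    unfolding abs_mult by (intro mult_mono M N) (use N[of x] in auto)
  then have "(\<integral>z. \<integral>w. (\<lambda>p. h (fst p) * f (snd p)) (z, a *\<^sub>R z + b *\<^sub>R w) \<partial>gauss_measure \<partial>gauss_measure)
       = (\<integral>z. \<integral>w. (\<lambda>p. h (fst p) * f (snd p)) (a *\<^sub>R z + b *\<^sub>R w, z) \<partial>gauss_measure \<partial>gauss_measure)"
    by (intro gauss_exchange_integral[OF ab, where M="N * M"]) auto
  then show ?thesis
    by (simp add: mehler_def a_def b_def mult.commute)
qed

lemma mehler_tendsto_0:
  fixes f :: "'a::euclidean_space \<Rightarrow> real"
  assumes [measurable]: "f \<in> borel_measurable borel" and M: "\<And>x. \<bar>f x\<bar> \<le> M" and cont: "isCont f x"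
    and X: "X \<longlonglongrightarrow> 0"
  shows "(\<lambda>n. mehler (X n) f x) \<longlonglongrightarrow> f x"
proof -
  have "(\<lambda>n. mehler (X n) f x) \<longlonglongrightarrow> (\<integral>z. f x \<partial>(gauss_measure :: 'a measure))"
    unfolding mehler_def
  proof (rule integral_dominated_convergence[where w="\<lambda>_. M"])
    show "AE z in gauss_measure. (\<lambda>n. f (exp (- X n) *\<^sub>R x + sqrt (1 - exp (- 2 * X n)) *\<^sub>R z)) \<longlonglongrightarrow> f x"
    proof (rule AE_I2)
      fix z :: 'a
      have "(\<lambda>n. exp (- X n) *\<^sub>R x + sqrt (1 - exp (- 2 * X n)) *\<^sub>R z)
          \<longlonglongrightarrow> exp (- 0) *\<^sub>R x + sqrt (1 - exp (- 2 * 0)) *\<^sub>R z"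
        by (intro tendsto_intros X)
      then have "(\<lambda>n. exp (- X n) *\<^sub>R x + sqrt (1 - exp (- 2 * X n)) *\<^sub>R z) \<longlonglongrightarrow> x" by simp
      from isCont_tendsto_compose[OF cont this]
      show "(\<lambda>n. f (exp (- X n) *\<^sub>R x + sqrt (1 - exp (- 2 * X n)) *\<^sub>R z)) \<longlonglongrightarrow> f x" .
    qed
  qed (use M in auto)
  then show ?thesis by (simp add: gauss.prob_space[unfolded space_gauss_measure])
qed

lemma ou_semigroup_cong_AE:
  fixes f g :: "'a::euclidean_space \<Rightarrow> real"
  assumes "r > 0" and [measurable]: "f \<in> borel_measurable borel" "g \<in> borel_measurable borel"
    and "AE x in lborel. f x = g x"
  shows "ou_semigroup r f x = ou_semigroup r g x"
proof -
  have "(\<integral>y. exp (- ((norm (y - exp (- r) *\<^sub>R x))\<^sup>2 / (1 - exp (- 2 * r)))) * f y \<partial>lborel)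
      = (\<integral>y. exp (- ((norm (y - exp (- r) *\<^sub>R x))\<^sup>2 / (1 - exp (- 2 * r)))) * g y \<partial>lborel)"
    by (rule integral_cong_AE) (use assms(4) in auto)
  then show ?thesis using assms(1) by (simp add: ou_semigroup_def)
qed

section \<open>Differentiation and substitution under the integral sign\<close>

text \<open>
  Dominated convergence for the difference quotients, which the mean value theorem bounds by the
  dominating function.
\<close>

lemma has_real_derivative_integral:
  fixes f f' :: "real \<Rightarrow> 'b \<Rightarrow> real"
  assumes e: "e > 0"
    and int: "\<And>s. \<bar>s - t\<bar> < e \<Longrightarrow> integrable M (f s)"
    and der: "\<And>s x. \<bar>s - t\<bar> < e \<Longrightarrow> x \<in> space M \<Longrightarrow> ((\<lambda>s. f s x) has_real_derivative f' s x) (at s)"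
    and bound: "\<And>s x. \<bar>s - t\<bar> < e \<Longrightarrow> x \<in> space M \<Longrightarrow> \<bar>f' s x\<bar> \<le> w x"
    and w: "integrable M w"
    and [measurable]: "f' t \<in> borel_measurable M"
  shows "((\<lambda>s. \<integral>x. f s x \<partial>M) has_real_derivative (\<integral>x. f' t x \<partial>M)) (at t)"
  unfolding has_field_derivative_iff tendsto_at_iff_sequentially
proof (intro allI impI)
  fix X :: "nat \<Rightarrow> real"
  assume X0: "\<forall>i. X i \<in> UNIV - {t}" and X: "X \<longlonglongrightarrow> t"
  obtain N where N: "\<And>n. n \<ge> N \<Longrightarrow> \<bar>X n - t\<bar> < e"
    using LIMSEQ_D[OF X e] by auto
  define Y where "Y n = X (n + N)" for n
  have Y: "(\<lambda>n. Y n) \<longlonglongrightarrow> t" "\<bar>Y n - t\<bar> < e" "Y n \<noteq> t" for n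
    using LIMSEQ_ignore_initial_segment[OF X, of N] N X0 by (simp_all add: Y_def)
  have It: "integrable M (f t)" using int[of t] e by simp
  have "(\<lambda>n. \<integral>x. (f (Y n) x - f t x) / (Y n - t) \<partial>M) \<longlonglongrightarrow> (\<integral>x. f' t x \<partial>M)"
  proof (rule integral_dominated_convergence[where w=w])
    show "(\<lambda>x. (f (Y n) x - f t x) / (Y n - t)) \<in> borel_measurable M" for n
      using int[OF Y(2)[of n]] It by measurable
    show "AE x in M. (\<lambda>n. (f (Y n) x - f t x) / (Y n - t)) \<longlonglongrightarrow> f' t x"
    proof (rule AE_I2)
      fix x assume "x \<in> space M"
      then have "((\<lambda>y. (f y x - f t x) / (y - t)) \<longlongrightarrow> f' t x) (at t)"
        using der[of t x] e by (simp add: has_field_derivative_iff)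
      then show "(\<lambda>n. (f (Y n) x - f t x) / (Y n - t)) \<longlonglongrightarrow> f' t x"
        using Y by (auto simp: tendsto_at_iff_sequentially o_def)
    qed
    show "AE x in M. norm ((f (Y n) x - f t x) / (Y n - t)) \<le> w x" for n
    proof (rule AE_I2)
      fix x assume x: "x \<in> space M"
      have "norm (f (Y n) x - f t x) \<le> w x * norm (Y n - t)"
      proof (rule field_differentiable_bound[where S="ball t e" and f'="\<lambda>s. f' s x"])
        show "((\<lambda>s. f s x) has_field_derivative f' s x) (at s within ball t e)" if "s \<in> ball t e" for s
          using der[of s x] that x by (auto simp: dist_real_def abs_minus_commute intro: has_field_derivative_at_within)
        show "norm (f' s x) \<le> w x" if "s \<in> ball t e" for s
          using bound[of s x] that x by (auto simp: dist_real_def abs_minus_commute)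
      qed (use e Y(2)[of n] in \<open>auto simp: dist_real_def abs_minus_commute\<close>)
      then show "norm ((f (Y n) x - f t x) / (Y n - t)) \<le> w x"
        using Y(3)[of n] by (simp add: divide_simps)
    qed
  qed (use w in auto)
  moreover have eq: "(\<integral>x. (f (Y n) x - f t x) / (Y n - t) \<partial>M) = ((\<integral>x. f (Y n) x \<partial>M) - (\<integral>x. f t x \<partial>M)) / (Y n - t)" for n
    using int[OF Y(2)[of n]] It by simp
  ultimately have "(\<lambda>n. ((\<lambda>y. ((\<integral>x. f y x \<partial>M) - (\<integral>x. f t x \<partial>M)) / (y - t)) \<circ> X) (n + N)) \<longlonglongrightarrow> (\<integral>x. f' t x \<partial>M)"
    unfolding eq by (simp only: Y_def o_def)
  then show "((\<lambda>y. ((\<integral>x. f y x \<partial>M) - (\<integral>x. f t x \<partial>M)) / (y - t)) \<circ> X) \<longlonglongrightarrow> (\<integral>x. f' t x \<partial>M)"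
    by (rule LIMSEQ_offset)
qed

text \<open>
  The substitution rule for absolutely integrable functions, carried over from the completed
  Lebesgue measure to the Borel one.
\<close>

lemma set_integral_change_of_variables:
  fixes f g h :: "real \<Rightarrow> real"
  assumes S: "S \<in> sets borel" and gS: "g ` S \<in> sets borel"
    and der: "\<And>x. x \<in> S \<Longrightarrow> (g has_real_derivative h x) (at x)"
    and inj: "inj_on g S"
    and mf: "set_borel_measurable lborel (g ` S) f"
    and mg: "set_borel_measurable lborel S (\<lambda>x. \<bar>h x\<bar> * f (g x))"
  shows "set_integrable lborel (g ` S) f \<longleftrightarrow> set_integrable lborel S (\<lambda>x. \<bar>h x\<bar> * f (g x))" (is ?A)
    and "(LINT x:g ` S|lborel. f x) = (LINT x:S|lborel. \<bar>h x\<bar> * f (g x))" (is ?B)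
proof -
  have S': "S \<in> sets lebesgue" using S by simp
  have cv: "(\<lambda>x. \<bar>h x\<bar> * f(g x)) absolutely_integrable_on S \<and> integral S (\<lambda>x. \<bar>h x\<bar> * f (g x)) = b
     \<longleftrightarrow> f absolutely_integrable_on (g ` S) \<and> integral (g ` S) f = b" for b
    by (rule has_absolute_integral_change_of_variables_1'[OF S' has_field_derivative_at_within[OF der] inj])
  have i1: "f absolutely_integrable_on (g ` S) \<longleftrightarrow> set_integrable lborel (g ` S) f"
    unfolding set_integrable_def using mf[unfolded set_borel_measurable_def]
    by (rule integrable_completion)
  have i2: "(\<lambda>x. \<bar>h x\<bar> * f(g x)) absolutely_integrable_on S \<longleftrightarrow> set_integrable lborel S (\<lambda>x. \<bar>h x\<bar> * f (g x))"
    unfolding set_integrable_def using mg[unfolded set_borel_measurable_def]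
    by (rule integrable_completion)
  show A: ?A using cv i1 i2 by blast
  show ?B
  proof (cases "set_integrable lborel (g ` S) f")
    case True
    have "(LINT x:g ` S|lborel. f x) = integral (g ` S) f"
      using True by (rule set_borel_integral_eq_integral(2))
    also have "\<dots> = integral S (\<lambda>x. \<bar>h x\<bar> * f (g x))"
      using cv[of "integral (g ` S) f"] True i1 by simp
    also have "\<dots> = (LINT x:S|lborel. \<bar>h x\<bar> * f (g x))"
      using True A by (intro set_borel_integral_eq_integral(2)[symmetric]) simp
    finally show ?thesis .
  next
    case False
    then show ?thesis using A
      by (simp add: set_integrable_def set_lebesgue_integral_def not_integrable_integral_eq)
  qed
qed

section \<open>The one-sided stable law of index 1/2\<close>

text \<open>
  The map \<open>v(q) = a q - b/q\<close> takes the half line onto the whole line and has derivative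
  \<open>a + b/q\<^sup>2\<close>, so the two integrals weighted with \<open>a\<close> and \<open>b\<close> add up to \<open>\<integral> exp(-v\<^sup>2) dv = \<surd>\<pi>\<close>. The involution
  \<open>q \<mapsto> b/(a q)\<close> changes the sign of \<open>v\<close> and interchanges them, so each is one half of it.
\<close>

lemma cauchy_schloemilch:
  fixes a b :: real
  assumes a: "a > 0" and b: "b > 0"
  shows "set_integrable lborel {0<..} (\<lambda>q. exp (- (a * q - b / q)\<^sup>2))"
    and "(LINT q:{0<..}|lborel. exp (- (a * q - b / q)\<^sup>2)) = sqrt pi / (2 * a)"
    and "set_integrable lborel {0<..} (\<lambda>q. exp (- (a * q - b / q)\<^sup>2) / q\<^sup>2)"
    and "(LINT q:{0<..}|lborel. exp (- (a * q - b / q)\<^sup>2) / q\<^sup>2) = sqrt pi / (2 * b)"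
proof -
  define S :: "real set" where "S = {0<..}"
  have [measurable]: "S \<in> sets borel" by (simp add: S_def)
  define v where "v q = a * q - b / q" for q
  define w where "w q = exp (- (v q)\<^sup>2)" for q
  have [measurable]: "v \<in> borel_measurable borel" "w \<in> borel_measurable borel"
    unfolding v_def[abs_def] w_def[abs_def] by measurable
  have gauss: "has_bochner_integral lborel (\<lambda>x::real. exp (- x\<^sup>2)) (sqrt pi)"
  proof -
    have "has_bochner_integral lborel (\<lambda>x::real. exp (- x\<^sup>2)) (2 *\<^sub>R (sqrt pi / 2))"
      by (rule has_bochner_integral_even_function[OF gaussian_moment_0]) simp
    then show ?thesis by simp
  qed
  have vim: "v ` S = UNIV"
  proof -
    have "y \<in> v ` S" for y
    proof -
      \<comment> \<open>The positive root of \<open>a q\<^sup>2 - y q - b = 0\<close> is the preimage of \<open>y\<close>.\<close>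
      define D where "D = sqrt (y\<^sup>2 + 4 * a * b)"
      have D2: "D\<^sup>2 = y\<^sup>2 + 4 * a * b" using a b by (simp add: D_def)
      have "\<bar>y\<bar> < D" unfolding D_def using a b by (intro real_less_rsqrt) auto
      then have pos: "y + D > 0" by linarith
      have "v ((y + D) / (2 * a)) = y"
      proof -
        have "(D - y) * (y + D) = 4 * a * b"
          using D2 by (simp add: power2_eq_square algebra_simps)
        then have "b / ((y + D) / (2 * a)) = (D - y) / 2"
          using a pos by (simp add: divide_simps)
        moreover have "a * ((y + D) / (2 * a)) = (y + D) / 2" using a by simp
        ultimately have "v ((y + D) / (2 * a)) = (y + D) / 2 - (D - y) / 2" by (simp only: v_def)
        then show ?thesis by (simp add: diff_divide_distrib add_divide_distrib)
      qed
      then show ?thesis using pos a by (intro image_eqI[of _ _ "(y + D) / (2 * a)"]) (auto simp: S_def)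
    qed
    then show ?thesis by auto
  qed
  have "strict_mono_on S v"
  proof (rule strict_mono_onI)
    fix p q assume "p \<in> S" "q \<in> S" "p < q"
    then have "a * p < a * q" "b / q < b / p" using a b by (auto simp: S_def intro: divide_strict_left_mono)
    then show "v p < v q" by (simp add: v_def)
  qed
  then have inj: "inj_on v S" by (rule strict_mono_on_imp_inj_on)
  have der: "(v has_real_derivative a + b / q\<^sup>2) (at q)" if "q \<in> S" for q
    using that unfolding v_def[abs_def] S_def by (auto intro!: derivative_eq_intros simp: power2_eq_square)
  have cv: "set_integrable lborel (v ` S) (\<lambda>x. exp (- x\<^sup>2)) = set_integrable lborel S (\<lambda>q. \<bar>a + b / q\<^sup>2\<bar> * exp (- (v q)\<^sup>2))"
     "(LINT x:v ` S|lborel. exp (- x\<^sup>2)) = (LINT q:S|lborel. \<bar>a + b / q\<^sup>2\<bar> * exp (- (v q)\<^sup>2))"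
    by (rule set_integral_change_of_variables[OF _ _ der inj]; simp add: vim set_borel_measurable_def)+
  have eq: "indicator S q *\<^sub>R (\<bar>a + b / q\<^sup>2\<bar> * exp (- (v q)\<^sup>2)) = indicator S q *\<^sub>R (a * w q) + indicator S q *\<^sub>R (b * (w q / q\<^sup>2))" for q
    using a b by (auto simp: w_def algebra_simps split: split_indicator)
  have sum: "integrable lborel (\<lambda>q. indicator S q *\<^sub>R (a * w q) + indicator S q *\<^sub>R (b * (w q / q\<^sup>2)))"
      "(\<integral>q. indicator S q *\<^sub>R (a * w q) + indicator S q *\<^sub>R (b * (w q / q\<^sup>2)) \<partial>lborel) = sqrt pi"
    using cv gauss unfolding vim set_integrable_def set_lebesgue_integral_def eq
    by (simp_all add: has_bochner_integral_iff)
  have i1: "integrable lborel (\<lambda>q. indicator S q *\<^sub>R (a * w q))"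
    by (rule Bochner_Integration.integrable_bound[OF sum(1)])
      (use a b in \<open>auto simp: w_def split: split_indicator\<close>)
  have i2: "integrable lborel (\<lambda>q. indicator S q *\<^sub>R (b * (w q / q\<^sup>2)))"
    by (rule Bochner_Integration.integrable_bound[OF sum(1)])
      (use a b in \<open>auto simp: w_def split: split_indicator\<close>)
  \<comment> \<open>The involution that swaps the two weighted integrals.\<close>
  define k where "k q = b / (a * q)" for q
  have k_inv: "k (k q) = q" "k q \<in> S" if "q \<in> S" for q
    using that a b by (auto simp: k_def S_def)
  then have kim: "k ` S = S" by force
  have kinj: "inj_on k S" using k_inv by (metis inj_onI)
  have kder: "(k has_real_derivative - (b / (a * q\<^sup>2))) (at q)" if "q \<in> S" for q
    using that a unfolding k_def[abs_def] S_def
    by (auto intro!: derivative_eq_intros simp: power2_eq_square field_simps)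
  have wk: "w (k q) = w q" if "q \<in> S" for q
  proof -
    have "v (k q) = - v q" using that a b by (simp add: v_def k_def S_def)
    then show ?thesis by (simp add: w_def)
  qed
  have [measurable]: "k \<in> borel_measurable borel" unfolding k_def[abs_def] by measurable
  have "(LINT q:k ` S|lborel. a * w q) = (LINT q:S|lborel. \<bar>- (b / (a * q\<^sup>2))\<bar> * (a * w (k q)))"
    by (rule set_integral_change_of_variables(2)[OF _ _ kder kinj])
      (simp_all add: kim set_borel_measurable_def)
  also have "\<dots> = (LINT q:S|lborel. b * (w q / q\<^sup>2))"
    by (rule set_lebesgue_integral_cong) (use a b wk in \<open>auto simp: abs_mult field_simps\<close>)
  finally have same: "(\<integral>q. indicator S q *\<^sub>R (a * w q) \<partial>lborel) = (\<integral>q. indicator S q *\<^sub>R (b * (w q / q\<^sup>2)) \<partial>lborel)"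
    unfolding kim set_lebesgue_integral_def .
  have tot: "(\<integral>q. indicator S q *\<^sub>R (a * w q) \<partial>lborel) + (\<integral>q. indicator S q *\<^sub>R (b * (w q / q\<^sup>2)) \<partial>lborel) = sqrt pi"
    using sum(2) i1 i2 by simp
  have S: "{0<..} = S" and W: "exp (- (a * q - b / q)\<^sup>2) = w q" for q
    by (simp_all add: S_def w_def v_def)
  have i1': "set_integrable lborel S w"
    using i1 a integrable_mult_right[of "1 / a" lborel "\<lambda>q. indicator S q *\<^sub>R (a * w q)"]
    by (simp add: set_integrable_def field_simps)
  have i2': "set_integrable lborel S (\<lambda>q. w q / q\<^sup>2)"
    using i2 b integrable_mult_right[of "1 / b" lborel "\<lambda>q. indicator S q *\<^sub>R (b * (w q / q\<^sup>2))"]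
    by (simp add: set_integrable_def field_simps)
  have e1: "(\<integral>q. indicator S q *\<^sub>R (a * w q) \<partial>lborel) = a * (LINT q:S|lborel. w q)"
    unfolding set_lebesgue_integral_def by (simp add: mult_ac)
  have e2: "(\<integral>q. indicator S q *\<^sub>R (b * (w q / q\<^sup>2)) \<partial>lborel) = b * (LINT q:S|lborel. w q / q\<^sup>2)"
    unfolding set_lebesgue_integral_def
    by (subst integral_mult_right_zero[symmetric]) (simp add: mult_ac)
  show "set_integrable lborel {0<..} (\<lambda>q. exp (- (a * q - b / q)\<^sup>2))"
    unfolding S W by (rule i1')
  show "set_integrable lborel {0<..} (\<lambda>q. exp (- (a * q - b / q)\<^sup>2) / q\<^sup>2)"
    unfolding S W by (rule i2')
  show "(LINT q:{0<..}|lborel. exp (- (a * q - b / q)\<^sup>2)) = sqrt pi / (2 * a)"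
    unfolding S W using tot same e1 a by (simp add: field_simps)
  show "(LINT q:{0<..}|lborel. exp (- (a * q - b / q)\<^sup>2) / q\<^sup>2) = sqrt pi / (2 * b)"
    unfolding S W using tot same e2 b by (simp add: field_simps)
qed

text \<open>
  The density of the time at which a Brownian motion of variance \<open>2r\<close> at time \<open>r\<close> first hits level \<open>t\<close>,
  also called the Levy distribution; its Laplace transform is \<open>exp(-t \<surd>\<lambda>)\<close>, which is why it turns \<open>T\<close>
  into the semigroup generated by \<open>-(-L)\<^sup>1\<^sup>/\<^sup>2\<close>.
\<close>

definition stable_density :: "real \<Rightarrow> real \<Rightarrow> real" where
  "stable_density t r = (if r > 0 then t / (2 * sqrt pi * (r * sqrt r)) * exp (- (t\<^sup>2 / (4 * r))) else 0)"

definition stable_density_deriv :: "real \<Rightarrow> real \<Rightarrow> real" where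
  "stable_density_deriv t r =
     (if r > 0 then 1 / (2 * sqrt pi * (r * sqrt r)) * (1 - t\<^sup>2 / (2 * r)) * exp (- (t\<^sup>2 / (4 * r))) else 0)"

lemma measurable_stable_density [measurable (raw)]:
  assumes [measurable]: "f \<in> borel_measurable M" "g \<in> borel_measurable M"
  shows "(\<lambda>x. stable_density (f x) (g x)) \<in> borel_measurable M"
    "(\<lambda>x. stable_density_deriv (f x) (g x)) \<in> borel_measurable M"
  unfolding stable_density_def stable_density_deriv_def by measurable

lemma stable_density_nonneg: "t \<ge> 0 \<Longrightarrow> stable_density t r \<ge> 0"
  by (simp add: stable_density_def)

lemma stable_density_has_derivative:
  "((\<lambda>t. stable_density t r) has_real_derivative stable_density_deriv t r) (at t)"
proof (cases "r > 0")
  case True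
  have "((\<lambda>t. t / (2 * sqrt pi * (r * sqrt r)) * exp (- (t\<^sup>2 / (4 * r)))) has_real_derivative
     1 / (2 * sqrt pi * (r * sqrt r)) * (1 - t\<^sup>2 / (2 * r)) * exp (- (t\<^sup>2 / (4 * r)))) (at t)"
    using True by (auto intro!: derivative_eq_intros simp: field_simps power2_eq_square)
  then show ?thesis using True by (simp add: stable_density_def[abs_def] stable_density_deriv_def)
qed (simp add: stable_density_def[abs_def] stable_density_deriv_def)

text \<open>
  Apart from the power of \<open>r\<close>, the derivative is \<open>(1 - 2x) e\<^sup>-\<^sup>x\<close> with \<open>x = t\<^sup>2/(4r)\<close>, and half of the exponential
  decay absorbs the linear factor. Halving the time in the density on the right replaces \<open>e\<^sup>-\<^sup>x\<close> by
  \<open>e\<^sup>-\<^sup>x\<^sup>/\<^sup>4\<close>, which is more than enough room. The separate lower bound \<open>t0\<close> gives a single dominating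
  function for all \<open>t \<ge> t0\<close>.
\<close>

lemma stable_density_deriv_bound:
  assumes "0 < t0" "t0 \<le> t"
  shows "\<bar>stable_density_deriv t r\<bar> \<le> 8 / t0 * stable_density (t0 / 2) r"
proof (cases "r > 0")
  case True
  define x where "x = t\<^sup>2 / (4 * r)"
  have x: "x \<ge> 0" using True by (simp add: x_def)
  have "\<bar>1 - 2 * x\<bar> \<le> 4 * (1 + x / 2)" using x by simp
  also have "\<dots> \<le> 4 * exp (x / 2)" by (intro mult_left_mono exp_ge_add_one_self) simp
  finally have "\<bar>1 - 2 * x\<bar> * exp (- x) \<le> 4 * exp (x / 2) * exp (- x)"
    by (intro mult_right_mono) auto
  also have "\<dots> = 4 * exp (- (x / 2))" by (simp add: exp_add[symmetric])
  also have "\<dots> \<le> 4 * exp (- ((t0 / 2)\<^sup>2 / (4 * r)))"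
  proof -
    have "(t0 / 2)\<^sup>2 \<le> (t / 2)\<^sup>2" using assms by (intro power_mono) auto
    then have "(t0 / 2)\<^sup>2 / (4 * r) \<le> (t / 2)\<^sup>2 / (4 * r)" using True by (intro divide_right_mono) auto
    also have "\<dots> = x / 4" by (simp add: x_def power_divide)
    also have "\<dots> \<le> x / 2" using x by simp
    finally show ?thesis by simp
  qed
  finally have "\<bar>1 - 2 * x\<bar> * exp (- x) \<le> 4 * exp (- ((t0 / 2)\<^sup>2 / (4 * r)))" .
  then have "1 / (2 * sqrt pi * (r * sqrt r)) * (\<bar>1 - 2 * x\<bar> * exp (- x))
      \<le> 1 / (2 * sqrt pi * (r * sqrt r)) * (4 * exp (- ((t0 / 2)\<^sup>2 / (4 * r))))"
    using True by (intro mult_left_mono) auto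
  moreover have "\<bar>stable_density_deriv t r\<bar> = 1 / (2 * sqrt pi * (r * sqrt r)) * (\<bar>1 - 2 * x\<bar> * exp (- x))"
    using True by (simp add: stable_density_deriv_def x_def abs_mult)
  moreover have "8 / t0 * stable_density (t0 / 2) r = 1 / (2 * sqrt pi * (r * sqrt r)) * (4 * exp (- ((t0 / 2)\<^sup>2 / (4 * r))))"
    using True assms by (simp add: stable_density_def)
  ultimately show ?thesis by simp
next
  case False
  then show ?thesis by (simp add: stable_density_def stable_density_deriv_def)
qed

text \<open>
  The substitution \<open>u = t\<^sup>2/(4r)\<close>, an involution of the half line, turns the Gamma-type weight in the
  definition of \<open>P\<^sub>t\<close> into the stable density.
\<close>

lemma stable_subordination:
  fixes \<Phi> :: "real \<Rightarrow> real"
  assumes t: "t > 0" and [measurable]: "\<Phi> \<in> borel_measurable borel"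
  shows "set_integrable lborel {0<..} (\<lambda>u. exp (- u) / sqrt u * \<Phi> (t\<^sup>2 / (4 * u)))
      \<longleftrightarrow> integrable lborel (\<lambda>r. stable_density t r * \<Phi> r)"
    and "1 / sqrt pi * (LINT u:{0<..}|lborel. exp (- u) / sqrt u * \<Phi> (t\<^sup>2 / (4 * u)))
      = (\<integral>r. stable_density t r * \<Phi> r \<partial>lborel)"
proof -
  define g h where "g r = t\<^sup>2 / (4 * r)" and "h r = - (t\<^sup>2 / (4 * r\<^sup>2))" for r
  have [measurable]: "g \<in> borel_measurable borel" "h \<in> borel_measurable borel"
    unfolding g_def[abs_def] h_def[abs_def] by measurable
  have inv: "g (g r) = r" "g r \<in> {0<..}" if "r \<in> {0<..}" for r
    using that t by (auto simp: g_def)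
  then have im: "g ` {0<..} = {0<..}" by (metis image_eqI subsetI subset_antisym image_subsetI)
  have inj: "inj_on g {0<..}" using inv by (metis inj_onI)
  have der: "(g has_real_derivative h r) (at r)" if "r \<in> {0<..}" for r
    using that t unfolding g_def[abs_def] h_def
    by (auto intro!: derivative_eq_intros simp: power2_eq_square field_simps)
  define F where "F u = exp (- u) / sqrt u * \<Phi> (g u)" for u
  have [measurable]: "F \<in> borel_measurable borel" unfolding F_def[abs_def] by measurable
  have cv: "set_integrable lborel (g ` {0<..}) F \<longleftrightarrow> set_integrable lborel {0<..} (\<lambda>r. \<bar>h r\<bar> * F (g r))"
    "(LINT u:g ` {0<..}|lborel. F u) = (LINT r:{0<..}|lborel. \<bar>h r\<bar> * F (g r))"
    by (rule set_integral_change_of_variables[OF _ _ der inj]; simp add: im set_borel_measurable_def)+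
  have eq: "indicator {0<..} r *\<^sub>R (\<bar>h r\<bar> * F (g r)) = sqrt pi * (stable_density t r * \<Phi> r)" for r
  proof (cases "r > 0")
    case True
    have sq: "sqrt (g r) = t / (2 * sqrt r)"
      using True t by (simp add: g_def real_sqrt_divide real_sqrt_mult)
    have r: "r * sqrt r = r\<^sup>2 / sqrt r" using True
      by (simp add: power2_eq_square field_simps)
    have gg: "g (g r) = r" using inv True by simp
    have "\<bar>h r\<bar> * F (g r) = t\<^sup>2 / (4 * r\<^sup>2) * (exp (- g r) * (2 * sqrt r) / t * \<Phi> r)"
      unfolding F_def gg sq using True t by (simp add: h_def)
    also have "\<dots> = t / (2 * (r * sqrt r)) * exp (- g r) * \<Phi> r"
      using True t unfolding r by (simp add: field_simps power2_eq_square)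
    finally show ?thesis using True by (simp add: stable_density_def g_def)
  next
    case False
    then show ?thesis by (simp add: stable_density_def)
  qed
  have cv1: "set_integrable lborel {0<..} F \<longleftrightarrow> integrable lborel (\<lambda>r. sqrt pi * (stable_density t r * \<Phi> r))"
    using cv(1) unfolding im set_integrable_def eq .
  have cv2: "(LINT u:{0<..}|lborel. F u) = (\<integral>r. sqrt pi * (stable_density t r * \<Phi> r) \<partial>lborel)"
    using cv(2) unfolding im set_lebesgue_integral_def eq .
  show "set_integrable lborel {0<..} (\<lambda>u. exp (- u) / sqrt u * \<Phi> (t\<^sup>2 / (4 * u)))
      \<longleftrightarrow> integrable lborel (\<lambda>r. stable_density t r * \<Phi> r)"
    using cv1 unfolding F_def[abs_def] g_def by simp
  show "1 / sqrt pi * (LINT u:{0<..}|lborel. exp (- u) / sqrt u * \<Phi> (t\<^sup>2 / (4 * u)))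
      = (\<integral>r. stable_density t r * \<Phi> r \<partial>lborel)"
    using cv2 unfolding F_def[abs_def] g_def by simp
qed

lemma gamma_half_integral:
  "set_integrable lborel {0<..} (\<lambda>u. exp (- u) / sqrt u)"
  "(LINT u:{0<..}|lborel. exp (- u) / sqrt u) = sqrt pi"
proof -
  have eq: "exp (- u) / sqrt u = u powr (1 / 2 - 1) / exp u" if "u > 0" for u :: real
    using that by (simp add: powr_minus powr_half_sqrt exp_minus divide_simps)
  have "((\<lambda>u. u powr (1 / 2 - 1) / exp u) has_integral sqrt pi) {0..}"
    using Gamma_integral_real[of "1 / 2"] by (simp add: Gamma_one_half_real)
  moreover have "negligible (({0..} - {0<..}) \<union> ({0<..} - {0..} :: real set))"
    by (rule negligible_subset[of "{0}"]) auto
  ultimately have "((\<lambda>u. u powr (1 / 2 - 1) / exp u) has_integral sqrt pi) {0<..}"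
    by (subst (asm) has_integral_spike_set_eq[of "{0..}" "{0<..}"])
      (auto intro: negligible_subset)
  then have hi: "((\<lambda>u. exp (- u) / sqrt u) has_integral sqrt pi) {0<..}"
    by (rule has_integral_eq[rotated]) (simp add: eq)
  have "(\<lambda>u. exp (- u) / sqrt u) absolutely_integrable_on {0<..}"
    by (rule nonnegative_absolutely_integrable_1) (use hi in \<open>auto simp: integrable_on_def\<close>)
  then show 1: "set_integrable lborel {0<..} (\<lambda>u. exp (- u) / sqrt u)"
    unfolding set_integrable_def by (subst (asm) integrable_completion) auto
  show "(LINT u:{0<..}|lborel. exp (- u) / sqrt u) = sqrt pi"
    using set_borel_integral_eq_integral(2)[OF 1] hi by (simp add: integral_unique)
qed

lemma stable_density_integral:
  assumes "t > 0"
  shows "integrable lborel (stable_density t)" "(\<integral>r. stable_density t r \<partial>lborel) = 1"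
  using stable_subordination[OF assms, of "\<lambda>_. 1"] gamma_half_integral by simp_all

text \<open>
  With \<open>r = R/(1 + q\<^sup>2)\<close> the square roots in the two densities cancel against the Jacobian, and the
  exponent becomes \<open>(s + t)\<^sup>2/(4R) + (a q - b/q)\<^sup>2\<close> with \<open>a = t/(2 \<surd>R)\<close> and \<open>b = s/(2 \<surd>R)\<close>. What remains is the
  sum of the two Cauchy-Schloemilch integrals.
\<close>

lemma stable_density_convolution:
  assumes s: "s > 0" and t: "t > 0" and R: "R > 0"
  shows "integrable lborel (\<lambda>r. stable_density s (R - r) * stable_density t r)"
    and "(\<integral>r. stable_density s (R - r) * stable_density t r \<partial>lborel) = stable_density (s + t) R"
proof -
  define g h where "g q = R / (1 + q\<^sup>2)" and "h q = - (2 * R * q / (1 + q\<^sup>2)\<^sup>2)" for q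
  define a b where "a = t / (2 * sqrt R)" and "b = s / (2 * sqrt R)"
  have ab: "a > 0" "b > 0" using s t R by (simp_all add: a_def b_def)
  define K where "K = s * t / (2 * pi * R\<^sup>2) * exp (- ((s + t)\<^sup>2 / (4 * R)))"
  define w where "w q = exp (- (a * q - b / q)\<^sup>2)" for q
  define f where "f r = stable_density s (R - r) * stable_density t r" for r
  have [measurable]: "g \<in> borel_measurable borel" "h \<in> borel_measurable borel" "f \<in> borel_measurable borel"
    unfolding g_def[abs_def] h_def[abs_def] f_def[abs_def] by measurable
  have p: "1 + q\<^sup>2 > 0" for q :: real by (simp add: add_pos_nonneg)
  have im: "g ` {0<..} = {0<..<R}"
  proof (intro equalityI subsetI)
    fix r assume "r \<in> g ` {0<..}"
    then obtain q where q: "q > 0" "r = R / (1 + q\<^sup>2)" by (auto simp: g_def)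
    moreover have "R / (1 + q\<^sup>2) < R / 1"
      using R q p by (intro divide_strict_left_mono) auto
    ultimately show "r \<in> {0<..<R}" using R p[of q] by simp
  next
    fix r assume r: "r \<in> {0<..<R}"
    then have "R / r > 1" by simp
    then have "r = g (sqrt (R / r - 1))" "sqrt (R / r - 1) > 0"
      using r by (simp_all add: g_def)
    then show "r \<in> g ` {0<..}" by blast
  qed
  have inj: "inj_on g {0<..}"
  proof (rule inj_onI)
    fix x y assume xy: "x \<in> {0<..}" "y \<in> {0<..}" "g x = g y"
    then have "x\<^sup>2 = y\<^sup>2" using p[of x] p[of y] R by (simp add: g_def frac_eq_eq)
    then show "x = y" using xy by (simp add: power2_eq_iff)
  qed
  have der: "(g has_real_derivative h q) (at q)" for q
    using p[of q] unfolding g_def[abs_def] h_def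
    by (auto intro!: derivative_eq_intros simp: power2_eq_square)
  \<comment> \<open>In the new variable the convolution integrand is the constant \<open>K\<close> times the two Cauchy-Schloemilch integrands.\<close>
  have trans: "\<bar>h q\<bar> * f (g q) = K * (w q + w q / q\<^sup>2)" if "q > 0" for q
  proof -
    define P where "P = 1 + q\<^sup>2"
    have P: "P > 0" using p by (simp add: P_def)
    have Rg: "R - g q = R * q\<^sup>2 / P" using P by (simp add: g_def P_def field_simps)
    have pos: "R * q\<^sup>2 / P > 0" "R / P > 0" using R that P by auto
    have s1: "sqrt (R * q\<^sup>2 / P) = q * sqrt R / sqrt P" and s2: "sqrt (R / P) = sqrt R / sqrt P"
      using that by (simp_all add: real_sqrt_divide real_sqrt_mult)
    have RP: "sqrt R * sqrt R = R" "sqrt P * sqrt P = P" using R P by simp_all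
    have gen: "(R * q\<^sup>2 / P * (q * u / v)) * (R / P * (u / v)) = R\<^sup>2 * q ^ 3 * (u * u) / (P\<^sup>2 * (v * v))" for u v :: real
      by (simp add: power2_eq_square power3_eq_cube mult_ac)
    have "(R * q\<^sup>2 / P * (q * sqrt R / sqrt P)) * (R / P * (sqrt R / sqrt P))
        = R\<^sup>2 * q ^ 3 * (sqrt R * sqrt R) / (P\<^sup>2 * (sqrt P * sqrt P))"
      by (rule gen)
    also have "\<dots> = (R * q / P) ^ 3"
      unfolding RP by (simp add: power2_eq_square power3_eq_cube)
    finally have pre: "(R * q\<^sup>2 / P * (q * sqrt R / sqrt P)) * (R / P * (sqrt R / sqrt P)) = (R * q / P) ^ 3" .
    \<comment> \<open>The square is completed so that the exponent of the density at time \<open>s + t\<close> splits off.\<close>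
    have exponent: "s\<^sup>2 / (4 * (R * q\<^sup>2 / P)) + t\<^sup>2 / (4 * (R / P)) = (s + t)\<^sup>2 / (4 * R) + (a * q - b / q)\<^sup>2"
    proof -
      have a2: "a\<^sup>2 = t\<^sup>2 / (4 * R)" and b2: "b\<^sup>2 = s\<^sup>2 / (4 * R)" and abe: "a * b = s * t / (4 * R)"
        using R by (simp_all add: a_def b_def power_divide power_mult_distrib)
      have "(a * q - b / q)\<^sup>2 = a\<^sup>2 * q\<^sup>2 - 2 * (a * b) + b\<^sup>2 / q\<^sup>2"
        using that by (simp add: power2_diff power_mult_distrib power_divide)
      then show ?thesis unfolding a2 b2 abe using that R P
        by (simp add: P_def divide_simps) (simp add: power2_eq_square algebra_simps)
    qed
    have gen2: "s / (2 * sqrt pi * X) * exp (- x) * (t / (2 * sqrt pi * Y) * exp (- y))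
        = s * t / (4 * pi * (X * Y)) * exp (- (x + y))" for X Y x y :: real
    proof -
      have e1: "exp (- (x + y)) = exp (- x) * exp (- y)" by (simp add: exp_add[symmetric])
      have e2: "4 * pi * (X * Y) = (2 * sqrt pi * X) * (2 * sqrt pi * Y)" by simp
      have "A / B * C * (D / E * F) = A * D / (B * E) * (C * F)" for A B C D E F :: real by simp
      then show ?thesis unfolding e1 e2 by this
    qed
    have "f (g q) = s * t / (4 * pi * ((R * q\<^sup>2 / P * (q * sqrt R / sqrt P)) * (R / P * (sqrt R / sqrt P))))
        * exp (- (s\<^sup>2 / (4 * (R * q\<^sup>2 / P)) + t\<^sup>2 / (4 * (R / P))))"
      unfolding f_def Rg unfolding g_def P_def[symmetric] stable_density_def s1 s2
        if_P[OF pos(1)] if_P[OF pos(2)] by (rule gen2)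
    also have "\<dots> = s * t / (4 * pi * (R * q / P) ^ 3) * (exp (- ((s + t)\<^sup>2 / (4 * R))) * w q)"
      unfolding pre exponent by (simp add: w_def exp_add[symmetric])
    finally have fg: "f (g q) = s * t / (4 * pi * (R * q / P) ^ 3) * (exp (- ((s + t)\<^sup>2 / (4 * R))) * w q)" .
    have hh: "\<bar>h q\<bar> = 2 * R * q / P\<^sup>2" using that R by (simp add: h_def P_def)
    have "2 * R * q / P\<^sup>2 * (s * t / (4 * pi * (R * q / P) ^ 3)) = s * t / (2 * pi * R\<^sup>2) * (P / q\<^sup>2)"
      using that R P by (simp add: power2_eq_square power3_eq_cube field_simps)
    also have "P / q\<^sup>2 = 1 + 1 / q\<^sup>2" using that by (simp add: P_def field_simps)
    finally have "2 * R * q / P\<^sup>2 * (s * t / (4 * pi * (R * q / P) ^ 3)) * (exp (- ((s + t)\<^sup>2 / (4 * R))) * w q)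
       = K * ((1 + 1 / q\<^sup>2) * w q)"
      by (simp add: K_def)
    then show ?thesis unfolding fg hh by (simp add: algebra_simps)
  qed
  have supp: "indicator {0<..<R} r *\<^sub>R f r = f r" for r
    by (auto simp: f_def stable_density_def split: split_indicator)
  have cv: "set_integrable lborel (g ` {0<..}) f = set_integrable lborel {0<..} (\<lambda>q. \<bar>h q\<bar> * f (g q))"
     "(LINT r:g ` {0<..}|lborel. f r) = (LINT q:{0<..}|lborel. \<bar>h q\<bar> * f (g q))"
    by (rule set_integral_change_of_variables[OF _ _ der inj]; simp add: im set_borel_measurable_def)+
  note cs = cauchy_schloemilch[OF ab, folded w_def]
  have eq: "(LINT q:{0<..}|lborel. \<bar>h q\<bar> * f (g q)) = (LINT q:{0<..}|lborel. K * (w q + w q / q\<^sup>2))"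
    by (rule set_lebesgue_integral_cong) (use trans in auto)
  have int: "set_integrable lborel {0<..} (\<lambda>q. K * (w q + w q / q\<^sup>2))"
    by (intro set_integrable_mult_right set_integral_add(1) cs)
  have "set_integrable lborel {0<..} (\<lambda>q. \<bar>h q\<bar> * f (g q)) = set_integrable lborel {0<..} (\<lambda>q. K * (w q + w q / q\<^sup>2))"
    by (rule set_integrable_cong) (use trans in auto)
  then have "set_integrable lborel {0<..<R} f" using cv(1) int unfolding im by simp
  then show "integrable lborel (\<lambda>r. stable_density s (R - r) * stable_density t r)"
    unfolding set_integrable_def supp unfolding f_def .
  have "(\<integral>r. f r \<partial>lborel) = (LINT q:{0<..}|lborel. K * (w q + w q / q\<^sup>2))"
    using cv(2) unfolding im eq by (simp add: set_lebesgue_integral_def supp[unfolded real_scaleR_def])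
  also have "\<dots> = K * (sqrt pi / (2 * a) + sqrt pi / (2 * b))"
    by (simp add: set_integral_add(2)[OF cs(1,3)] cs)
  also have "\<dots> = stable_density (s + t) R"
  proof -
    have "sqrt pi / (2 * a) + sqrt pi / (2 * b) = sqrt pi * sqrt R * (s + t) / (s * t)"
      using s t R by (simp add: a_def b_def field_simps)
    then have "K * (sqrt pi / (2 * a) + sqrt pi / (2 * b)) =
        (sqrt pi * sqrt R * (s + t) / (s * t) * (s * t / (2 * pi * R\<^sup>2))) * exp (- ((s + t)\<^sup>2 / (4 * R)))"
      unfolding K_def by (simp only: mult_ac)
    moreover have "sqrt pi * sqrt R * (s + t) / (s * t) * (s * t / (2 * pi * R\<^sup>2)) = (s + t) / (2 * sqrt pi * (R * sqrt R))"
    proof -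
      have e: "2 * pi * R\<^sup>2 = (sqrt pi * sqrt R) * (2 * sqrt pi * (R * sqrt R))"
      proof -
        have "(sqrt pi * sqrt R) * (2 * sqrt pi * (R * sqrt R)) = 2 * (sqrt pi * sqrt pi) * (R * (sqrt R * sqrt R))"
          by (simp only: mult_ac)
        also have "\<dots> = 2 * pi * R\<^sup>2" using R by (simp add: power2_eq_square)
        finally show ?thesis by simp
      qed
      have "A * x / y * (y / (A * B)) = x / B" if "A \<noteq> 0" "y \<noteq> 0" for A B x y :: real
        using that by simp
      then show ?thesis unfolding e using s t R by force
    qed
    ultimately show ?thesis using R by (simp only: stable_density_def if_True)
  qed
  finally show "(\<integral>r. stable_density s (R - r) * stable_density t r \<partial>lborel) = stable_density (s + t) R"
    by (simp add: f_def)
qed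

definition stable_measure :: "real \<Rightarrow> real measure" where
  "stable_measure t = density lborel (\<lambda>r. ennreal (stable_density t r))"

lemma sets_stable_measure [simp, measurable_cong]: "sets (stable_measure t) = sets borel"
  by (simp add: stable_measure_def)

lemma space_stable_measure [simp]: "space (stable_measure t) = UNIV"
  by (simp add: stable_measure_def)

lemma prob_space_stable_measure:
  assumes "t > 0"
  shows "prob_space (stable_measure t)"
proof
  have "emeasure (stable_measure t) (space (stable_measure t)) = (\<integral>\<^sup>+r. ennreal (stable_density t r) \<partial>lborel)"
    by (simp add: stable_measure_def emeasure_density)
  also have "\<dots> = ennreal (\<integral>r. stable_density t r \<partial>lborel)"
    by (rule nn_integral_eq_integral) (use assms stable_density_integral stable_density_nonneg in auto)
  finally show "emeasure (stable_measure t) (space (stable_measure t)) = 1"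
    using stable_density_integral(2)[OF assms] by simp
qed

lemma integral_stable_measure:
  fixes \<Phi> :: "real \<Rightarrow> real"
  assumes "t > 0" and [measurable]: "\<Phi> \<in> borel_measurable borel"
  shows "(\<integral>r. \<Phi> r \<partial>stable_measure t) = (\<integral>r. stable_density t r * \<Phi> r \<partial>lborel)"
  unfolding stable_measure_def
  by (subst integral_density) (use assms stable_density_nonneg in auto)

lemma AE_stable_measure: "AE r in stable_measure t. r > 0"
  unfolding stable_measure_def
  by (subst AE_density) (auto simp: stable_density_def)

lemma stable_measure_convolution:
  assumes s: "s > 0" and t: "t > 0"
  shows "stable_measure s \<star> stable_measure t = stable_measure (s + t)"
proof -
  have fin: "finite_measure (stable_measure t)" if "t > 0" for t
    using prob_space_stable_measure[OF that] by (rule prob_space.finite_measure)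
  have "stable_measure s \<star> stable_measure t = density lborel (\<lambda>x. \<integral>\<^sup>+y. ennreal (stable_density s (x - y)) * ennreal (stable_density t y) \<partial>lborel)"
    unfolding stable_measure_def
    by (rule convolution_density) (use fin[unfolded stable_measure_def] s t in auto)
  also have "\<dots> = density lborel (\<lambda>x. ennreal (stable_density (s + t) x))"
  proof (rule density_cong)
    show "AE x in lborel. (\<integral>\<^sup>+y. ennreal (stable_density s (x - y)) * ennreal (stable_density t y) \<partial>lborel)
        = ennreal (stable_density (s + t) x)"
    proof (rule AE_I2)
      fix x :: real
      show "(\<integral>\<^sup>+y. ennreal (stable_density s (x - y)) * ennreal (stable_density t y) \<partial>lborel)
        = ennreal (stable_density (s + t) x)"
      proof (cases "x > 0")
        case True
        have "(\<integral>\<^sup>+y. ennreal (stable_density s (x - y)) * ennreal (stable_density t y) \<partial>lborel)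
           = (\<integral>\<^sup>+y. ennreal (stable_density s (x - y) * stable_density t y) \<partial>lborel)"
          using s t by (intro nn_integral_cong) (simp add: ennreal_mult stable_density_nonneg)
        also have "\<dots> = ennreal (\<integral>y. stable_density s (x - y) * stable_density t y \<partial>lborel)"
          by (rule nn_integral_eq_integral) (use s t True stable_density_convolution stable_density_nonneg in auto)
        finally show ?thesis using stable_density_convolution(2)[OF s t True] by simp
      next
        case False
        then have z: "ennreal (stable_density s (x - y)) * ennreal (stable_density t y) = 0" for y
          by (simp add: stable_density_def)
        show ?thesis unfolding z using False by (simp add: stable_density_def)
      qed
    qed
  qed measurable
  finally show ?thesis by (simp add: stable_measure_def)
qed

lemma integral_stable_measure_add:
  fixes \<Phi> :: "real \<Rightarrow> real"
  assumes s: "s > 0" and t: "t > 0" and [measurable]: "\<Phi> \<in> borel_measurable borel" and M: "\<And>r. \<bar>\<Phi> r\<bar> \<le> M"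
  shows "(\<integral>r. \<integral>u. \<Phi> (r + u) \<partial>stable_measure t \<partial>stable_measure s) = (\<integral>r. \<Phi> r \<partial>stable_measure (s + t))"
proof -
  interpret S: prob_space "stable_measure s" by (rule prob_space_stable_measure) fact
  interpret T: prob_space "stable_measure t" by (rule prob_space_stable_measure) fact
  interpret ST: pair_prob_space "stable_measure s" "stable_measure t" ..
  have "(\<integral>r. \<Phi> r \<partial>stable_measure (s + t)) = (\<integral>r. \<Phi> r \<partial>(stable_measure s \<star> stable_measure t))"
    by (simp add: stable_measure_convolution s t)
  also have "\<dots> = (\<integral>p. \<Phi> (fst p + snd p) \<partial>(stable_measure s \<Otimes>\<^sub>M stable_measure t))"
    unfolding convolution_def by (subst integral_distr) (simp_all add: case_prod_beta)
  also have "\<dots> = (\<integral>r. \<integral>u. \<Phi> (r + u) \<partial>stable_measure t \<partial>stable_measure s)"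
  proof -
    have "integrable (stable_measure s \<Otimes>\<^sub>M stable_measure t) (\<lambda>p. \<Phi> (fst p + snd p))"
      by (rule ST.P.integrable_const_bound[where B=M]) (use M in auto)
    from ST.integral_fst'[OF this] show ?thesis by simp
  qed
  finally show ?thesis by simp
qed

section \<open>The Poisson-Hermite semigroup and its time derivative\<close>

definition poisson_op :: "real \<Rightarrow> ('a::euclidean_space \<Rightarrow> real) \<Rightarrow> 'a \<Rightarrow> real" where
  "poisson_op t f x = (\<integral>r. stable_density t r * mehler r f x \<partial>lborel)"

definition poisson_op_deriv :: "real \<Rightarrow> ('a::euclidean_space \<Rightarrow> real) \<Rightarrow> 'a \<Rightarrow> real" where
  "poisson_op_deriv t f x = (\<integral>r. stable_density_deriv t r * mehler r f x \<partial>lborel)"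

lemma poisson_hermite_eq_subordination:
  fixes f :: "'a::euclidean_space \<Rightarrow> real"
  assumes t: "t > 0" and [measurable]: "f \<in> borel_measurable borel"
  shows "poisson_hermite t f x = 1 / sqrt pi * (LINT u:{0<..}|lborel. exp (- u) / sqrt u * mehler (t\<^sup>2 / (4 * u)) f x)"
proof -
  have "(LINT u:{0<..}|lborel. exp (- u) / sqrt u * ou_semigroup (t\<^sup>2 / (4 * u)) f x)
      = (LINT u:{0<..}|lborel. exp (- u) / sqrt u * mehler (t\<^sup>2 / (4 * u)) f x)"
    by (rule set_lebesgue_integral_cong) (use t in \<open>auto simp: ou_semigroup_eq_mehler\<close>)
  then show ?thesis using t by (simp add: poisson_hermite_def)
qed

lemma poisson_hermite_eq_poisson_op:
  fixes f :: "'a::euclidean_space \<Rightarrow> real"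
  assumes t: "t > 0" and [measurable]: "f \<in> borel_measurable borel"
  shows "poisson_hermite t f x = poisson_op t f x"
  unfolding poisson_hermite_eq_subordination[OF assms] poisson_op_def
  by (rule stable_subordination(2)) (use t in auto)

lemma poisson_hermite_cong_AE:
  fixes f g :: "'a::euclidean_space \<Rightarrow> real"
  assumes t: "t > 0" and [measurable]: "f \<in> borel_measurable borel" "g \<in> borel_measurable borel"
    and fg: "AE x in lborel. f x = g x"
  shows "poisson_hermite t f x = poisson_hermite t g x"
proof -
  have "(LINT u:{0<..}|lborel. exp (- u) / sqrt u * ou_semigroup (t\<^sup>2 / (4 * u)) f x)
      = (LINT u:{0<..}|lborel. exp (- u) / sqrt u * ou_semigroup (t\<^sup>2 / (4 * u)) g x)"
    by (rule set_lebesgue_integral_cong) (use t fg in \<open>auto intro: ou_semigroup_cong_AE\<close>)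
  then show ?thesis using t by (simp add: poisson_hermite_def)
qed

lemma poisson_op_cong_AE:
  fixes f g :: "'a::euclidean_space \<Rightarrow> real"
  assumes "t > 0" "f \<in> borel_measurable borel" "g \<in> borel_measurable borel" "AE x in lborel. f x = g x"
  shows "poisson_op t f x = poisson_op t g x"
  using poisson_hermite_cong_AE[OF assms] assms by (simp add: poisson_hermite_eq_poisson_op)

lemma measurable_poisson_op [measurable (raw)]:
  fixes f :: "'a::euclidean_space \<Rightarrow> real"
  assumes [measurable]: "f \<in> borel_measurable borel" "g \<in> borel_measurable M" "h \<in> borel_measurable M"
  shows "(\<lambda>x. poisson_op (g x) f (h x)) \<in> borel_measurable M"
    "(\<lambda>x. poisson_op_deriv (g x) f (h x)) \<in> borel_measurable M"
proof -
  have [measurable]: "(\<lambda>p::real \<times> 'a. poisson_op (fst p) f (snd p)) \<in> borel_measurable (borel \<Otimes>\<^sub>M borel)"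
     "(\<lambda>p::real \<times> 'a. poisson_op_deriv (fst p) f (snd p)) \<in> borel_measurable (borel \<Otimes>\<^sub>M borel)"
    unfolding poisson_op_def poisson_op_deriv_def by measurable
  have "(\<lambda>x. (\<lambda>p. poisson_op (fst p) f (snd p)) (g x, h x)) \<in> borel_measurable M"
    "(\<lambda>x. (\<lambda>p. poisson_op_deriv (fst p) f (snd p)) (g x, h x)) \<in> borel_measurable M"
    by measurable
  then show "(\<lambda>x. poisson_op (g x) f (h x)) \<in> borel_measurable M"
    "(\<lambda>x. poisson_op_deriv (g x) f (h x)) \<in> borel_measurable M" by simp_all
qed

text \<open>
  \<open>P\<^sub>t\<close> as an average over random times. The definition with the density serves joint measurability in
  \<open>t\<close> and \<open>x\<close>; this form serves Fubini's theorem on products of probability measures.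
\<close>

lemma poisson_op_eq_integral_stable_measure:
  fixes f :: "'a::euclidean_space \<Rightarrow> real"
  assumes "t > 0" and [measurable]: "f \<in> borel_measurable borel"
  shows "poisson_op t f x = (\<integral>r. mehler r f x \<partial>stable_measure t)"
  unfolding poisson_op_def by (rule integral_stable_measure[symmetric]) (use assms in auto)

lemma integrable_stable_density_mult:
  fixes \<Phi> :: "real \<Rightarrow> real"
  assumes t: "t > 0" and [measurable]: "\<Phi> \<in> borel_measurable borel" and M: "\<And>r. \<bar>\<Phi> r\<bar> \<le> M"
  shows "integrable lborel (\<lambda>r. stable_density t r * \<Phi> r)"
    and "integrable lborel (\<lambda>r. stable_density_deriv t r * \<Phi> r)"
    and "\<bar>\<integral>r. stable_density_deriv t r * \<Phi> r \<partial>lborel\<bar> \<le> 8 * M / t"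
proof -
  have M0: "M \<ge> 0" using M[of 0] by linarith
  have "norm (stable_density t r * \<Phi> r) \<le> norm (M * stable_density t r)" for r
    using mult_left_mono[OF M[of r], of "\<bar>stable_density t r\<bar>"] M0
    by (simp add: abs_mult mult.commute)
  then show "integrable lborel (\<lambda>r. stable_density t r * \<Phi> r)"
    by (intro Bochner_Integration.integrable_bound[OF integrable_mult_right[OF stable_density_integral(1)[OF t], of M]])
      auto
  define w where "w r = 8 * M / t * stable_density (t / 2) r" for r
  have w: "integrable lborel w" "(\<integral>r. w r \<partial>lborel) = 8 * M / t"
    unfolding w_def[abs_def] using stable_density_integral[of "t / 2"] t by simp_all
  have b: "\<bar>stable_density_deriv t r * \<Phi> r\<bar> \<le> w r" for r
  proof -
    have "\<bar>stable_density_deriv t r * \<Phi> r\<bar> \<le> (8 / t * stable_density (t / 2) r) * M"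
      unfolding abs_mult using stable_density_deriv_bound[of t t r] M[of r] t
      by (intro mult_mono) (simp_all add: stable_density_nonneg)
    then show ?thesis by (simp add: w_def mult_ac)
  qed
  show i: "integrable lborel (\<lambda>r. stable_density_deriv t r * \<Phi> r)"
    by (rule Bochner_Integration.integrable_bound[OF w(1)]) (auto simp del: abs_mult intro!: order_trans[OF b abs_ge_self])
  have "\<bar>\<integral>r. stable_density_deriv t r * \<Phi> r \<partial>lborel\<bar> \<le> (\<integral>r. \<bar>stable_density_deriv t r * \<Phi> r\<bar> \<partial>lborel)"
    by (rule integral_abs_bound)
  also have "\<dots> \<le> (\<integral>r. w r \<partial>lborel)"
    by (rule integral_mono) (use i w b in auto)
  finally show "\<bar>\<integral>r. stable_density_deriv t r * \<Phi> r \<partial>lborel\<bar> \<le> 8 * M / t" by (simp add: w)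
qed

text \<open>
  The Poisson-Hermite kernel as a measure. It is defined as the law of the Mehler point at a random
  stable time, so that it is a probability measure by construction and integrals against it can be
  differentiated and estimated without an explicit density.
\<close>

definition poisson_kernel :: "real \<Rightarrow> 'a::euclidean_space \<Rightarrow> 'a measure" where
  "poisson_kernel t x = distr (stable_measure t \<Otimes>\<^sub>M gauss_measure) borel
     (\<lambda>(r, z). exp (- r) *\<^sub>R x + sqrt (1 - exp (- 2 * r)) *\<^sub>R z)"

lemma sets_poisson_kernel [simp, measurable_cong]: "sets (poisson_kernel t x) = sets borel"
  by (simp add: poisson_kernel_def)

lemma space_poisson_kernel [simp]: "space (poisson_kernel t x) = UNIV"
  by (simp add: poisson_kernel_def)

lemma prob_space_poisson_kernel:
  assumes "t > 0"
  shows "prob_space (poisson_kernel t (x :: 'a::euclidean_space))"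
proof -
  interpret S: prob_space "stable_measure t" by (rule prob_space_stable_measure) fact
  interpret P: pair_prob_space "stable_measure t" "gauss_measure :: 'a measure" ..
  show ?thesis unfolding poisson_kernel_def by (rule P.P.prob_space_distr) measurable
qed

lemma poisson_op_eq_kernel:
  fixes f :: "'a::euclidean_space \<Rightarrow> real"
  assumes t: "t > 0" and [measurable]: "f \<in> borel_measurable borel" and M: "\<And>x. \<bar>f x\<bar> \<le> M"
  shows "poisson_op t f x = (\<integral>y. f y \<partial>poisson_kernel t x)"
proof -
  interpret S: prob_space "stable_measure t" by (rule prob_space_stable_measure) fact
  interpret P: pair_prob_space "stable_measure t" "gauss_measure :: 'a measure" ..
  have "integrable (stable_measure t \<Otimes>\<^sub>M gauss_measure) (\<lambda>p. f (exp (- fst p) *\<^sub>R x + sqrt (1 - exp (- 2 * fst p)) *\<^sub>R snd p))"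
    by (rule P.P.integrable_const_bound[where B=M]) (use M in auto)
  from P.integral_fst'[OF this]
  show ?thesis
    unfolding poisson_op_eq_integral_stable_measure[OF t assms(2)] mehler_def poisson_kernel_def
    by (subst integral_distr) (simp_all add: case_prod_beta)
qed

lemma integrable_poisson_kernel:
  fixes f :: "'a::euclidean_space \<Rightarrow> real"
  assumes t: "t > 0" and [measurable]: "f \<in> borel_measurable borel" and M: "\<And>x. \<bar>f x\<bar> \<le> M"
  shows "integrable (poisson_kernel t x) f"
proof -
  interpret prob_space "poisson_kernel t x" by (rule prob_space_poisson_kernel) fact
  show ?thesis by (rule integrable_const_bound[where B=M]) (use M in auto)
qed

lemma poisson_op_bound:
  fixes f :: "'a::euclidean_space \<Rightarrow> real"
  assumes t: "t > 0" and [measurable]: "f \<in> borel_measurable borel" and M: "\<And>x. \<bar>f x\<bar> \<le> M"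
  shows "\<bar>poisson_op t f x\<bar> \<le> M"
proof -
  interpret prob_space "poisson_kernel t x" by (rule prob_space_poisson_kernel) fact
  have "\<bar>\<integral>y. f y \<partial>poisson_kernel t x\<bar> \<le> (\<integral>y. \<bar>f y\<bar> \<partial>poisson_kernel t x)"
    by (rule integral_abs_bound)
  also have "\<dots> \<le> (\<integral>y. M \<partial>poisson_kernel t x)"
    by (rule integral_mono) (use integrable_poisson_kernel[OF assms] M in auto)
  finally show ?thesis using prob_space by (simp add: poisson_op_eq_kernel[OF assms])
qed

text \<open>
  \<open>P\<^sub>t\<close> does not see null sets, so an almost everywhere bound on \<open>f\<close> holds for \<open>P\<^sub>t f\<close> everywhere.
  This is what later removes the exceptional sets from the Lipschitz condition.
\<close>

lemma poisson_op_bound_AE: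
  fixes f :: "'a::euclidean_space \<Rightarrow> real"
  assumes t: "t > 0" and [measurable]: "f \<in> borel_measurable borel" and M: "AE x in lborel. \<bar>f x\<bar> \<le> M"
  shows "\<bar>poisson_op t f x\<bar> \<le> M"
proof -
  have "\<exists>x::'a. \<bar>f x\<bar> \<le> M"
  proof (rule ccontr)
    assume "\<not> ?thesis"
    then have "AE x in (lborel :: 'a measure). False" using M by auto
    then show False by (simp add: AE_iff_null null_sets_def)
  qed
  then have M0: "M \<ge> 0" by (meson abs_ge_zero order_trans)
  define g where "g x = max (- M) (min M (f x))" for x
  have [measurable]: "g \<in> borel_measurable borel" unfolding g_def[abs_def] by measurable
  have "poisson_op t f x = poisson_op t g x"
    by (rule poisson_op_cong_AE) (use t M in \<open>auto simp: g_def\<close>)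
  also have "\<bar>\<dots>\<bar> \<le> M" by (rule poisson_op_bound) (use t M0 in \<open>auto simp: g_def\<close>)
  finally show ?thesis .
qed

lemma poisson_op_deriv_bound:
  fixes f :: "'a::euclidean_space \<Rightarrow> real"
  assumes t: "t > 0" and [measurable]: "f \<in> borel_measurable borel" and M: "\<And>x. \<bar>f x\<bar> \<le> M"
  shows "\<bar>poisson_op_deriv t f x\<bar> \<le> 8 * M / t"
  unfolding poisson_op_deriv_def
  by (rule integrable_stable_density_mult(3)) (use t in \<open>auto intro: mehler_bound M\<close>)

text \<open>
  For fixed \<open>x\<close> only the stable density depends on time, and its derivative at times beyond \<open>t/2\<close> is
  dominated by one integrable function.
\<close>

lemma poisson_op_has_derivative:
  fixes f :: "'a::euclidean_space \<Rightarrow> real"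
  assumes t: "t > 0" and [measurable]: "f \<in> borel_measurable borel" and M: "\<And>x. \<bar>f x\<bar> \<le> M"
  shows "((\<lambda>t. poisson_op t f x) has_real_derivative poisson_op_deriv t f x) (at t)"
  unfolding poisson_op_def poisson_op_deriv_def
proof (rule has_real_derivative_integral[where e="t / 2" and w="\<lambda>r. 8 / (t / 2) * stable_density (t / 2 / 2) r * M"])
  show "integrable lborel (\<lambda>r. stable_density s r * mehler r f x)" if "\<bar>s - t\<bar> < t / 2" for s
  proof -
    have "s > 0" using that by (auto simp: abs_if split: if_splits)
    then show ?thesis by (rule integrable_stable_density_mult) (auto intro: mehler_bound M)
  qed
  show "\<bar>stable_density_deriv s r * mehler r f x\<bar> \<le> 8 / (t / 2) * stable_density (t / 2 / 2) r * M"
    if "\<bar>s - t\<bar> < t / 2" for s r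
  proof -
    have "t / 2 \<le> s" using that by (auto simp: abs_if field_simps split: if_splits)
    then show ?thesis unfolding abs_mult using t mehler_bound[of f M r x] M stable_density_deriv_bound[of "t / 2" s r]
      by (intro mult_mono) (auto intro!: divide_nonneg_pos mult_nonneg_nonneg stable_density_nonneg)
  qed
  show "integrable lborel (\<lambda>r. 8 / (t / 2) * stable_density (t / 2 / 2) r * M)"
    using t by (intro integrable_mult_left integrable_mult_right stable_density_integral) auto
  show "((\<lambda>s. stable_density s r * mehler r f x) has_real_derivative stable_density_deriv s r * mehler r f x) (at s)" for s r
    by (rule DERIV_cmult_right) (rule stable_density_has_derivative)
qed (use t in auto)

text \<open>
  By Fubini's theorem the left side averages \<open>T\<^sub>r T\<^sub>u f = T\<^sub>r\<^sub>+\<^sub>u f\<close> over independent stable times \<open>r\<close> and \<open>u\<close>,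
  and the sum of the two times is again stable.
\<close>

lemma poisson_op_add:
  fixes f :: "'a::euclidean_space \<Rightarrow> real"
  assumes s: "s > 0" and t: "t > 0" and [measurable]: "f \<in> borel_measurable borel" and M: "\<And>x. \<bar>f x\<bar> \<le> M"
  shows "poisson_op s (poisson_op t f) x = poisson_op (s + t) f x"
proof -
  interpret T: prob_space "stable_measure t" by (rule prob_space_stable_measure) fact
  interpret P: pair_prob_space "stable_measure t" "gauss_measure :: 'a measure" ..
  have "poisson_op s (poisson_op t f) x = (\<integral>r. mehler r (poisson_op t f) x \<partial>stable_measure s)"
    by (rule poisson_op_eq_integral_stable_measure) (use s in measurable)
  also have "\<dots> = (\<integral>r. \<integral>u. mehler (r + u) f x \<partial>stable_measure t \<partial>stable_measure s)"
  proof (rule integral_cong_AE)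
    show "AE r in stable_measure s. mehler r (poisson_op t f) x = (\<integral>u. mehler (r + u) f x \<partial>stable_measure t)"
      using AE_stable_measure
    proof eventually_elim
      fix r :: real assume r: "r > 0"
      define Y where "Y z = exp (- r) *\<^sub>R x + sqrt (1 - exp (- 2 * r)) *\<^sub>R z" for z
      have [measurable]: "Y \<in> borel_measurable borel" unfolding Y_def[abs_def] by measurable
      have "mehler r (poisson_op t f) x = (\<integral>z. \<integral>u. mehler u f (Y z) \<partial>stable_measure t \<partial>gauss_measure)"
        unfolding mehler_def[of r] Y_def by (simp add: poisson_op_eq_integral_stable_measure t)
      also have "\<dots> = (\<integral>u. \<integral>z. mehler u f (Y z) \<partial>gauss_measure \<partial>stable_measure t)"
      proof (rule P.Fubini_integral)
        show "integrable (stable_measure t \<Otimes>\<^sub>M gauss_measure) (\<lambda>(u, z). mehler u f (Y z))"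
          by (rule P.P.integrable_const_bound[where B=M]) (auto intro!: AE_I2 mehler_bound M)
      qed
      also have "\<dots> = (\<integral>u. mehler (r + u) f x \<partial>stable_measure t)"
      proof (rule integral_cong_AE)
        show "AE u in stable_measure t. (\<integral>z. mehler u f (Y z) \<partial>gauss_measure) = mehler (r + u) f x"
          using AE_stable_measure
        proof eventually_elim
          fix u :: real assume "u > 0"
          then show "(\<integral>z. mehler u f (Y z) \<partial>gauss_measure) = mehler (r + u) f x"
            using mehler_add[OF r _ assms(3) M, of u x] by (simp add: mehler_def[of r] Y_def)
        qed
      qed measurable
      finally show "mehler r (poisson_op t f) x = (\<integral>u. mehler (r + u) f x \<partial>stable_measure t)" .
    qed
  qed measurable
  also have "\<dots> = (\<integral>r. mehler r f x \<partial>stable_measure (s + t))"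
    by (rule integral_stable_measure_add[OF s t]) (auto intro: mehler_bound M)
  also have "\<dots> = poisson_op (s + t) f x"
    using s t by (simp add: poisson_op_eq_integral_stable_measure)
  finally show ?thesis .
qed

text \<open>
  Differentiate the semigroup law in its first time variable.
\<close>

lemma poisson_op_deriv_add:
  fixes f :: "'a::euclidean_space \<Rightarrow> real"
  assumes s: "s > 0" and t: "t > 0" and [measurable]: "f \<in> borel_measurable borel" and M: "\<And>x. \<bar>f x\<bar> \<le> M"
  shows "poisson_op_deriv s (poisson_op t f) x = poisson_op_deriv (s + t) f x"
proof -
  have 1: "((\<lambda>s. poisson_op s (poisson_op t f) x) has_real_derivative poisson_op_deriv s (poisson_op t f) x) (at s)"
    by (rule poisson_op_has_derivative[where M=M]) (use s t M in \<open>auto intro: poisson_op_bound\<close>)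
  have "((\<lambda>s. poisson_op (s + t) f x) has_real_derivative poisson_op_deriv (s + t) f x) (at s)"
    using poisson_op_has_derivative[OF _ assms(3) M, of "s + t" x] s t by (simp add: DERIV_shift)
  then have 2: "((\<lambda>s. poisson_op s (poisson_op t f) x) has_real_derivative poisson_op_deriv (s + t) f x) (at s)"
  proof (rule DERIV_cong_ev[THEN iffD1, rotated 3])
    show "\<forall>\<^sub>F s in nhds s. poisson_op (s + t) f x = poisson_op s (poisson_op t f) x"
      using eventually_nhds_in_open[of "{0<..}" s] s
      by (auto elim!: eventually_mono simp: poisson_op_add[OF _ t assms(3) M])
  qed auto
  from 1 2 show ?thesis by (rule DERIV_unique)
qed

text \<open>
  Differentiate the semigroup law in its second time variable. Here the derivative has to be taken
  under the integral against the kernel, which \<open>|Q\<^sub>u f| \<le> 8 M/u\<close> with \<open>u \<ge> t/2\<close> justifies.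
\<close>

lemma poisson_op_of_deriv:
  fixes f :: "'a::euclidean_space \<Rightarrow> real"
  assumes s: "s > 0" and t: "t > 0" and [measurable]: "f \<in> borel_measurable borel" and M: "\<And>x. \<bar>f x\<bar> \<le> M"
  shows "poisson_op s (poisson_op_deriv t f) x = poisson_op_deriv (s + t) f x"
proof -
  interpret K: prob_space "poisson_kernel s x" by (rule prob_space_poisson_kernel) fact
  have 1: "((\<lambda>t. \<integral>y. poisson_op t f y \<partial>poisson_kernel s x) has_real_derivative
      (\<integral>y. poisson_op_deriv t f y \<partial>poisson_kernel s x)) (at t)"
  proof (rule has_real_derivative_integral[where e="t / 2" and w="\<lambda>_. 8 * M / (t / 2)"])
    have pos: "u > t / 2" if "\<bar>u - t\<bar> < t / 2" for u
      using that by (auto simp: abs_if field_simps split: if_splits)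
    show "integrable (poisson_kernel s x) (poisson_op u f)" if "\<bar>u - t\<bar> < t / 2" for u
      by (rule integrable_poisson_kernel[where M=M]) (use pos[OF that] s t M in \<open>auto intro: poisson_op_bound\<close>)
    show "((\<lambda>u. poisson_op u f y) has_real_derivative poisson_op_deriv u f y) (at u)" if "\<bar>u - t\<bar> < t / 2" for u y
      by (rule poisson_op_has_derivative[OF _ _ M]) (use pos[OF that] t in auto)
    show "\<bar>poisson_op_deriv u f y\<bar> \<le> 8 * M / (t / 2)" if "\<bar>u - t\<bar> < t / 2" for u y
    proof -
      have "\<bar>poisson_op_deriv u f y\<bar> \<le> 8 * M / u"
        by (rule poisson_op_deriv_bound[OF _ _ M]) (use pos[OF that] t in auto)
      also have "\<dots> \<le> 8 * M / (t / 2)"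
        using pos[OF that] t M[of undefined] by (intro divide_left_mono) auto
      finally show ?thesis .
    qed
  qed (use t in auto)
  have Q: "poisson_op s (poisson_op_deriv t f) x = (\<integral>y. poisson_op_deriv t f y \<partial>poisson_kernel s x)"
    by (rule poisson_op_eq_kernel[where M="8 * M / t"]) (use s t M in \<open>auto intro: poisson_op_deriv_bound\<close>)
  have "((\<lambda>t. poisson_op (s + t) f x) has_real_derivative poisson_op_deriv (s + t) f x) (at t)"
    using poisson_op_has_derivative[OF _ assms(3) M, of "t + s" x] s t unfolding add.commute[of s] by (simp add: DERIV_shift)
  then have 2: "((\<lambda>t. \<integral>y. poisson_op t f y \<partial>poisson_kernel s x) has_real_derivative poisson_op_deriv (s + t) f x) (at t)"
  proof (rule DERIV_cong_ev[THEN iffD1, rotated 3])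
    show "\<forall>\<^sub>F t in nhds t. poisson_op (s + t) f x = (\<integral>y. poisson_op t f y \<partial>poisson_kernel s x)"
      using eventually_nhds_in_open[of "{0<..}" t] t
    proof (auto elim!: eventually_mono)
      fix u :: real assume u: "u > 0"
      have "poisson_op (s + u) f x = poisson_op s (poisson_op u f) x"
        by (rule poisson_op_add[symmetric]) (use s u M in auto)
      also have "\<dots> = (\<integral>y. poisson_op u f y \<partial>poisson_kernel s x)"
        by (rule poisson_op_eq_kernel[where M=M]) (use s u M in \<open>auto intro: poisson_op_bound\<close>)
      finally show "poisson_op (s + u) f x = (\<integral>y. poisson_op u f y \<partial>poisson_kernel s x)" .
    qed
  qed auto
  from DERIV_unique[OF 1 2] Q show ?thesis by simp
qed

lemma poisson_op_symmetric:
  fixes f h :: "'a::euclidean_space \<Rightarrow> real"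
  assumes t: "t > 0"
    and [measurable]: "f \<in> borel_measurable borel" "h \<in> borel_measurable borel"
    and M: "\<And>x. \<bar>f x\<bar> \<le> M" and N: "\<And>x. \<bar>h x\<bar> \<le> N"
  shows "(\<integral>x. h x * poisson_op t f x \<partial>gauss_measure) = (\<integral>x. f x * poisson_op t h x \<partial>gauss_measure)"
proof -
  interpret T: prob_space "stable_measure t" by (rule prob_space_stable_measure) fact
  interpret P: pair_prob_space "stable_measure t" "gauss_measure :: 'a measure" ..
  \<comment> \<open>Both pairings are averages over \<open>r\<close> of the corresponding pairings for \<open>T\<^sub>r\<close>.\<close>
  have swap: "(\<integral>x. h x * poisson_op t f x \<partial>gauss_measure)
      = (\<integral>r. \<integral>x. h x * mehler r f x \<partial>gauss_measure \<partial>stable_measure t)"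
    if [measurable]: "f \<in> borel_measurable borel" "h \<in> borel_measurable borel"
      and M: "\<And>x. \<bar>f x\<bar> \<le> M" and N: "\<And>x. \<bar>h x\<bar> \<le> N" for f h :: "'a \<Rightarrow> real" and M N
  proof -
    have "(\<integral>x. h x * poisson_op t f x \<partial>gauss_measure) = (\<integral>x. \<integral>r. h x * mehler r f x \<partial>stable_measure t \<partial>gauss_measure)"
      by (simp add: poisson_op_eq_integral_stable_measure t)
    also have "\<dots> = (\<integral>r. \<integral>x. h x * mehler r f x \<partial>gauss_measure \<partial>stable_measure t)"
    proof (rule P.Fubini_integral)
      have "\<bar>h x * mehler r f x\<bar> \<le> N * M" for x r
        unfolding abs_mult by (intro mult_mono N mehler_bound M) (use N[of x] in auto)
      then show "integrable (stable_measure t \<Otimes>\<^sub>M gauss_measure) (\<lambda>(r, x). h x * mehler r f x)"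
        by (intro P.P.integrable_const_bound[where B="N * M"]) (auto intro!: AE_I2)
    qed
    finally show ?thesis .
  qed
  have "(\<integral>r. \<integral>x. h x * mehler r f x \<partial>gauss_measure \<partial>stable_measure t)
      = (\<integral>r. \<integral>x. f x * mehler r h x \<partial>gauss_measure \<partial>stable_measure t)"
  proof (rule integral_cong_AE)
    show "AE r in stable_measure t. (\<integral>x. h x * mehler r f x \<partial>gauss_measure) = (\<integral>x. f x * mehler r h x \<partial>gauss_measure)"
      using AE_stable_measure
      by eventually_elim (rule mehler_symmetric[OF _ _ _ M N], auto)
  qed measurable
  then show ?thesis by (simp add: swap[OF _ _ M N] swap[OF _ _ N M])
qed

lemma poisson_op_tendsto_0:
  fixes f :: "'a::euclidean_space \<Rightarrow> real"
  assumes [measurable]: "f \<in> borel_measurable borel" and M: "\<And>x. \<bar>f x\<bar> \<le> M" and cont: "isCont f x"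
    and X: "X \<longlonglongrightarrow> 0" "\<And>n. X n > 0"
  shows "(\<lambda>n. poisson_op (X n) f x) \<longlonglongrightarrow> f x"
proof -
  have "(\<lambda>n. \<integral>u. indicator {0<..} u *\<^sub>R (exp (- u) / sqrt u * mehler ((X n)\<^sup>2 / (4 * u)) f x) \<partial>lborel)
      \<longlonglongrightarrow> (\<integral>u. indicator {0<..} u *\<^sub>R (exp (- u) / sqrt u * f x) \<partial>lborel)"
  proof (rule integral_dominated_convergence[where w="\<lambda>u. indicator {0<..} u *\<^sub>R (exp (- u) / sqrt u) * M"])
    show "AE u in lborel. (\<lambda>n. indicator {0<..} u *\<^sub>R (exp (- u) / sqrt u * mehler ((X n)\<^sup>2 / (4 * u)) f x))
        \<longlonglongrightarrow> indicator {0<..} u *\<^sub>R (exp (- u) / sqrt u * f x)"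
    proof (rule AE_I2)
      fix u :: real
      have qq: "(\<lambda>n. (X n)\<^sup>2 * inverse (4 * u)) \<longlonglongrightarrow> 0\<^sup>2 * inverse (4 * u)"
        by (intro tendsto_mult tendsto_power tendsto_const X)
      have "(\<lambda>n. (X n)\<^sup>2 / (4 * u)) \<longlonglongrightarrow> 0" using qq unfolding divide_inverse by simp
      note tendsto_scaleR[OF tendsto_const tendsto_mult[OF tendsto_const mehler_tendsto_0[OF assms(1) M cont this]]]
      then show "(\<lambda>n. indicator {0<..} u *\<^sub>R (exp (- u) / sqrt u * mehler ((X n)\<^sup>2 / (4 * u)) f x))
        \<longlonglongrightarrow> indicator {0<..} u *\<^sub>R (exp (- u) / sqrt u * f x)" .
    qed
    show "integrable lborel (\<lambda>u. indicator {0<..} u *\<^sub>R (exp (- u) / sqrt u) * M)"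
      using gamma_half_integral(1) unfolding set_integrable_def by (rule integrable_mult_left)
    show "AE u in lborel. norm (indicator {0<..} u *\<^sub>R (exp (- u) / sqrt u * mehler ((X n)\<^sup>2 / (4 * u)) f x))
        \<le> indicator {0<..} u *\<^sub>R (exp (- u) / sqrt u) * M" for n
    proof (rule AE_I2)
      fix u :: real
      have "exp (- u) / sqrt u * \<bar>mehler ((X n)\<^sup>2 / (4 * u)) f x\<bar> \<le> exp (- u) / sqrt u * M" if "u > 0"
        by (rule mult_left_mono[OF mehler_bound[OF M]]) (use that in simp)
      then show "norm (indicator {0<..} u *\<^sub>R (exp (- u) / sqrt u * mehler ((X n)\<^sup>2 / (4 * u)) f x))
        \<le> indicator {0<..} u *\<^sub>R (exp (- u) / sqrt u) * M"
        by (simp add: abs_mult indicator_def)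
    qed
    show "(\<lambda>u. indicator {0<..} u *\<^sub>R (exp (- u) / sqrt u * f x)) \<in> borel_measurable lborel"
      by measurable
    show "(\<lambda>u. indicator {0<..} u *\<^sub>R (exp (- u) / sqrt u * mehler ((X n)\<^sup>2 / (4 * u)) f x)) \<in> borel_measurable lborel" for n
      by measurable
  qed
  then have "(\<lambda>n. 1 / sqrt pi * (LINT u:{0<..}|lborel. exp (- u) / sqrt u * mehler ((X n)\<^sup>2 / (4 * u)) f x))
      \<longlonglongrightarrow> 1 / sqrt pi * (LINT u:{0<..}|lborel. exp (- u) / sqrt u * f x)"
    unfolding set_lebesgue_integral_def by (intro tendsto_intros)
  moreover have "(LINT u:{0<..}|lborel. exp (- u) / sqrt u * f x) = sqrt pi * f x"
    using gamma_half_integral(2) by (simp only: set_integral_mult_left)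
  moreover have "1 / sqrt pi * (LINT u:{0<..}|lborel. exp (- u) / sqrt u * mehler ((X n)\<^sup>2 / (4 * u)) f x)
      = poisson_op (X n) f x" for n
    using poisson_hermite_eq_subordination[OF X(2) assms(1)] poisson_hermite_eq_poisson_op[OF X(2) assms(1)] by metis
  ultimately show ?thesis by simp
qed

section \<open>The Poisson-Hermite semigroup determines the function\<close>

text \<open>
  Boxes form an intersection-stable generator of the Borel sets, so two finite measures that agree
  on them coincide, and then so do their densities. Adding \<open>M\<close> makes both densities nonnegative.
\<close>

lemma AE_eq_if_box_integrals_eq:
  fixes f g :: "'a::euclidean_space \<Rightarrow> real"
  assumes [measurable]: "f \<in> borel_measurable borel" "g \<in> borel_measurable borel"
    and M: "\<And>x. \<bar>f x\<bar> \<le> M" "\<And>x. \<bar>g x\<bar> \<le> M"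
    and eq: "\<And>l u. (\<integral>x. f x * indicator (box l u) x \<partial>gauss_measure) = (\<integral>x. g x * indicator (box l u) x \<partial>gauss_measure)"
  shows "AE x in lborel. f x = g x"
proof -
  \<comment> \<open>The shift by \<open>M\<close> turns the signed function \<open>h\<close> into the density of a finite measure.\<close>
  define D where "D h = density gauss_measure (\<lambda>x::'a. ennreal (h x + M))" for h
  have em: "emeasure (D h) A = ennreal ((\<integral>x. h x * indicator A x \<partial>gauss_measure) + (\<integral>x. M * indicator A x \<partial>gauss_measure))"
    if [measurable]: "h \<in> borel_measurable borel" "A \<in> sets borel" and h: "\<And>x. \<bar>h x\<bar> \<le> M" for h A
  proof -
    have i: "integrable gauss_measure (\<lambda>x. h x * indicator A x)" "integrable gauss_measure (\<lambda>x. M * indicator A x)"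
      by (rule gauss_integrable_bounded[where M="M"]; use h order_trans[OF abs_ge_zero h] in \<open>auto split: split_indicator\<close>)+
    have nonneg: "0 \<le> h x + M" for x using h[of x] by linarith
    have "emeasure (D h) A = (\<integral>\<^sup>+x. ennreal (h x * indicator A x + M * indicator A x) \<partial>gauss_measure)"
      unfolding D_def by (subst emeasure_density) (auto intro!: nn_integral_cong split: split_indicator)
    also have "\<dots> = ennreal (\<integral>x. h x * indicator A x + M * indicator A x \<partial>gauss_measure)"
      using nonneg by (intro nn_integral_eq_integral Bochner_Integration.integrable_add i) (auto split: split_indicator)
    finally show ?thesis using i by simp
  qed
  have "D f = D g"
  proof (rule measure_eqI_generator_eq)
    let ?E = "range (\<lambda>(a, b). box a b::'a set)"
    show "Int_stable ?E"
      by (auto simp: Int_stable_def box_Int_box)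
    show "?E \<subseteq> Pow UNIV" "sets (D f) = sigma_sets UNIV ?E" "sets (D g) = sigma_sets UNIV ?E"
      by (simp_all add: borel_eq_box D_def)
    let ?A = "\<lambda>n::nat. box (- (real n *\<^sub>R One)) (real n *\<^sub>R One) :: 'a set"
    show "range ?A \<subseteq> ?E" "(\<Union>i. ?A i) = UNIV"
      unfolding UN_box_eq_UNIV by auto
    show "emeasure (D f) (?A i) \<noteq> \<infinity>" for i by (simp add: em M)
    show "emeasure (D f) X = emeasure (D g) X" if "X \<in> ?E" for X
      using that by (auto simp: em M eq)
  qed
  then have "AE x in gauss_measure. ennreal (f x + M) = ennreal (g x + M)"
    unfolding D_def by (intro gauss.density_unique) simp_all
  then show ?thesis
    unfolding AE_gauss_measure
  proof eventually_elim
    case (elim x)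
    have "0 \<le> f x + M" "0 \<le> g x + M" using M(1)[of x] M(2)[of x] by linarith+
    with elim show "f x = g x" by simp
  qed
qed

lemma AE_isCont_indicator_box: "AE x in (lborel :: 'a::euclidean_space measure). isCont (indicator (box l u) :: 'a \<Rightarrow> real) x"
proof -
  have "frontier (box l u) \<in> null_sets (lborel :: 'a measure)"
    using negligible_convex_frontier[of "box l u :: 'a set"]
    by (simp add: negligible_iff_null_sets null_sets_completion_iff)
  then have "AE x in lborel. x \<notin> frontier (box l u :: 'a set)" by (rule AE_not_in)
  then show ?thesis by eventually_elim (simp add: isCont_indicator)
qed

text \<open>
  Let \<open>\<phi>\<close> be the indicator of a box. By symmetry \<open>\<integral> \<phi> P\<^sub>t f d\<gamma> = \<integral> f P\<^sub>t \<phi> d\<gamma>\<close>, which tends to \<open>\<integral> f \<phi> d\<gamma>\<close> as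
  \<open>t \<rightarrow> 0\<close> because \<open>P\<^sub>t \<phi> \<rightarrow> \<phi>\<close> off the boundary of the box. So \<open>P\<^sub>t f\<close> for small \<open>t\<close> determines the integrals of
  \<open>f\<close> over boxes.
\<close>

lemma AE_eq_if_poisson_op_eq:
  fixes f g :: "'a::euclidean_space \<Rightarrow> real"
  assumes [measurable]: "f \<in> borel_measurable borel" "g \<in> borel_measurable borel"
    and M: "\<And>x. \<bar>f x\<bar> \<le> M" "\<And>x. \<bar>g x\<bar> \<le> M"
    and eq: "\<And>t x. t > 0 \<Longrightarrow> poisson_op t f x = poisson_op t g x"
  shows "AE x in lborel. f x = g x"
proof (rule AE_eq_if_box_integrals_eq[OF assms(1,2) M])
  fix l u :: 'a
  define \<phi> where "\<phi> = (indicator (box l u) :: 'a \<Rightarrow> real)"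
  have [measurable]: "\<phi> \<in> borel_measurable borel" unfolding \<phi>_def by measurable
  have \<phi>: "\<bar>\<phi> x\<bar> \<le> 1" for x by (simp add: \<phi>_def indicator_def)
  define X where "X n = 1 / real (Suc n)" for n
  have X: "X \<longlonglongrightarrow> 0" "X n > 0" for n
    using LIMSEQ_inverse_real_of_nat by (simp_all add: X_def[abs_def] divide_inverse)
  have lim: "(\<lambda>n. \<integral>x. \<phi> x * poisson_op (X n) h x \<partial>gauss_measure) \<longlonglongrightarrow> (\<integral>x. h x * \<phi> x \<partial>gauss_measure)"
    if [measurable]: "h \<in> borel_measurable borel" and h: "\<And>x. \<bar>h x\<bar> \<le> M" for h
  proof -
    have "(\<lambda>n. \<integral>x. h x * poisson_op (X n) \<phi> x \<partial>gauss_measure) \<longlonglongrightarrow> (\<integral>x. h x * \<phi> x \<partial>gauss_measure)"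
    proof (rule integral_dominated_convergence[where w="\<lambda>_. M * 1"])
      show "AE x in gauss_measure. (\<lambda>n. h x * poisson_op (X n) \<phi> x) \<longlonglongrightarrow> h x * \<phi> x"
        using AE_isCont_indicator_box[of l u, folded \<phi>_def] unfolding AE_gauss_measure
      proof eventually_elim
        case (elim x)
        show ?case by (rule tendsto_mult[OF tendsto_const poisson_op_tendsto_0[OF _ \<phi> elim X]]) measurable
      qed
      show "AE x in gauss_measure. norm (h x * poisson_op (X n) \<phi> x) \<le> M * 1" for n
        unfolding real_norm_def abs_mult
        by (intro AE_I2 mult_mono h poisson_op_bound[OF X(2) _ \<phi>] order_trans[OF abs_ge_zero h]) auto
    qed measurable
    then show ?thesis
      by (simp only: poisson_op_symmetric[OF X(2) that(1) _ h \<phi>] \<open>\<phi> \<in> borel_measurable borel\<close>)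
  qed
  have "(\<lambda>n. \<integral>x. \<phi> x * poisson_op (X n) f x \<partial>gauss_measure) = (\<lambda>n. \<integral>x. \<phi> x * poisson_op (X n) g x \<partial>gauss_measure)"
    by (simp add: eq X)
  with lim[OF assms(1) M(1)] lim[OF assms(2) M(2)]
  have "(\<integral>x. f x * \<phi> x \<partial>gauss_measure) = (\<integral>x. g x * \<phi> x \<partial>gauss_measure)"
    by (metis LIMSEQ_unique)
  then show "(\<integral>x. f x * indicator (box l u) x \<partial>gauss_measure) = (\<integral>x. g x * indicator (box l u) x \<partial>gauss_measure)"
    by (simp add: \<phi>_def)
qed

section \<open>Superpositions of functions under the time derivative\<close>

text \<open>
  The factor \<open>(s/t)\<^sup>\<alpha>\<close> repairs the singularity at \<open>0\<close> as \<open>\<beta> < \<alpha>\<close>, and \<open>0 < \<beta>\<close> gives decay at infinity. The case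
  \<open>t = 1\<close> bounds \<open>D\<^sup>\<beta> f\<close>; the case of exponent \<open>1\<close> and small \<open>t\<close> bounds its time derivative and produces the
  loss of \<open>t\<^sup>-\<^sup>\<beta>\<close>.
\<close>

lemma powr_min_integral:
  fixes \<alpha> \<beta> t :: real
  assumes "0 < \<beta>" "\<beta> < \<alpha>" "t > 0"
  shows "set_integrable lborel {0<..} (\<lambda>s. s powr (- \<beta> - 1) * min 1 ((s / t) powr \<alpha>))"
    and "(LINT s:{0<..}|lborel. s powr (- \<beta> - 1) * min 1 ((s / t) powr \<alpha>)) = t powr (- \<beta>) * (1 / (\<alpha> - \<beta>) + 1 / \<beta>)"
proof -
  define F where "F s = s powr (- \<beta> - 1) * min 1 ((s / t) powr \<alpha>)" for s
  have "((\<lambda>s. s powr (\<alpha> - \<beta> - 1)) has_integral (t powr (\<alpha> - \<beta> - 1 + 1) / (\<alpha> - \<beta> - 1 + 1))) {0..t}"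
    by (rule has_integral_powr_from_0) (use assms in auto)
  then have "((\<lambda>s. t powr (- \<alpha>) * s powr (\<alpha> - \<beta> - 1)) has_integral t powr (- \<alpha>) * (t powr (\<alpha> - \<beta> - 1 + 1) / (\<alpha> - \<beta> - 1 + 1))) {0..t}"
    by (rule has_integral_mult_right)
  moreover have "t powr (- \<alpha>) * (t powr (\<alpha> - \<beta> - 1 + 1) / (\<alpha> - \<beta> - 1 + 1)) = t powr (- \<beta>) / (\<alpha> - \<beta>)"
    using assms by (simp add: powr_add[symmetric])
  ultimately have "((\<lambda>s. t powr (- \<alpha>) * s powr (\<alpha> - \<beta> - 1)) has_integral t powr (- \<beta>) / (\<alpha> - \<beta>)) {0..t}"
    by (simp only:)
  then have h1: "(F has_integral t powr (- \<beta>) / (\<alpha> - \<beta>)) {0..t}"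
  proof (rule has_integral_eq[rotated])
    fix s assume s: "s \<in> {0..t}"
    show "t powr (- \<alpha>) * s powr (\<alpha> - \<beta> - 1) = F s"
    proof (cases "s = 0")
      case False
      then have s: "s > 0" "s \<le> t" using s by auto
      have "(s / t) powr \<alpha> \<le> 1 powr \<alpha>" using s assms by (intro powr_mono2) auto
      then have "F s = s powr (- \<beta> - 1) * (s powr \<alpha> * t powr (- \<alpha>))"
        using s assms by (simp add: F_def powr_divide powr_minus_divide)
      also have "\<dots> = t powr (- \<alpha>) * (s powr (- \<beta> - 1) * s powr \<alpha>)" by (simp only: mult_ac)
      also have "s powr (- \<beta> - 1) * s powr \<alpha> = s powr (\<alpha> - \<beta> - 1)"
        by (simp add: powr_add[symmetric] algebra_simps)
      finally show ?thesis by simp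
    qed (simp add: F_def)
  qed
  have "((\<lambda>s. s powr (- \<beta> - 1)) has_integral -(t powr (- \<beta> - 1 + 1)) / (- \<beta> - 1 + 1)) {t..}"
    by (rule has_integral_powr_to_inf) (use assms in auto)
  then have "((\<lambda>s. s powr (- \<beta> - 1)) has_integral t powr (- \<beta>) / \<beta>) {t..}" by simp
  then have h2: "(F has_integral t powr (- \<beta>) / \<beta>) {t..}"
  proof (rule has_integral_eq[rotated])
    fix s assume s: "s \<in> {t..}"
    then have "1 powr \<alpha> \<le> (s / t) powr \<alpha>" using assms by (intro powr_mono2) auto
    then show "s powr (- \<beta> - 1) = F s" by (simp add: F_def)
  qed
  have "(F has_integral t powr (- \<beta>) / (\<alpha> - \<beta>) + t powr (- \<beta>) / \<beta>) ({0..t} \<union> {t..})"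
    by (rule has_integral_Un[OF h1 h2], rule negligible_subset[of "{t}"]) auto
  moreover have "{0..t} \<union> {t..} = {0..}" using assms by auto
  ultimately have "(F has_integral t powr (- \<beta>) / (\<alpha> - \<beta>) + t powr (- \<beta>) / \<beta>) {0..}" by simp
  then have h: "(F has_integral t powr (- \<beta>) / (\<alpha> - \<beta>) + t powr (- \<beta>) / \<beta>) {0<..}"
    by (rule has_integral_spike_set_eq[THEN iffD1, rotated 2]) (rule negligible_subset[of "{0}"]; auto)+
  have [measurable]: "F \<in> borel_measurable borel" unfolding F_def[abs_def] by measurable
  have "F absolutely_integrable_on {0<..}"
    by (rule nonnegative_absolutely_integrable_1) (use h in \<open>auto simp: integrable_on_def F_def\<close>)
  then have 1: "set_integrable lborel {0<..} F"
    unfolding set_integrable_def by (subst (asm) integrable_completion) auto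
  then show "set_integrable lborel {0<..} (\<lambda>s. s powr (- \<beta> - 1) * min 1 ((s / t) powr \<alpha>))"
    by (simp add: F_def[abs_def])
  have "(LINT s:{0<..}|lborel. F s) = t powr (- \<beta>) / (\<alpha> - \<beta>) + t powr (- \<beta>) / \<beta>"
    using set_borel_integral_eq_integral(2)[OF 1] h by (simp add: integral_unique)
  then show "(LINT s:{0<..}|lborel. s powr (- \<beta> - 1) * min 1 ((s / t) powr \<alpha>)) = t powr (- \<beta>) * (1 / (\<alpha> - \<beta>) + 1 / \<beta>)"
    by (simp add: F_def distrib_left)
qed

lemma integrable_pair_bound:
  fixes F :: "'b \<times> 'c \<Rightarrow> real"
  assumes "sigma_finite_measure N"
    and [measurable]: "F \<in> borel_measurable (M \<Otimes>\<^sub>M N)" and u: "integrable M u" and v: "integrable N v"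
    and bound: "\<And>x y. \<bar>F (x, y)\<bar> \<le> u x * v y"
  shows "integrable (M \<Otimes>\<^sub>M N) F"
proof (rule integrableI_bounded)
  interpret N: sigma_finite_measure N by fact
  have [measurable]: "u \<in> borel_measurable M" "v \<in> borel_measurable N" using u v by auto
  have "(\<integral>\<^sup>+p. ennreal (norm (F p)) \<partial>(M \<Otimes>\<^sub>M N)) = (\<integral>\<^sup>+x. \<integral>\<^sup>+y. ennreal \<bar>F (x, y)\<bar> \<partial>N \<partial>M)"
    by (subst N.nn_integral_fst[symmetric]) simp_all
  also have "\<dots> \<le> (\<integral>\<^sup>+x. \<integral>\<^sup>+y. ennreal \<bar>u x\<bar> * ennreal \<bar>v y\<bar> \<partial>N \<partial>M)"
  proof (intro nn_integral_mono)
    fix x y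
    have "\<bar>F (x, y)\<bar> \<le> \<bar>u x\<bar> * \<bar>v y\<bar>"
      using order_trans[OF bound[of x y] abs_ge_self] by (simp add: abs_mult)
    then show "ennreal \<bar>F (x, y)\<bar> \<le> ennreal \<bar>u x\<bar> * ennreal \<bar>v y\<bar>"
      by (simp add: ennreal_mult[symmetric] ennreal_leI)
  qed
  also have "\<dots> = (\<integral>\<^sup>+x. ennreal \<bar>u x\<bar> \<partial>M) * (\<integral>\<^sup>+y. ennreal \<bar>v y\<bar> \<partial>N)"
    by (simp add: nn_integral_cmult nn_integral_multc)
  also have "\<dots> < \<infinity>"
    using u v by (auto simp: integrable_iff_bounded ennreal_mult_less_top)
  finally show "(\<integral>\<^sup>+p. ennreal (norm (F p)) \<partial>(M \<Otimes>\<^sub>M N)) < \<infinity>" .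
qed measurable

text \<open>
  Two applications of Fubini's theorem, one in the Mehler average and one in the time integral. The
  derivative kernel has no sign, but it is dominated by a multiple of a stable density.
\<close>

lemma poisson_op_deriv_integral:
  fixes B :: "'a::euclidean_space \<times> real \<Rightarrow> real"
  assumes t: "t > 0"
    and [measurable]: "B \<in> borel_measurable (borel \<Otimes>\<^sub>M borel)"
    and \<rho>: "integrable lborel \<rho>" and bound: "\<And>y s. \<bar>B (y, s)\<bar> \<le> \<rho> s"
  shows "poisson_op_deriv t (\<lambda>y. \<integral>s. B (y, s) \<partial>lborel) x = (\<integral>s. poisson_op_deriv t (\<lambda>y. B (y, s)) x \<partial>lborel)"
proof -
  interpret GL: pair_sigma_finite lborel "gauss_measure :: 'a measure" ..
  define m where "m p = mehler (fst p) (\<lambda>y. B (y, snd p)) x" for p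
  have [measurable]: "m \<in> borel_measurable (borel \<Otimes>\<^sub>M borel)"
    unfolding m_def[abs_def] mehler_def by measurable
  have m: "\<bar>m (r, s)\<bar> \<le> \<rho> s" for r s
    unfolding m_def fst_conv snd_conv by (rule mehler_bound) (rule bound)
  have meh: "mehler r (\<lambda>y. \<integral>s. B (y, s) \<partial>lborel) x = (\<integral>s. m (r, s) \<partial>lborel)" for r
    unfolding mehler_def m_def fst_conv snd_conv
  proof (rule GL.Fubini_integral)
    let ?Y = "\<lambda>z. exp (- r) *\<^sub>R x + sqrt (1 - exp (- 2 * r)) *\<^sub>R z"
    show "integrable (lborel \<Otimes>\<^sub>M gauss_measure) (\<lambda>(s, z). B (?Y z, s))"
      by (rule integrable_pair_bound[where u=\<rho> and v="\<lambda>_. 1"])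
        (use \<rho> bound in \<open>auto intro: gauss.sigma_finite_measure_axioms\<close>)
  qed
  have "poisson_op_deriv t (\<lambda>y. \<integral>s. B (y, s) \<partial>lborel) x = (\<integral>r. \<integral>s. stable_density_deriv t r * m (r, s) \<partial>lborel \<partial>lborel)"
    unfolding poisson_op_deriv_def meh by simp
  also have "\<dots> = (\<integral>s. \<integral>r. stable_density_deriv t r * m (r, s) \<partial>lborel \<partial>lborel)"
  proof (rule lborel_pair.Fubini_integral)
    show "integrable (lborel \<Otimes>\<^sub>M lborel) (\<lambda>(s, r). stable_density_deriv t r * m (r, s))"
    proof (rule integrable_pair_bound[where u=\<rho> and v="\<lambda>r. 8 / t * stable_density (t / 2) r"])
      show "integrable lborel (\<lambda>r. 8 / t * stable_density (t / 2) r)"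
        using t by (intro integrable_mult_right stable_density_integral) auto
      show "\<bar>case (s, r) of (s, r) \<Rightarrow> stable_density_deriv t r * m (r, s)\<bar> \<le> \<rho> s * (8 / t * stable_density (t / 2) r)" for s r
        unfolding prod.case abs_mult mult.commute[of "\<rho> s"]
        using t by (intro mult_mono m stable_density_deriv_bound) (auto simp: stable_density_nonneg)
    qed (use \<rho> in \<open>auto intro: lborel.sigma_finite_measure_axioms\<close>)
  qed
  finally show ?thesis by (simp add: poisson_op_deriv_def m_def)
qed

lemma poisson_op_deriv_lincomb:
  fixes f g :: "'a::euclidean_space \<Rightarrow> real"
  assumes t: "t > 0" and [measurable]: "f \<in> borel_measurable borel" "g \<in> borel_measurable borel"
    and M: "\<And>x. \<bar>f x\<bar> \<le> M" and N: "\<And>x. \<bar>g x\<bar> \<le> N"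
  shows "poisson_op_deriv t (\<lambda>y. a * f y + b * g y) x = a * poisson_op_deriv t f x + b * poisson_op_deriv t g x"
proof -
  have meh: "mehler r (\<lambda>y. a * f y + b * g y) x = a * mehler r f x + b * mehler r g x" for r
    using integrable_mehler[OF assms(2) M] integrable_mehler[OF assms(3) N] by (simp add: mehler_def)
  have i: "integrable lborel (\<lambda>r. stable_density_deriv t r * mehler r f x)" "integrable lborel (\<lambda>r. stable_density_deriv t r * mehler r g x)"
    by (rule integrable_stable_density_mult(2)[OF t _ mehler_bound[OF M]], measurable)
       (rule integrable_stable_density_mult(2)[OF t _ mehler_bound[OF N]], measurable)
  have "poisson_op_deriv t (\<lambda>y. a * f y + b * g y) x
      = (\<integral>r. a * (stable_density_deriv t r * mehler r f x) + b * (stable_density_deriv t r * mehler r g x) \<partial>lborel)"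
    unfolding poisson_op_deriv_def meh by (simp add: algebra_simps)
  also have "\<dots> = a * poisson_op_deriv t f x + b * poisson_op_deriv t g x"
    unfolding poisson_op_deriv_def using i by simp
  finally show ?thesis .
qed

section \<open>Pointwise consequences of the Lipschitz condition\<close>

text \<open>
  A bounded Borel representative of a function in \<open>Lip\<^sub>\<alpha>(\<gamma>)\<close>, with \<open>M\<close> bounding its size and \<open>A\<close> its Lipschitz
  constant. As \<open>0 < \<alpha> < 1\<close>, the defining condition involves the first time derivative.
\<close>

locale lipschitz_function =
  fixes f :: "'a::euclidean_space \<Rightarrow> real" and M A \<alpha> :: real
  assumes borel [measurable]: "f \<in> borel_measurable borel"
    and bounded: "\<And>x. \<bar>f x\<bar> \<le> M"
    and alpha: "0 < \<alpha>" "\<alpha> < 1"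
    and A_nonneg: "0 \<le> A"
    and AE_deriv_bound: "\<And>t. t > 0 \<Longrightarrow> AE x in lborel. \<bar>poisson_op_deriv t f x\<bar> \<le> A * t powr (\<alpha> - 1)"
begin

lemma M_nonneg: "0 \<le> M"
  using bounded[of undefined] by linarith

text \<open>
  Times \<open>t\<close> and \<open>t/2\<close> are interchangeable at the price of a factor \<open>2\<close>.
\<close>

lemma half_powr: "t > 0 \<Longrightarrow> (t / 2) powr (\<alpha> - 1) \<le> 2 * t powr (\<alpha> - 1)"
proof -
  assume t: "t > 0"
  have "(t / 2) powr (\<alpha> - 1) = 2 powr (1 - \<alpha>) * t powr (\<alpha> - 1)"
    using t by (simp add: powr_divide powr_diff divide_simps)
  also have "\<dots> \<le> 2 powr 1 * t powr (\<alpha> - 1)"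
    using alpha by (intro mult_right_mono powr_mono) auto
  finally show ?thesis by simp
qed

text \<open>
  Since \<open>Q\<^sub>t f = P\<^sub>t\<^sub>/\<^sub>2 (Q\<^sub>t\<^sub>/\<^sub>2 f)\<close> and \<open>P\<^sub>t\<^sub>/\<^sub>2\<close> ignores null sets, spending half of the time turns the almost
  everywhere bound into an everywhere bound.
\<close>

lemma deriv_bound:
  assumes t: "t > 0"
  shows "\<bar>poisson_op_deriv t f x\<bar> \<le> 2 * A * t powr (\<alpha> - 1)"
proof -
  have "poisson_op_deriv t f x = poisson_op (t / 2) (poisson_op_deriv (t / 2) f) x"
    using poisson_op_of_deriv[OF _ _ borel bounded, of "t / 2" "t / 2" x] t by simp
  also have "\<bar>\<dots>\<bar> \<le> A * (t / 2) powr (\<alpha> - 1)"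
    by (rule poisson_op_bound_AE) (use t AE_deriv_bound[of "t / 2"] in auto)
  also have "\<dots> \<le> A * (2 * t powr (\<alpha> - 1))"
    using half_powr[OF t] A_nonneg by (intro mult_left_mono) auto
  finally show ?thesis by simp
qed

text \<open>
  By the derivative bound, \<open>(2A/\<alpha>) u\<^sup>\<alpha> \<plusminus> P\<^sub>u f(x)\<close> is nondecreasing in \<open>u\<close> for either sign.
\<close>

lemma poisson_op_diff_bound:
  assumes s: "0 < s" "s \<le> t"
  shows "\<bar>poisson_op t f x - poisson_op s f x\<bar> \<le> 2 * A / \<alpha> * (t powr \<alpha> - s powr \<alpha>)"
proof -
  have D: "((\<lambda>u. 2 * A / \<alpha> * u powr \<alpha> + c * poisson_op u f x) has_real_derivative
      2 * A * u powr (\<alpha> - 1) + c * poisson_op_deriv u f x) (at u)" if "u > 0" for u c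
  proof -
    have "((\<lambda>u. u powr \<alpha>) has_real_derivative \<alpha> * u powr (\<alpha> - 1)) (at u)"
      using that by (rule has_real_derivative_powr)
    from DERIV_cmult[OF this, of "2 * A / \<alpha>"]
    have "((\<lambda>u. 2 * A / \<alpha> * u powr \<alpha>) has_real_derivative 2 * A * u powr (\<alpha> - 1)) (at u)"
      using alpha by (simp add: mult.assoc)
    then show ?thesis
      by (intro DERIV_add DERIV_cmult poisson_op_has_derivative[OF that borel bounded])
  qed
  have mono: "2 * A / \<alpha> * s powr \<alpha> + c * poisson_op s f x \<le> 2 * A / \<alpha> * t powr \<alpha> + c * poisson_op t f x"
    if "\<bar>c\<bar> = 1" for c
  proof (rule DERIV_nonneg_imp_nondecreasing[OF s(2)])
    fix u assume "s \<le> u"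
    then have u: "u > 0" using s by simp
    have "\<bar>c * poisson_op_deriv u f x\<bar> \<le> 2 * A * u powr (\<alpha> - 1)"
      using deriv_bound[OF u, of x] that by (simp add: abs_mult)
    then show "\<exists>y. ((\<lambda>u. 2 * A / \<alpha> * u powr \<alpha> + c * poisson_op u f x) has_real_derivative y) (at u) \<and> 0 \<le> y"
      using D[OF u, of c] by (intro exI conjI) (assumption, linarith)
  qed
  show ?thesis using mono[of 1] mono[of "-1"] by (simp add: abs_le_iff right_diff_distrib)
qed

text \<open>
  By the preceding bound on increments, \<open>P\<^sub>t f\<close> converges uniformly to some \<open>g\<close> as \<open>t \<rightarrow> 0\<close>. By the
  semigroup law \<open>P\<^sub>t g = lim P\<^sub>t P\<^sub>s f = lim P\<^sub>t\<^sub>+\<^sub>s f = P\<^sub>t f\<close> as \<open>s \<rightarrow> 0\<close>, hence \<open>g = f\<close> almost everywhere.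
\<close>

lemma obtain_limit_at_0:
  obtains g where "g \<in> borel_measurable borel" "\<And>x. \<bar>g x\<bar> \<le> M" "AE x in lborel. f x = g x"
    "\<And>t x. t > 0 \<Longrightarrow> \<bar>poisson_op t f x - g x\<bar> \<le> 2 * A / \<alpha> * t powr \<alpha>"
    "\<And>t x. t > 0 \<Longrightarrow> poisson_op t g x = poisson_op t f x"
proof -
  define X where "X n = 1 / real (Suc n)" for n
  have X: "X \<longlonglongrightarrow> 0" "\<And>n. X n > 0"
    using LIMSEQ_inverse_real_of_nat by (simp_all add: X_def[abs_def] divide_inverse)
  define C where "C = 2 * A / \<alpha>"
  have C: "C \<ge> 0" using A_nonneg alpha by (simp add: C_def)
  have diff: "\<bar>poisson_op t f x - poisson_op s f x\<bar> \<le> C * max s t powr \<alpha>" if "s > 0" "t > 0" for s t x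
  proof -
    have 1: "\<bar>poisson_op t f x - poisson_op s f x\<bar> \<le> C * t powr \<alpha>" if "0 < s" "s \<le> t" for s t
    proof -
      have "\<bar>poisson_op t f x - poisson_op s f x\<bar> \<le> C * (t powr \<alpha> - s powr \<alpha>)"
        using poisson_op_diff_bound[OF that] by (simp add: C_def)
      also have "\<dots> \<le> C * t powr \<alpha>" using C by (intro mult_left_mono) auto
      finally show ?thesis .
    qed
    show ?thesis
    proof (cases "s \<le> t")
      case True
      then show ?thesis using 1[of s t] that by (simp add: max_def)
    next
      case False
      then show ?thesis using 1[of t s] that by (simp add: max_def abs_minus_commute)
    qed
  qed
  have "Cauchy (\<lambda>n. poisson_op (X n) f x)" for x
  proof (rule metric_CauchyI)
    fix e :: real assume e: "e > 0"
    have "(\<lambda>n. C * X n powr \<alpha>) \<longlonglongrightarrow> C * 0 powr \<alpha>"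
      using X(2) alpha less_imp_le[OF X(2)]
      by (intro tendsto_mult tendsto_const tendsto_powr' X(1)) auto
    then have "(\<lambda>n. C * X n powr \<alpha>) \<longlonglongrightarrow> 0" by simp
    then obtain N where N: "C * X n powr \<alpha> < e" if "n \<ge> N" for n
      using order_tendstoD(2)[of _ 0 sequentially e] e unfolding eventually_sequentially by blast
    have "dist (poisson_op (X m) f x) (poisson_op (X n) f x) < e" if "m \<ge> N" "n \<ge> N" for m n
    proof -
      have "dist (poisson_op (X m) f x) (poisson_op (X n) f x) \<le> C * max (X n) (X m) powr \<alpha>"
        unfolding dist_real_def by (rule diff) (rule X)+
      also have "\<dots> < e" using N[OF that(1)] N[OF that(2)] by (simp add: max_def)
      finally show ?thesis .
    qed
    then show "\<exists>N. \<forall>m\<ge>N. \<forall>n\<ge>N. dist (poisson_op (X m) f x) (poisson_op (X n) f x) < e" by blast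
  qed
  then have conv: "convergent (\<lambda>n. poisson_op (X n) f x)" for x
    by (simp add: real_Cauchy_convergent)
  define g where "g x = lim (\<lambda>n. poisson_op (X n) f x)" for x
  have lim: "(\<lambda>n. poisson_op (X n) f x) \<longlonglongrightarrow> g x" for x
    using conv[of x] by (simp add: g_def convergent_LIMSEQ_iff)
  have g_borel [measurable]: "g \<in> borel_measurable borel"
    by (rule borel_measurable_LIMSEQ_real[where u="\<lambda>n. poisson_op (X n) f"]) (use lim in auto)
  have g_bound: "\<bar>g x\<bar> \<le> M" for x
    by (rule LIMSEQ_le_const2[OF tendsto_rabs[OF lim]]) (auto intro!: poisson_op_bound[OF X(2) borel] bounded)
  have g_close: "\<bar>poisson_op t f x - g x\<bar> \<le> 2 * A / \<alpha> * t powr \<alpha>" if t: "t > 0" for t x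
  proof (rule LIMSEQ_le_const2)
    show "(\<lambda>n. \<bar>poisson_op t f x - poisson_op (X n) f x\<bar>) \<longlonglongrightarrow> \<bar>poisson_op t f x - g x\<bar>"
      by (intro tendsto_rabs tendsto_diff tendsto_const lim)
    obtain N where N: "X n < t" if "n \<ge> N" for n
      using order_tendstoD(2)[OF X(1) t] unfolding eventually_sequentially by blast
    have "\<bar>poisson_op t f x - poisson_op (X n) f x\<bar> \<le> 2 * A / \<alpha> * t powr \<alpha>" if "n \<ge> N" for n
      using diff[OF X(2)[of n] t, of x] N[OF that] by (simp add: C_def max_def)
    then show "\<exists>N. \<forall>n\<ge>N. \<bar>poisson_op t f x - poisson_op (X n) f x\<bar> \<le> 2 * A / \<alpha> * t powr \<alpha>" by blast
  qed
  have g_op: "poisson_op t g x = poisson_op t f x" if t: "t > 0" for t x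
  proof -
    interpret K: prob_space "poisson_kernel t x" by (rule prob_space_poisson_kernel) fact
    have "(\<lambda>n. \<integral>y. poisson_op (X n) f y \<partial>poisson_kernel t x) \<longlonglongrightarrow> (\<integral>y. g y \<partial>poisson_kernel t x)"
      by (rule integral_dominated_convergence[where w="\<lambda>_. M"])
        (use lim in \<open>auto intro!: poisson_op_bound[OF X(2) borel] bounded\<close>)
    moreover have "(\<integral>y. poisson_op (X n) f y \<partial>poisson_kernel t x) = poisson_op (t + X n) f x" for n
    proof -
      have "(\<integral>y. poisson_op (X n) f y \<partial>poisson_kernel t x) = poisson_op t (poisson_op (X n) f) x"
        by (rule poisson_op_eq_kernel[where M=M, OF t, symmetric])
          (auto intro!: poisson_op_bound[OF X(2) borel] bounded)
      also have "\<dots> = poisson_op (t + X n) f x" by (rule poisson_op_add[OF t X(2) borel bounded])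
      finally show ?thesis .
    qed
    moreover have "(\<integral>y. g y \<partial>poisson_kernel t x) = poisson_op t g x"
      by (rule poisson_op_eq_kernel[OF t g_borel g_bound, symmetric])
    ultimately have 1: "(\<lambda>n. poisson_op (t + X n) f x) \<longlonglongrightarrow> poisson_op t g x" by simp
    have "isCont (\<lambda>u. poisson_op u f x) t"
      by (rule DERIV_isCont[OF poisson_op_has_derivative[OF t borel bounded]])
    moreover have "(\<lambda>n. t + X n) \<longlonglongrightarrow> t" using tendsto_add[OF tendsto_const X(1), of t] by simp
    ultimately have "(\<lambda>n. poisson_op (t + X n) f x) \<longlonglongrightarrow> poisson_op t f x"
      by (rule isCont_tendsto_compose)
    from LIMSEQ_unique[OF 1 this] show ?thesis .
  qed
  have "AE x in lborel. f x = g x"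
    by (rule AE_eq_if_poisson_op_eq[OF borel g_borel bounded g_bound]) (simp add: g_op)
  from that[OF g_borel g_bound this g_close g_op] show ?thesis .
qed

text \<open>
  With \<open>\<phi> = Q\<^sub>t\<^sub>/\<^sub>2 f\<close>, which is everywhere of size at most \<open>K = 4 A t\<^sup>\<alpha>\<^sup>-\<^sup>1\<close>, the difference is
  \<open>P\<^sub>t\<^sub>/\<^sub>2\<^sub>+\<^sub>s \<phi> - P\<^sub>t\<^sub>/\<^sub>2 \<phi>\<close>. At times beyond \<open>t/2\<close> the function \<open>P\<^sub>u \<phi>\<close> has slope at most \<open>16 K/t\<close>.
\<close>

lemma deriv_diff_bound:
  assumes t: "t > 0" and s: "s > 0"
  shows "\<bar>poisson_op_deriv (t + s) f x - poisson_op_deriv t f x\<bar> \<le> 64 * A * t powr (\<alpha> - 1) * min 1 (s / t)"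
proof -
  define K where "K = 4 * A * t powr (\<alpha> - 1)"
  have K0: "K \<ge> 0" using A_nonneg by (simp add: K_def)
  define \<phi> where "\<phi> = poisson_op_deriv (t / 2) f"
  have [measurable]: "\<phi> \<in> borel_measurable borel" unfolding \<phi>_def by measurable
  have \<phi>: "\<bar>\<phi> y\<bar> \<le> K" for y
  proof -
    have "\<bar>\<phi> y\<bar> \<le> 2 * A * (t / 2) powr (\<alpha> - 1)" unfolding \<phi>_def by (rule deriv_bound) (use t in simp)
    also have "\<dots> \<le> 2 * A * (2 * t powr (\<alpha> - 1))"
      using half_powr[OF t] A_nonneg by (intro mult_left_mono) auto
    finally show ?thesis by (simp add: K_def)
  qed
  have split: "poisson_op_deriv (t + u) f x = poisson_op (t / 2 + u) \<phi> x" if "u \<ge> 0" for u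
    unfolding \<phi>_def using poisson_op_of_deriv[OF _ _ borel bounded, of "t / 2 + u" "t / 2" x] t that
    by (simp add: add_ac)
  have "\<bar>poisson_op (t / 2 + s) \<phi> x - poisson_op (t / 2) \<phi> x\<bar> \<le> 16 * K / t * s"
  proof -
    have "norm (poisson_op (t / 2 + s) \<phi> x - poisson_op (t / 2) \<phi> x) \<le> 16 * K / t * norm (t / 2 + s - t / 2)"
    proof (rule field_differentiable_bound[where S="{t / 2..}" and f'="\<lambda>u. poisson_op_deriv u \<phi> x"])
      fix u assume "u \<in> {t / 2..}"
      then have u: "u > 0" "t / 2 \<le> u" using t by auto
      show "((\<lambda>u. poisson_op u \<phi> x) has_real_derivative poisson_op_deriv u \<phi> x) (at u within {t / 2..})"
        using poisson_op_has_derivative[where f=\<phi> and M=K, OF u(1) _ \<phi>] by (simp add: has_field_derivative_at_within)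
      have "\<bar>poisson_op_deriv u \<phi> x\<bar> \<le> 8 * K / u" by (rule poisson_op_deriv_bound[OF u(1) _ \<phi>]) measurable
      also have "\<dots> \<le> 8 * K / (t / 2)" using u t K0 by (intro divide_left_mono) auto
      finally show "norm (poisson_op_deriv u \<phi> x) \<le> 16 * K / t" by simp
    qed (use t s in auto)
    then show ?thesis using s by simp
  qed
  then have "\<bar>poisson_op_deriv (t + s) f x - poisson_op_deriv t f x\<bar> \<le> 16 * K * (s / t)"
    using split[of s] split[of 0] s by simp
  moreover have "\<bar>poisson_op_deriv (t + s) f x - poisson_op_deriv t f x\<bar> \<le> 16 * K * 1"
  proof -
    have "\<bar>poisson_op_deriv (t + u) f x\<bar> \<le> K" if "u \<ge> 0" for u
      unfolding split[OF that] by (rule poisson_op_bound[OF _ _ \<phi>]) (use t that in auto)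
    from this[of s] this[of 0] s K0 show ?thesis by (auto simp: abs_le_iff)
  qed
  ultimately have "\<bar>poisson_op_deriv (t + s) f x - poisson_op_deriv t f x\<bar> \<le> 16 * K * min 1 (s / t)"
    by (simp add: min_def)
  then show ?thesis by (simp add: K_def)
qed

end

section \<open>The Bessel derivative of a Lipschitz function\<close>

lemma one_minus_exp_le: "s \<ge> 0 \<Longrightarrow> \<bar>1 - exp (- s)\<bar> \<le> min 1 s" for s :: real
  using exp_ge_add_one_self[of "- s"] by (auto simp: abs_if)

text \<open>
  The representative singled out by \<open>obtain_limit_at_0\<close>: it is the pointwise limit of \<open>P\<^sub>t f\<close> with a rate, so
  that the integral defining \<open>D\<^sup>\<beta> f\<close> converges absolutely at every point.
\<close>

locale lipschitz_representative = lipschitz_function +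
  assumes close: "\<And>t x. t > 0 \<Longrightarrow> \<bar>poisson_op t f x - f x\<bar> \<le> 2 * A / \<alpha> * t powr \<alpha>"
begin

definition bessel_kernel :: "real \<Rightarrow> 'a \<times> real \<Rightarrow> real" where
  "bessel_kernel \<beta> p = indicator {0<..} (snd p) * (snd p powr (- \<beta> - 1) *
     (exp (- snd p) * poisson_op (snd p) f (fst p) - f (fst p)))"

lemma measurable_bessel_kernel [measurable]: "bessel_kernel \<beta> \<in> borel_measurable (borel \<Otimes>\<^sub>M borel)"
  unfolding bessel_kernel_def[abs_def] by measurable

lemma bessel_kernel_eq: "indicator {0<..} s *\<^sub>R bessel_integrand \<beta> f x s = bessel_kernel \<beta> (x, s)"
  by (auto simp: bessel_kernel_def bessel_integrand_def poisson_hermite_eq_poisson_op split: split_indicator)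

definition bessel_dominant :: "real \<Rightarrow> real \<Rightarrow> real" where
  "bessel_dominant \<beta> s = (3 * M + 2 * A / \<alpha>) * (indicator {0<..} s * (s powr (- \<beta> - 1) * min 1 (s powr \<alpha>)))"

lemma bessel_dominant_integral:
  assumes "0 < \<beta>" "\<beta> < \<alpha>"
  shows "integrable lborel (bessel_dominant \<beta>)"
    "(\<integral>s. bessel_dominant \<beta> s \<partial>lborel) = (3 * M + 2 * A / \<alpha>) * (1 / (\<alpha> - \<beta>) + 1 / \<beta>)"
  using powr_min_integral[OF assms, of 1]
  unfolding set_integrable_def set_lebesgue_integral_def bessel_dominant_def[abs_def] by simp_all

text \<open>
  Split \<open>e\<^sup>-\<^sup>s P\<^sub>s f - f\<close> as \<open>(P\<^sub>s f - f) - (1 - e\<^sup>-\<^sup>s) P\<^sub>s f\<close>. The first part is at most \<open>min(2M, (2A/\<alpha>) s\<^sup>\<alpha>)\<close> and the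
  second at most \<open>M min(1, s) \<le> M min(1, s\<^sup>\<alpha>)\<close>.
\<close>

lemma bessel_kernel_bound: "\<bar>bessel_kernel \<beta> (x, s)\<bar> \<le> bessel_dominant \<beta> s"
proof (cases "s > 0")
  case True
  define m where "m = min 1 (s powr \<alpha>)"
  have m_s: "min 1 s \<le> m"
  proof (cases "s \<le> 1")
    case True
    with \<open>s > 0\<close> have "s powr 1 \<le> s powr \<alpha>" using alpha by (intro powr_mono') auto
    then show ?thesis using True \<open>s > 0\<close> by (auto simp: m_def)
  next
    case False
    then have "1 \<le> s powr \<alpha>" using alpha by (simp add: ge_one_powr_ge_zero)
    then show ?thesis by (simp add: m_def)
  qed
  have Pb: "\<bar>poisson_op s f x\<bar> \<le> M" by (rule poisson_op_bound[OF True borel bounded])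
  have C: "2 * A / \<alpha> \<ge> 0" using A_nonneg alpha by simp
  have "\<bar>poisson_op s f x - f x\<bar> \<le> (2 * M + 2 * A / \<alpha>) * m"
  proof (cases "s powr \<alpha> \<le> 1")
    case True
    have "\<bar>poisson_op s f x - f x\<bar> \<le> 2 * A / \<alpha> * s powr \<alpha>" by (rule close[OF \<open>s > 0\<close>])
    also have "\<dots> \<le> (2 * M + 2 * A / \<alpha>) * s powr \<alpha>" using M_nonneg by (intro mult_right_mono) auto
    finally show ?thesis using True by (simp add: m_def)
  next
    case False
    have "\<bar>poisson_op s f x - f x\<bar> \<le> 2 * M" using Pb bounded[of x] by (auto simp: abs_le_iff)
    then show ?thesis using False C by (simp add: m_def)
  qed
  moreover have "\<bar>(1 - exp (- s)) * poisson_op s f x\<bar> \<le> m * M"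
  proof -
    have "\<bar>1 - exp (- s)\<bar> \<le> m" using one_minus_exp_le[of s] True m_s by linarith
    then show ?thesis unfolding abs_mult by (intro mult_mono Pb) (auto simp: m_def)
  qed
  moreover have "exp (- s) * poisson_op s f x - f x = (poisson_op s f x - f x) - (1 - exp (- s)) * poisson_op s f x"
    by (simp add: algebra_simps)
  ultimately have "\<bar>exp (- s) * poisson_op s f x - f x\<bar> \<le> (2 * M + 2 * A / \<alpha>) * m + m * M"
    by linarith
  also have "\<dots> = (3 * M + 2 * A / \<alpha>) * m" by (simp add: algebra_simps)
  finally have "s powr (- \<beta> - 1) * \<bar>exp (- s) * poisson_op s f x - f x\<bar> \<le> s powr (- \<beta> - 1) * ((3 * M + 2 * A / \<alpha>) * m)"
    by (intro mult_left_mono) auto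
  then show ?thesis using True by (simp add: bessel_kernel_def bessel_dominant_def abs_mult m_def mult_ac)
qed (simp add: bessel_kernel_def bessel_dominant_def)

lemma bessel_integrable:
  assumes "0 < \<beta>" "\<beta> < \<alpha>"
  shows "set_integrable lborel {0<..} (bessel_integrand \<beta> f x)"
  unfolding set_integrable_def bessel_kernel_eq
  by (rule Bochner_Integration.integrable_bound[OF bessel_dominant_integral(1)[OF assms]])
    (use order_trans[OF bessel_kernel_bound abs_ge_self] in auto)

lemma bessel_deriv_eq: "bessel_deriv \<beta> f x = 1 / bessel_const \<beta> * (\<integral>s. bessel_kernel \<beta> (x, s) \<partial>lborel)"
  unfolding bessel_deriv_def set_lebesgue_integral_def bessel_kernel_eq ..

lemma measurable_bessel_deriv [measurable]: "bessel_deriv \<beta> f \<in> borel_measurable borel"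
proof -
  have "(\<lambda>x. 1 / bessel_const \<beta> * (\<integral>s. bessel_kernel \<beta> (x, s) \<partial>lborel)) \<in> borel_measurable borel"
    by measurable
  then show ?thesis by (simp add: bessel_deriv_eq[abs_def])
qed

lemma bessel_kernel_integral_bound:
  assumes "0 < \<beta>" "\<beta> < \<alpha>"
  shows "\<bar>\<integral>s. bessel_kernel \<beta> (x, s) \<partial>lborel\<bar> \<le> (3 * M + 2 * A / \<alpha>) * (1 / (\<alpha> - \<beta>) + 1 / \<beta>)"
proof -
  have i: "integrable lborel (\<lambda>s. bessel_kernel \<beta> (x, s))"
    using bessel_integrable[OF assms, of x] unfolding set_integrable_def bessel_kernel_eq .
  have "\<bar>\<integral>s. bessel_kernel \<beta> (x, s) \<partial>lborel\<bar> \<le> (\<integral>s. \<bar>bessel_kernel \<beta> (x, s)\<bar> \<partial>lborel)"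
    by (rule integral_abs_bound)
  also have "\<dots> \<le> (\<integral>s. bessel_dominant \<beta> s \<partial>lborel)"
    by (rule integral_mono) (use i bessel_kernel_bound bessel_dominant_integral[OF assms] in auto)
  finally show ?thesis by (simp add: bessel_dominant_integral[OF assms])
qed

lemma bessel_deriv_bound:
  assumes "0 < \<beta>" "\<beta> < \<alpha>"
  shows "\<bar>bessel_deriv \<beta> f x\<bar> \<le> \<bar>1 / bessel_const \<beta>\<bar> * ((3 * M + 2 * A / \<alpha>) * (1 / (\<alpha> - \<beta>) + 1 / \<beta>))"
  unfolding bessel_deriv_eq abs_mult by (intro mult_left_mono bessel_kernel_integral_bound assms) auto

text \<open>
  The dominating function allows \<open>Q\<^sub>t\<close> to pass under the integral over \<open>s\<close>, and \<open>Q\<^sub>t P\<^sub>s f = Q\<^sub>t\<^sub>+\<^sub>s f\<close>.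
\<close>

lemma poisson_op_deriv_bessel_deriv:
  assumes \<beta>: "0 < \<beta>" "\<beta> < \<alpha>" and t: "t > 0"
  shows "poisson_op_deriv t (bessel_deriv \<beta> f) x = 1 / bessel_const \<beta> *
    (\<integral>s. indicator {0<..} s * (s powr (- \<beta> - 1) * (exp (- s) * poisson_op_deriv (t + s) f x - poisson_op_deriv t f x)) \<partial>lborel)"
proof -
  let ?c = "1 / bessel_const \<beta>"
  have "poisson_op_deriv t (bessel_deriv \<beta> f) x = ?c * poisson_op_deriv t (\<lambda>y. \<integral>s. bessel_kernel \<beta> (y, s) \<partial>lborel) x"
    using poisson_op_deriv_lincomb[where a="?c" and b=0 and f="\<lambda>y. \<integral>s. bessel_kernel \<beta> (y, s) \<partial>lborel"
        and g="\<lambda>y. \<integral>s. bessel_kernel \<beta> (y, s) \<partial>lborel",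
        OF t _ _ bessel_kernel_integral_bound[OF \<beta>] bessel_kernel_integral_bound[OF \<beta>]]
    by (simp add: bessel_deriv_eq[abs_def])
  also have "poisson_op_deriv t (\<lambda>y. \<integral>s. bessel_kernel \<beta> (y, s) \<partial>lborel) x
      = (\<integral>s. poisson_op_deriv t (\<lambda>y. bessel_kernel \<beta> (y, s)) x \<partial>lborel)"
    by (rule poisson_op_deriv_integral[OF t _ bessel_dominant_integral(1)[OF \<beta>] bessel_kernel_bound]) measurable
  also have "\<dots> = (\<integral>s. indicator {0<..} s * (s powr (- \<beta> - 1) * (exp (- s) * poisson_op_deriv (t + s) f x - poisson_op_deriv t f x)) \<partial>lborel)"
  proof (rule Bochner_Integration.integral_cong[OF refl])
    fix s :: real
    show "poisson_op_deriv t (\<lambda>y. bessel_kernel \<beta> (y, s)) x = indicator {0<..} s *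
        (s powr (- \<beta> - 1) * (exp (- s) * poisson_op_deriv (t + s) f x - poisson_op_deriv t f x))"
    proof (cases "s > 0")
      case True
      have "(\<lambda>y. bessel_kernel \<beta> (y, s)) = (\<lambda>y. (s powr (- \<beta> - 1) * exp (- s)) * poisson_op s f y + (- (s powr (- \<beta> - 1))) * f y)"
        using True by (simp add: bessel_kernel_def fun_eq_iff algebra_simps)
      then have "poisson_op_deriv t (\<lambda>y. bessel_kernel \<beta> (y, s)) x
          = (s powr (- \<beta> - 1) * exp (- s)) * poisson_op_deriv t (poisson_op s f) x + (- (s powr (- \<beta> - 1))) * poisson_op_deriv t f x"
        using poisson_op_deriv_lincomb[where f="poisson_op s f" and g=f and a="s powr (- \<beta> - 1) * exp (- s)" and b="- (s powr (- \<beta> - 1))",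
          OF t _ borel poisson_op_bound[OF True borel bounded] bounded] by simp
      then show ?thesis
        using True poisson_op_deriv_add[OF t True borel bounded] by (simp add: algebra_simps)
    next
      case False
      then show ?thesis by (simp add: bessel_kernel_def poisson_op_deriv_def mehler_def)
    qed
  qed
  finally show ?thesis .
qed

text \<open>
  The integrand is at most \<open>66 A t\<^sup>\<alpha>\<^sup>-\<^sup>1 s\<^sup>-\<^sup>\<beta>\<^sup>-\<^sup>1 min(1, s/t)\<close>: a part \<open>64\<close> from \<open>Q\<^sub>t\<^sub>+\<^sub>s f - Q\<^sub>t f\<close> and a part \<open>2\<close>
  from \<open>(1 - e\<^sup>-\<^sup>s) Q\<^sub>t\<^sub>+\<^sub>s f\<close>. The latter uses \<open>1 - e\<^sup>-\<^sup>s \<le> min(1, s) \<le> min(1, s/t)\<close>, which requires \<open>t \<le> 1\<close>.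
\<close>

lemma poisson_op_deriv_bessel_deriv_bound_small:
  assumes \<beta>: "0 < \<beta>" "\<beta> < \<alpha>" and t: "0 < t" "t \<le> 1"
  shows "\<bar>poisson_op_deriv t (bessel_deriv \<beta> f) x\<bar>
    \<le> \<bar>1 / bessel_const \<beta>\<bar> * (66 * A * (1 / (1 - \<beta>) + 1 / \<beta>)) * t powr (\<alpha> - \<beta> - 1)"
proof -
  define H where "H s = indicator {0<..} s * (s powr (- \<beta> - 1) * (exp (- s) * poisson_op_deriv (t + s) f x - poisson_op_deriv t f x))" for s
  define W where "W s = 66 * A * t powr (\<alpha> - 1) * (indicator {0<..} s * (s powr (- \<beta> - 1) * min 1 ((s / t) powr 1)))" for s
  have \<beta>1: "\<beta> < 1" using \<beta> alpha by simp
  have HW: "\<bar>H s\<bar> \<le> W s" for s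
  proof (cases "s > 0")
    case True
    have "\<bar>(1 - exp (- s)) * poisson_op_deriv (t + s) f x\<bar> \<le> min 1 (s / t) * (2 * A * t powr (\<alpha> - 1))"
      unfolding abs_mult
    proof (intro mult_mono)
      have "s \<le> s / t" using True t by (simp add: pos_le_divide_eq mult_le_cancel_left1)
      then show "\<bar>1 - exp (- s)\<bar> \<le> min 1 (s / t)" using one_minus_exp_le[of s] True by linarith
      have "\<bar>poisson_op_deriv (t + s) f x\<bar> \<le> 2 * A * (t + s) powr (\<alpha> - 1)" by (rule deriv_bound) (use t True in simp)
      also have "\<dots> \<le> 2 * A * t powr (\<alpha> - 1)"
        using t True alpha A_nonneg by (intro mult_left_mono powr_mono2') auto
      finally show "\<bar>poisson_op_deriv (t + s) f x\<bar> \<le> 2 * A * t powr (\<alpha> - 1)" .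
    qed (use True t in auto)
    moreover have "\<bar>poisson_op_deriv (t + s) f x - poisson_op_deriv t f x\<bar> \<le> 64 * A * t powr (\<alpha> - 1) * min 1 (s / t)"
      by (rule deriv_diff_bound[OF t(1) True])
    moreover have "exp (- s) * poisson_op_deriv (t + s) f x - poisson_op_deriv t f x
        = (poisson_op_deriv (t + s) f x - poisson_op_deriv t f x) - (1 - exp (- s)) * poisson_op_deriv (t + s) f x"
      by (simp add: algebra_simps)
    ultimately have "\<bar>exp (- s) * poisson_op_deriv (t + s) f x - poisson_op_deriv t f x\<bar>
        \<le> 64 * A * t powr (\<alpha> - 1) * min 1 (s / t) + min 1 (s / t) * (2 * A * t powr (\<alpha> - 1))"
      by linarith
    also have "\<dots> = 66 * A * t powr (\<alpha> - 1) * min 1 (s / t)" by (simp add: algebra_simps)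
    finally have "s powr (- \<beta> - 1) * \<bar>exp (- s) * poisson_op_deriv (t + s) f x - poisson_op_deriv t f x\<bar>
        \<le> s powr (- \<beta> - 1) * (66 * A * t powr (\<alpha> - 1) * min 1 (s / t))"
      by (intro mult_left_mono) auto
    then show ?thesis using True t by (simp add: H_def W_def abs_mult mult_ac)
  qed (simp add: H_def W_def)
  have W: "integrable lborel W" "(\<integral>s. W s \<partial>lborel) = 66 * A * t powr (\<alpha> - 1) * (t powr (- \<beta>) * (1 / (1 - \<beta>) + 1 / \<beta>))"
    using powr_min_integral[OF \<beta>(1) \<beta>1 t(1)]
    unfolding set_integrable_def set_lebesgue_integral_def W_def[abs_def] by simp_all
  have [measurable]: "H \<in> borel_measurable borel" unfolding H_def[abs_def] by measurable
  have H: "integrable lborel H"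
    by (rule Bochner_Integration.integrable_bound[OF W(1)]) (use order_trans[OF HW abs_ge_self] in auto)
  have "\<bar>\<integral>s. H s \<partial>lborel\<bar> \<le> (\<integral>s. \<bar>H s\<bar> \<partial>lborel)" by (rule integral_abs_bound)
  also have "\<dots> \<le> (\<integral>s. W s \<partial>lborel)" by (rule integral_mono) (use H W HW in auto)
  also have "\<dots> = (66 * A * (1 / (1 - \<beta>) + 1 / \<beta>)) * (t powr (\<alpha> - 1) * t powr (- \<beta>))"
    unfolding W by (simp only: mult_ac)
  also have "t powr (\<alpha> - 1) * t powr (- \<beta>) = t powr (\<alpha> - \<beta> - 1)"
    by (simp add: powr_add[symmetric] algebra_simps)
  finally have "\<bar>\<integral>s. H s \<partial>lborel\<bar> \<le> (66 * A * (1 / (1 - \<beta>) + 1 / \<beta>)) * t powr (\<alpha> - \<beta> - 1)" .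
  then show ?thesis
    unfolding poisson_op_deriv_bessel_deriv[OF \<beta> t(1)] H_def[symmetric] abs_mult mult.assoc[of "\<bar>1 / bessel_const \<beta>\<bar>"]
    by (intro mult_left_mono) auto
qed

text \<open>
  For \<open>t > 1\<close> the general bound \<open>8/t\<close> for a time derivative is enough, because \<open>t\<^sup>-\<^sup>1 \<le> t\<^sup>\<alpha>\<^sup>-\<^sup>\<beta>\<^sup>-\<^sup>1\<close>.
\<close>

lemma poisson_op_deriv_bessel_deriv_bound:
  assumes \<beta>: "0 < \<beta>" "\<beta> < \<alpha>" and t: "0 < t"
  defines "D \<equiv> \<bar>1 / bessel_const \<beta>\<bar> * (66 * A * (1 / (1 - \<beta>) + 1 / \<beta>))
      + 8 * (\<bar>1 / bessel_const \<beta>\<bar> * ((3 * M + 2 * A / \<alpha>) * (1 / (\<alpha> - \<beta>) + 1 / \<beta>)))"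
  shows "\<bar>poisson_op_deriv t (bessel_deriv \<beta> f) x\<bar> \<le> D * t powr (\<alpha> - \<beta> - 1)"
proof -
  define D1 D2 where "D1 = \<bar>1 / bessel_const \<beta>\<bar> * (66 * A * (1 / (1 - \<beta>) + 1 / \<beta>))"
    and "D2 = \<bar>1 / bessel_const \<beta>\<bar> * ((3 * M + 2 * A / \<alpha>) * (1 / (\<alpha> - \<beta>) + 1 / \<beta>))"
  have D: "D = D1 + 8 * D2" by (simp add: D_def D1_def D2_def)
  have nonneg: "D1 \<ge> 0" "D2 \<ge> 0"
    unfolding D1_def D2_def using \<beta> alpha A_nonneg M_nonneg by simp_all
  show ?thesis
  proof (cases "t \<le> 1")
    case True
    have "\<bar>poisson_op_deriv t (bessel_deriv \<beta> f) x\<bar> \<le> D1 * t powr (\<alpha> - \<beta> - 1)"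
      unfolding D1_def by (rule poisson_op_deriv_bessel_deriv_bound_small[OF \<beta> t True])
    also have "\<dots> \<le> D * t powr (\<alpha> - \<beta> - 1)" using nonneg by (intro mult_right_mono) (auto simp: D)
    finally show ?thesis .
  next
    case False
    have "\<bar>poisson_op_deriv t (bessel_deriv \<beta> f) x\<bar> \<le> 8 * D2 / t"
      by (rule poisson_op_deriv_bound[OF t]) (use bessel_deriv_bound[OF \<beta>] in \<open>auto simp: D2_def\<close>)
    also have "\<dots> = 8 * D2 * t powr (- 1)" using t by (simp add: powr_minus divide_inverse)
    also have "\<dots> \<le> D * t powr (\<alpha> - \<beta> - 1)"
      using nonneg False \<beta> by (intro mult_mono powr_mono) (auto simp: D)
    finally show ?thesis .
  qed
qed

end

section \<open>Boundedness in the Lipschitz norms\<close>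

lemma borel_measurable_gauss_measure: "borel_measurable gauss_measure = borel_measurable borel"
  by (rule measurable_cong_sets) auto

lemma Linf_norm_le_iff:
  fixes h :: "'a::euclidean_space \<Rightarrow> real"
  assumes [measurable]: "h \<in> borel_measurable borel"
  shows "Linf_norm h \<le> ereal B \<longleftrightarrow> (AE x in lborel. \<bar>h x\<bar> \<le> B)"
proof
  assume le: "Linf_norm h \<le> ereal B"
  have "AE x in gauss_measure. ereal \<bar>h x\<bar> \<le> Linf_norm h"
    unfolding Linf_norm_def by (rule esssup_AE)
  then have "AE x in gauss_measure. \<bar>h x\<bar> \<le> B"
    by eventually_elim (use le in \<open>metis ereal_less_eq(3) order_trans\<close>)
  then show "AE x in lborel. \<bar>h x\<bar> \<le> B" by (simp add: AE_gauss_measure)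
next
  assume "AE x in lborel. \<bar>h x\<bar> \<le> B"
  then show "Linf_norm h \<le> ereal B"
    unfolding Linf_norm_def by (intro esssup_I) (auto simp: AE_gauss_measure)
qed

lemma Linf_norm_nonneg: "0 \<le> Linf_norm h"
proof (rule ccontr)
  assume neg: "\<not> 0 \<le> Linf_norm h"
  have "AE x in gauss_measure. ereal \<bar>h x\<bar> \<le> Linf_norm h"
    unfolding Linf_norm_def by (rule esssup_AE)
  then have "AE x in (gauss_measure :: 'a measure). False"
  proof eventually_elim
    case (elim x)
    have "0 \<le> ereal \<bar>h x\<bar>" by simp
    with elim neg show False by (metis order_trans)
  qed
  then show False by simp
qed

text \<open>
  Truncation at the essential supremum yields a function bounded everywhere.
\<close>

lemma Linf_bounded_representative:
  fixes f :: "'a::euclidean_space \<Rightarrow> real"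
  assumes "f \<in> Linf"
  obtains f' M where "f \<in> borel_measurable borel" "f' \<in> borel_measurable borel" "\<And>x. \<bar>f' x\<bar> \<le> M"
    "AE x in lborel. f x = f' x" "Linf_norm f = ereal M"
proof -
  have [measurable]: "f \<in> borel_measurable borel" and fin: "Linf_norm f < \<infinity>"
    using assms by (auto simp: Linf_def borel_measurable_gauss_measure)
  obtain M where M: "Linf_norm f = ereal M" "0 \<le> M"
    using fin Linf_norm_nonneg[of f] by (cases "Linf_norm f") auto
  then have b: "AE x in lborel. \<bar>f x\<bar> \<le> M" using Linf_norm_le_iff[of f M] by simp
  show ?thesis
  proof (rule that[of "\<lambda>x. max (- M) (min M (f x))" M])
    show "AE x in lborel. f x = max (- M) (min M (f x))" using b by eventually_elim (auto simp: abs_le_iff)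
  qed (use M in auto)
qed

lemma lip_order_eq_1:
  assumes "0 < \<alpha>" "\<alpha> < 1"
  shows "lip_order \<alpha> = 1"
  unfolding lip_order_def
proof (rule Least_equality)
  fix n :: nat assume "\<alpha> < real n"
  then show "1 \<le> n" using assms by (cases n) auto
qed (use assms in simp)

text \<open>
  The Lipschitz condition sees only the class of \<open>f\<close>, so it can be tested on a bounded representative
  \<open>g\<close>, for which the derivative is the explicit integral \<open>Q\<^sub>t g\<close>.
\<close>

lemma lip_bound_iff:
  fixes f g :: "'a::euclidean_space \<Rightarrow> real"
  assumes \<alpha>: "0 < \<alpha>" "\<alpha> < 1" and [measurable]: "f \<in> borel_measurable borel" "g \<in> borel_measurable borel"
    and M: "\<And>x. \<bar>g x\<bar> \<le> M" and fg: "AE x in lborel. f x = g x"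
  shows "lip_bound \<alpha> f A \<longleftrightarrow> (\<forall>t>0. AE x in lborel. \<bar>poisson_op_deriv t g x\<bar> \<le> A * t powr (\<alpha> - 1))"
proof -
  have "deriv (\<lambda>s. poisson_hermite s f x) t = poisson_op_deriv t g x" if t: "t > 0" for t x
  proof -
    have "deriv (\<lambda>s. poisson_hermite s f x) t = deriv (\<lambda>s. poisson_op s g x) t"
    proof (rule deriv_cong_ev[OF _ refl])
      have "poisson_hermite s f x = poisson_op s g x" if "s > 0" for s
        using poisson_hermite_cong_AE[OF that assms(3,4) fg] poisson_hermite_eq_poisson_op[OF that assms(4)] by simp
      then show "\<forall>\<^sub>F s in nhds t. poisson_hermite s f x = poisson_op s g x"
        using eventually_nhds_in_open[of "{0<..}" t] t by (auto elim!: eventually_mono)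
    qed
    also have "\<dots> = poisson_op_deriv t g x"
      by (rule DERIV_imp_deriv[OF poisson_op_has_derivative[OF t assms(4) M]])
    finally show ?thesis .
  qed
  then show ?thesis
    unfolding lip_bound_def lip_order_eq_1[OF \<alpha>] using assms(4)
    by (simp add: Linf_norm_le_iff)
qed

text \<open>
  For each \<open>t\<close> the condition is a closed lower bound on \<open>A\<close>, and at \<open>t = 1\<close> it forces \<open>A \<ge> 0\<close>. So the
  infimum of the admissible constants is admissible and the least constant exists.
\<close>

lemma lip_const_least:
  fixes f :: "'a::euclidean_space \<Rightarrow> real"
  assumes "lip_bound \<alpha> f A0"
  shows "lip_bound \<alpha> f (lip_const \<alpha> f)" "0 \<le> lip_const \<alpha> f" "\<And>A. lip_bound \<alpha> f A \<Longrightarrow> lip_const \<alpha> f \<le> A"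
proof -
  define S where "S = {A. lip_bound \<alpha> f A}"
  define N where "N t = Linf_norm (\<lambda>x. (deriv ^^ lip_order \<alpha>) (\<lambda>s. poisson_hermite s f x) t)" for t
  define p where "p = - real (lip_order \<alpha>) + \<alpha>"
  have S: "A \<in> S \<longleftrightarrow> (\<forall>t>0. N t \<le> ereal (A * t powr p))" for A
    by (simp add: S_def lip_bound_def N_def p_def)
  have ne: "S \<noteq> {}" using assms by (auto simp: S_def)
  have nonneg: "0 \<le> A" if "A \<in> S" for A
  proof -
    have "0 \<le> N 1" unfolding N_def by (rule Linf_norm_nonneg)
    also have "N 1 \<le> ereal A" using that S[of A] by (metis mult.right_neutral powr_one_eq_one zero_less_one)
    finally show ?thesis by simp
  qed
  have bdd: "bdd_below S" using nonneg by (intro bdd_belowI)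
  have inS: "Inf S \<in> S"
    unfolding S
  proof (intro allI impI)
    fix t :: real assume t: "t > 0"
    obtain A where A: "A \<in> S" using ne by blast
    have "0 \<le> N t" unfolding N_def by (rule Linf_norm_nonneg)
    moreover have "N t \<le> ereal (A * t powr p)" using A t by (simp add: S)
    ultimately obtain n where n: "N t = ereal n" by (cases "N t") auto
    have "n / t powr p \<le> Inf S"
      using ne
    proof (rule cInf_greatest)
      fix A assume "A \<in> S"
      then have "n \<le> A * t powr p" using S[of A] t n by (metis ereal_less_eq(3))
      then show "n / t powr p \<le> A" using t by (simp add: divide_le_eq)
    qed
    then show "N t \<le> ereal (Inf S * t powr p)" using t n by (simp add: divide_le_eq)
  qed
  have "lip_const \<alpha> f = Inf S"
    unfolding lip_const_def
    by (rule Least_equality) (use inS bdd in \<open>auto simp: S_def intro: cInf_lower\<close>)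
  then show "lip_bound \<alpha> f (lip_const \<alpha> f)" "0 \<le> lip_const \<alpha> f" "\<And>A. lip_bound \<alpha> f A \<Longrightarrow> lip_const \<alpha> f \<le> A"
    using inS nonneg bdd by (auto simp: S_def intro: cInf_lower)
qed

text \<open>
  Replacing \<open>f\<close> by the limit of \<open>P\<^sub>t f\<close> changes \<open>D\<^sup>\<beta> f\<close> on a null set only, so the pointwise estimates for that
  representative give the norm bound, with constants that are linear in \<open>M + A\<close>.
\<close>

lemma bessel_deriv_gauss_lip:
  fixes f :: "'a::euclidean_space \<Rightarrow> real"
  assumes ab: "0 < \<beta>" "\<beta> < \<alpha>" "\<alpha> < 1" and f: "f \<in> gauss_lip \<alpha>"
  defines "b \<equiv> \<bar>1 / bessel_const \<beta>\<bar>"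
  defines "C1 \<equiv> b * ((3 + 2 / \<alpha>) * (1 / (\<alpha> - \<beta>) + 1 / \<beta>))"
  defines "C2 \<equiv> b * (66 * (1 / (1 - \<beta>) + 1 / \<beta>)) + 8 * C1"
  shows "(AE x in gauss_measure. set_integrable lborel {0<..} (bessel_integrand \<beta> f x))
    \<and> bessel_deriv \<beta> f \<in> gauss_lip (\<alpha> - \<beta>)
    \<and> gauss_lip_norm (\<alpha> - \<beta>) (bessel_deriv \<beta> f) \<le> ereal (C1 + C2) * gauss_lip_norm \<alpha> f"
proof -
  have \<alpha>: "0 < \<alpha>" "\<alpha> < 1" using ab by auto
  have fL: "f \<in> Linf" and fb: "\<exists>A. lip_bound \<alpha> f A" using f by (auto simp: gauss_lip_def)
  obtain f1 M where [measurable]: "f \<in> borel_measurable borel" "f1 \<in> borel_measurable borel" and f1: "\<And>x. \<bar>f1 x\<bar> \<le> M"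
    "AE x in lborel. f x = f1 x" and M: "Linf_norm f = ereal M"
    by (rule Linf_bounded_representative[OF fL]) auto
  define A where "A = lip_const \<alpha> f"
  have A: "lip_bound \<alpha> f A" "0 \<le> A" using fb lip_const_least by (auto simp: A_def)
  have M0: "0 \<le> M" using Linf_norm_nonneg[of f] M by simp
  interpret F1: lipschitz_function f1 M A \<alpha>
    by standard (use f1 \<alpha> A lip_bound_iff[OF \<alpha> _ _ f1, of A] in auto)
  obtain g where g: "g \<in> borel_measurable borel" "\<And>x. \<bar>g x\<bar> \<le> M" "AE x in lborel. f1 x = g x"
    "\<And>t x. t > 0 \<Longrightarrow> \<bar>poisson_op t f1 x - g x\<bar> \<le> 2 * A / \<alpha> * t powr \<alpha>"
    "\<And>t x. t > 0 \<Longrightarrow> poisson_op t g x = poisson_op t f1 x"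
    by (rule F1.obtain_limit_at_0) blast
  note [measurable] = g(1)
  have fg: "AE x in lborel. f x = g x" using f1(2) g(3) by eventually_elim simp
  \<comment> \<open>From here on all estimates are for \<open>g\<close>, where they hold pointwise.\<close>
  interpret G: lipschitz_representative g M A \<alpha>
    by standard (use g \<alpha> A lip_bound_iff[OF \<alpha> _ g(1,2) fg, of A] in auto)
  have same: "AE x in lborel. bessel_integrand \<beta> f x = bessel_integrand \<beta> g x"
    using fg
  proof eventually_elim
    case (elim x)
    have "poisson_hermite s f x = poisson_hermite s g x" for s
      using poisson_hermite_cong_AE[of s f g x] fg elim by (cases "s > 0") (auto simp: poisson_hermite_def)
    then show ?case using elim by (simp add: bessel_integrand_def fun_eq_iff)
  qed
  have int: "AE x in gauss_measure. set_integrable lborel {0<..} (bessel_integrand \<beta> f x)"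
    unfolding AE_gauss_measure using same by eventually_elim (simp add: G.bessel_integrable[OF ab(1,2)])
  have sameD: "AE x in lborel. bessel_deriv \<beta> f x = bessel_deriv \<beta> g x"
    using same by eventually_elim (simp add: bessel_deriv_def)
  have Bf [measurable]: "bessel_deriv \<beta> f \<in> borel_measurable borel"
  proof -
    have [measurable]: "(\<lambda>p. bessel_integrand \<beta> f (fst p) (snd p) * indicator {0<..} (snd p)) \<in> borel_measurable (borel \<Otimes>\<^sub>M borel)"
    proof -
      have "(\<lambda>p. bessel_integrand \<beta> f (fst p) (snd p) * indicator {0<..} (snd p))
        = (\<lambda>p. indicator {0<..} (snd p) * (snd p powr (- \<beta> - 1) * (exp (- snd p) * poisson_op (snd p) f (fst p) - f (fst p))))"
        by (auto simp: bessel_integrand_def poisson_hermite_eq_poisson_op fun_eq_iff split: split_indicator)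
      then show ?thesis by simp
    qed
    have "(\<lambda>x. 1 / bessel_const \<beta> * (\<integral>s. (\<lambda>p. bessel_integrand \<beta> f (fst p) (snd p) * indicator {0<..} (snd p)) (x, s) \<partial>lborel)) \<in> borel_measurable borel"
      by measurable
    then show ?thesis
      by (simp add: bessel_deriv_def[abs_def] set_lebesgue_integral_def mult.commute)
  qed
  have pos: "0 \<le> b" "0 \<le> 1 / (\<alpha> - \<beta>) + 1 / \<beta>" "0 \<le> 1 / (1 - \<beta>) + 1 / \<beta>" using ab by (auto simp: b_def)
  have le1: "b * ((3 * M + 2 * A / \<alpha>) * (1 / (\<alpha> - \<beta>) + 1 / \<beta>)) \<le> C1 * (M + A)"
  proof -
    have "3 * M + 2 * A / \<alpha> \<le> (3 + 2 / \<alpha>) * (M + A)"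
      using M0 A(2) \<alpha> by (simp add: distrib_left distrib_right)
    then have "b * ((3 * M + 2 * A / \<alpha>) * (1 / (\<alpha> - \<beta>) + 1 / \<beta>)) \<le> b * ((3 + 2 / \<alpha>) * (M + A) * (1 / (\<alpha> - \<beta>) + 1 / \<beta>))"
      using pos by (intro mult_left_mono mult_right_mono) auto
    then show ?thesis by (simp add: C1_def mult_ac)
  qed
  have le2: "b * (66 * A * (1 / (1 - \<beta>) + 1 / \<beta>)) \<le> b * (66 * (1 / (1 - \<beta>) + 1 / \<beta>)) * (M + A)"
  proof -
    have "b * (66 * (1 / (1 - \<beta>) + 1 / \<beta>)) * A \<le> b * (66 * (1 / (1 - \<beta>) + 1 / \<beta>)) * (M + A)"
      using pos M0 by (intro mult_left_mono mult_nonneg_nonneg) auto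
    then show ?thesis by (simp add: mult_ac)
  qed
  have Dg: "\<bar>bessel_deriv \<beta> g x\<bar> \<le> C1 * (M + A)" for x
    using G.bessel_deriv_bound[OF ab(1,2), of x] le1 by (simp add: b_def)
  have Qg: "\<bar>poisson_op_deriv t (bessel_deriv \<beta> g) x\<bar> \<le> C2 * (M + A) * t powr (\<alpha> - \<beta> - 1)" if "t > 0" for t x
  proof -
    have "\<bar>poisson_op_deriv t (bessel_deriv \<beta> g) x\<bar> \<le> (b * (66 * A * (1 / (1 - \<beta>) + 1 / \<beta>))
        + 8 * (b * ((3 * M + 2 * A / \<alpha>) * (1 / (\<alpha> - \<beta>) + 1 / \<beta>)))) * t powr (\<alpha> - \<beta> - 1)"
      unfolding b_def by (rule G.poisson_op_deriv_bessel_deriv_bound[OF ab(1,2) that])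
    also have "\<dots> \<le> C2 * (M + A) * t powr (\<alpha> - \<beta> - 1)"
    proof (rule mult_right_mono)
      have "C2 * (M + A) = b * (66 * (1 / (1 - \<beta>) + 1 / \<beta>)) * (M + A) + 8 * (C1 * (M + A))"
        unfolding C2_def by (simp only: distrib_right mult.assoc)
      then show "b * (66 * A * (1 / (1 - \<beta>) + 1 / \<beta>)) + 8 * (b * ((3 * M + 2 * A / \<alpha>) * (1 / (\<alpha> - \<beta>) + 1 / \<beta>))) \<le> C2 * (M + A)"
        using le1 le2 by linarith
    qed simp
    finally show ?thesis .
  qed
  have ab': "0 < \<alpha> - \<beta>" "\<alpha> - \<beta> < 1" using ab by auto
  have norm: "Linf_norm (bessel_deriv \<beta> f) \<le> ereal (C1 * (M + A))"
    unfolding Linf_norm_le_iff[OF Bf] using sameD by eventually_elim (simp add: Dg)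
  have lip: "lip_bound (\<alpha> - \<beta>) (bessel_deriv \<beta> f) (C2 * (M + A))"
    unfolding lip_bound_iff[OF ab' Bf G.measurable_bessel_deriv Dg sameD] using Qg by auto
  have mem: "bessel_deriv \<beta> f \<in> gauss_lip (\<alpha> - \<beta>)"
    unfolding gauss_lip_def Linf_def using norm lip Bf
    by (auto simp: borel_measurable_gauss_measure intro: le_less_trans)
  have "gauss_lip_norm (\<alpha> - \<beta>) (bessel_deriv \<beta> f) \<le> ereal (C1 * (M + A)) + ereal (C2 * (M + A))"
    unfolding gauss_lip_norm_def using norm lip_const_least(3)[OF lip lip] by (intro add_mono) auto
  also have "\<dots> = ereal (C1 + C2) * gauss_lip_norm \<alpha> f"
    by (simp add: gauss_lip_norm_def M A_def distrib_right)
  finally show ?thesis using int mem by blast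
qed

theorem theorem3p3:
  fixes \<alpha> \<beta> :: real
  assumes "0 < \<beta>" and "\<beta> < \<alpha>" and "\<alpha> < 1"
  shows "(\<forall>f :: real ^ 'd \<Rightarrow> real. f \<in> gauss_lip \<alpha> \<longrightarrow>
            (AE x in gauss_measure. set_integrable lborel {0<..} (bessel_integrand \<beta> f x)) \<and>
            bessel_deriv \<beta> f \<in> gauss_lip (\<alpha> - \<beta>)) \<and>
         (\<exists>C :: real. \<forall>f :: real ^ 'd \<Rightarrow> real. f \<in> gauss_lip \<alpha> \<longrightarrow>
            gauss_lip_norm (\<alpha> - \<beta>) (bessel_deriv \<beta> f) \<le> ereal C * gauss_lip_norm \<alpha> f)"
  using bessel_deriv_gauss_lip[OF assms, where 'a="real ^ 'd"] by blast

end
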